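(* Consider a class of LQCI instances for which the following operations can be performed in time polynomial in the size of the instance: (1) compute the list of possible costs $\Theta$; (2) for each label index $i\in\{1,\dots,|\Omega|\}$ and each cost $\theta_k\in\Theta$, compute $|I_{i,k}|$; (3) for each such $i$ and $\theta_k$, sample uniformly at random from $I_{i,k}$. Then there is a polynomial-time improvisation scheme for that class.
   Context: Fix a finite alphabet $\Sigma$. An LQCI instance is a tuple $\mathcal{C}=(\mathcal{H},\mathcal{K},L,m,n,c,\lambda,\rho,\hat{\alpha},\hat{\beta})$ where $m\le n$ are natural numbers; $\mathcal{H}$ is a hard specification (a set of words over $\Sigma$, given in some encoding); $\mathcal{K}:\Sigma^*\to\mathbb{Q}$ is a cost function; $L:\Sigma^*\to\Omega$ is a label function into a finite set $\Omega=\{\ell_1,\dots,\ell_{|\Omega|}\}$; $c\in\mathbb{Q}^+$; $0\le\lambda\le\rho\le1$ rationals; and for each $i$, rationals $0\le\hat{\alpha}_i\le\hat{\beta}_i\le1$. Let $I=\{w\in\Sigma^*: m\le|w|\le n,\ w\text{ satisfies }\mathcal{H}\}$, $\Theta=\mathcal{K}(I)=\{\theta_1,\dots,\theta_{|\Theta|}\}$, $I_{i,k}=\{w\in I: L(w)=\ell_i,\mathcal{K}(w)=\theta_k\}$, $I_i=\bigcup_kI_{i,k}$. A distribution $D$ over $\Sigma^*$ is improvising if: $\Pr[w\in I\mid w\leftarrow D]=1$; $E[\mathcal{K}(w)\mid w\leftarrow D]\le c$; for all $i$, $\lambda\le\Pr[w\in I_i\mid w\leftarrow D]\le\rho$; and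 for all $i$ and $y\in I_i$, $\hat{\alpha}_i\le\Pr[w=y\mid w\in I_i,w\leftarrow D]\le\hat{\beta}_i$. The instance is feasible if an improvising distribution exists. An improviser is a probabilistic algorithm taking no input, with finite expected running time, whose output distribution is improvising. The LQCI problem is: given $\mathcal{C}$, determine whether it is feasible and, if so, produce an improviser for it. An improvisation scheme for a class of instances is a probabilistic algorithm with finite expected runtime solving the LQCI problem on that class; it is polynomial-time if it runs in (expected) time polynomial in the size of the instance and the improvisers it produces run in expected time polynomial in the size of the instance. *)

theory Defs
  imports "HOL-Probability.Probability" "HOL-Probability.SPMF"
    "HOL-Computational_Algebra.Polynomial" "HOL-Library.Log_Nat" "HOL-Library.Countable"
begin

section \<open>Probabilistic algorithms\<close>

text \<open>
  Algorithms are programs of a small probabilistic WHILE language whose only source of randomness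
  is a fair coin. Programs compute on binary trees with integer leaves, and time is measured by
  the logarithmic cost criterion: evaluating an expression costs the total bit size of the values
  of all its subexpressions. Every operation is computable on a Turing machine in time polynomial
  in the size of its operands, and the total size of newly created values is linear in the cost.
  Hence the cost of a run and the length of the corresponding run of a probabilistic Turing machine
  are polynomially related.
\<close>

datatype val = Num int | Pr val val

fun val_size :: "val \<Rightarrow> nat" where
  "val_size (Num i) = 1 + floorlog 2 (nat \<bar>i\<bar>)"
| "val_size (Pr u v) = 1 + val_size u + val_size v"

datatype unop = Fst | Snd | IsNum

datatype binop = MkPr | Add | Sub | Mul | Div | Mod | Less | Equal

datatype expr = Var nat | Const val | Unary unop expr | Binary binop expr expr

fun bool_val :: "bool \<Rightarrow> val" where
  "bool_val b = Num (if b then 1 else 0)"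

text \<open>Operations applied to operands of the wrong shape return \<open>Num 0\<close>.\<close>

fun apply_un :: "unop \<Rightarrow> val \<Rightarrow> val" where
  "apply_un Fst (Pr u v) = u"
| "apply_un Snd (Pr u v) = v"
| "apply_un IsNum (Num i) = bool_val True"
| "apply_un _ _ = Num 0"

fun apply_bin :: "binop \<Rightarrow> val \<Rightarrow> val \<Rightarrow> val" where
  "apply_bin MkPr u v = Pr u v"
| "apply_bin Equal u v = bool_val (u = v)"
| "apply_bin Add (Num i) (Num j) = Num (i + j)"
| "apply_bin Sub (Num i) (Num j) = Num (i - j)"
| "apply_bin Mul (Num i) (Num j) = Num (i * j)"
| "apply_bin Div (Num i) (Num j) = Num (i div j)"
| "apply_bin Mod (Num i) (Num j) = Num (i mod j)"
| "apply_bin Less (Num i) (Num j) = bool_val (i < j)"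
| "apply_bin _ _ _ = Num 0"

type_synonym store = "nat \<Rightarrow> val"

fun eval :: "expr \<Rightarrow> store \<Rightarrow> val" where
  "eval (Var x) s = s x"
| "eval (Const v) s = v"
| "eval (Unary f e) s = apply_un f (eval e s)"
| "eval (Binary f d e) s = apply_bin f (eval d s) (eval e s)"

fun eval_cost :: "expr \<Rightarrow> store \<Rightarrow> nat" where
  "eval_cost (Var x) s = val_size (s x)"
| "eval_cost (Const v) s = val_size v"
| "eval_cost (Unary f e) s = eval_cost e s + val_size (eval (Unary f e) s)"
| "eval_cost (Binary f d e) s = eval_cost d s + eval_cost e s + val_size (eval (Binary f d e) s)"

text \<open>
  \<open>Call x c e\<close> runs \<open>c\<close> as a (non-recursive) subroutine on a fresh store, with argument \<open>e\<close>, and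
  stores its result in \<open>x\<close>. The argument and the result of a program are held in variable \<open>0\<close>.
  Guards are true iff they do not evaluate to \<open>Num 0\<close>.
\<close>

datatype com =
    Skip
  | Assign nat expr
  | Flip nat
  | Seq com com
  | If expr com com
  | While expr com
  | Call nat com expr

definition init_store :: "val \<Rightarrow> store" where
  "init_store v = (\<lambda>_. Num 0)(0 := v)"

text \<open>
  Least fixed point in the ccpo of subprobability mass functions: the mass missing from the result
  is the probability of divergence.
\<close>

partial_function (spmf) while_spmf :: "('s \<Rightarrow> bool) \<Rightarrow> ('s \<Rightarrow> 's spmf) \<Rightarrow> 's \<Rightarrow> 's spmf" where
  "while_spmf b f s = (if b s then bind_spmf (f s) (while_spmf b f) else return_spmf s)"

text \<open>The joint distribution of the final store and the running time.\<close>

fun exec :: "com \<Rightarrow> store \<Rightarrow> (store \<times> nat) spmf" where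
  "exec Skip s = return_spmf (s, 1)"
| "exec (Assign x e) s = return_spmf (s(x := eval e s), 1 + eval_cost e s)"
| "exec (Flip x) s = map_spmf (\<lambda>b. (s(x := bool_val b), 1)) coin_spmf"
| "exec (Seq c d) s =
    bind_spmf (exec c s) (\<lambda>(s1, t1). map_spmf (\<lambda>(s2, t2). (s2, t1 + t2)) (exec d s1))"
| "exec (If e c d) s =
    map_spmf (\<lambda>(s1, t1). (s1, 1 + eval_cost e s + t1))
      (if eval e s \<noteq> Num 0 then exec c s else exec d s)"
| "exec (While e c) s =
    map_spmf (\<lambda>(s1, t1). (s1, t1 + 1 + eval_cost e s1))
      (while_spmf (\<lambda>(s1, t1). eval e s1 \<noteq> Num 0)
        (\<lambda>(s1, t1). map_spmf (\<lambda>(s2, t2). (s2, t1 + 1 + eval_cost e s1 + t2)) (exec c s1))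
        (s, 0))"
| "exec (Call x c e) s =
    map_spmf (\<lambda>(s1, t1). (s(x := s1 0), 1 + eval_cost e s + t1 + val_size (s1 0)))
      (exec c (init_store (eval e s)))"

definition run :: "com \<Rightarrow> val \<Rightarrow> (val \<times> nat) spmf" where
  "run c v = map_spmf (\<lambda>(s, t). (s 0, t)) (exec c (init_store v))"

definition output_dist :: "com \<Rightarrow> val \<Rightarrow> val spmf" where
  "output_dist c v = map_spmf fst (run c v)"

definition expected_time :: "com \<Rightarrow> val \<Rightarrow> ennreal" where
  "expected_time c v =
    (if lossless_spmf (run c v) then \<integral>\<^sup>+ r. of_nat (snd r) \<partial>measure_spmf (run c v) else \<infinity>)"

section \<open>Encodings\<close>

text \<open>Integers have size logarithmic in their value, so rationals are encoded in binary.\<close>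

fun list_val :: "val list \<Rightarrow> val" where
  "list_val [] = Num 0"
| "list_val (v # vs) = Pr v (list_val vs)"

definition nat_val :: "nat \<Rightarrow> val" where
  "nat_val k = Num (int k)"

definition rat_val :: "rat \<Rightarrow> val" where
  "rat_val q = (case quotient_of q of (a, b) \<Rightarrow> Pr (Num a) (Num b))"

definition word_val :: "'a::countable list \<Rightarrow> val" where
  "word_val w = list_val (map (\<lambda>a. nat_val (to_nat a)) w)"

fun unop_val :: "unop \<Rightarrow> val" where
  "unop_val Fst = Num 0" | "unop_val Snd = Num 1" | "unop_val IsNum = Num 2"

fun binop_val :: "binop \<Rightarrow> val" where
  "binop_val MkPr = Num 0" | "binop_val Add = Num 1" | "binop_val Sub = Num 2"
| "binop_val Mul = Num 3" | "binop_val Div = Num 4" | "binop_val Mod = Num 5"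
| "binop_val Less = Num 6" | "binop_val Equal = Num 7"

fun expr_val :: "expr \<Rightarrow> val" where
  "expr_val (Var x) = list_val [Num 0, nat_val x]"
| "expr_val (Const v) = list_val [Num 1, v]"
| "expr_val (Unary f e) = list_val [Num 2, unop_val f, expr_val e]"
| "expr_val (Binary f d e) = list_val [Num 3, binop_val f, expr_val d, expr_val e]"

fun com_val :: "com \<Rightarrow> val" where
  "com_val Skip = list_val [Num 0]"
| "com_val (Assign x e) = list_val [Num 1, nat_val x, expr_val e]"
| "com_val (Flip x) = list_val [Num 2, nat_val x]"
| "com_val (Seq c d) = list_val [Num 3, com_val c, com_val d]"
| "com_val (If e c d) = list_val [Num 4, expr_val e, com_val c, com_val d]"
| "com_val (While e c) = list_val [Num 5, expr_val e, com_val c]"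
| "com_val (Call x c e) = list_val [Num 6, nat_val x, com_val c, expr_val e]"

lemma list_val_inject [simp]: "list_val us = list_val vs \<longleftrightarrow> us = vs"
proof (induction us arbitrary: vs)
  case Nil
  then show ?case by (cases vs) auto
next
  case (Cons u us)
  then show ?case by (cases vs) auto
qed

lemma nat_val_inject [simp]: "nat_val i = nat_val j \<longleftrightarrow> i = j"
  by (simp add: nat_val_def)

lemma rat_val_inject [simp]: "rat_val p = rat_val q \<longleftrightarrow> p = q"
  by (auto simp: rat_val_def split: prod.splits intro: quotient_of_inject)

lemma word_val_inject [simp]: "word_val u = word_val w \<longleftrightarrow> u = w"
  by (auto simp: word_val_def inj_map_eq_map inj_def)

lemma unop_val_inject [simp]: "unop_val f = unop_val g \<longleftrightarrow> f = g"
  by (cases f; cases g) auto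

lemma binop_val_inject [simp]: "binop_val f = binop_val g \<longleftrightarrow> f = g"
  by (cases f; cases g) auto

lemma expr_val_inject [simp]: "expr_val d = expr_val e \<longleftrightarrow> d = e"
proof (induction d arbitrary: e)
  case (Var x)
  then show ?case by (cases e) auto
next
  case (Const v)
  then show ?case by (cases e) auto
next
  case (Unary f d)
  then show ?case by (cases e) auto
next
  case (Binary f d1 d2)
  then show ?case by (cases e) auto
qed

lemma com_val_inject [simp]: "com_val c = com_val d \<longleftrightarrow> c = d"
proof (induction c arbitrary: d)
  case Skip
  then show ?case by (cases d) auto
next
  case (Assign x e)
  then show ?case by (cases d) auto
next
  case (Flip x)
  then show ?case by (cases d) auto
next
  case (Seq c1 c2)
  then show ?case by (cases d) auto
next
  case (If e c1 c2)
  then show ?case by (cases d) auto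
next
  case (While e c)
  then show ?case by (cases d) auto
next
  case (Call x c e)
  then show ?case by (cases d) auto
qed

section \<open>Labelled quantitative control improvisation\<close>

text \<open>
  The fields \<open>hard_code\<close>, \<open>cost_code\<close> and \<open>label_code\<close> are the descriptions by which the hard
  specification, the cost function and the label function are handed to an algorithm (automata,
  circuits, \<dots>). The list \<open>labels\<close> enumerates \<open>\<Omega>\<close>; label indices start at \<open>0\<close>.
\<close>

record ('a, 'l) lqci =
  hard :: "'a list set"
  hard_code :: val
  cost :: "'a list \<Rightarrow> rat"
  cost_code :: val
  label :: "'a list \<Rightarrow> 'l"
  label_code :: val
  labels :: "'l list"
  min_len :: nat
  max_len :: nat
  cost_bound :: rat
  label_lo :: rat
  label_hi :: rat
  word_lo :: "rat list"
  word_hi :: "rat list"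

definition lqci_instance :: "('a, 'l) lqci \<Rightarrow> bool" where
  "lqci_instance C \<longleftrightarrow>
    min_len C \<le> max_len C \<and>
    distinct (labels C) \<and> range (label C) \<subseteq> set (labels C) \<and>
    0 < cost_bound C \<and>
    0 \<le> label_lo C \<and> label_lo C \<le> label_hi C \<and> label_hi C \<le> 1 \<and>
    length (word_lo C) = length (labels C) \<and> length (word_hi C) = length (labels C) \<and>
    (\<forall>i<length (labels C). 0 \<le> word_lo C ! i \<and> word_lo C ! i \<le> word_hi C ! i \<and> word_hi C ! i \<le> 1)"

definition words :: "('a, 'l) lqci \<Rightarrow> 'a list set" where
  "words C = {w. min_len C \<le> length w \<and> length w \<le> max_len C \<and> w \<in> hard C}"

definition costs :: "('a, 'l) lqci \<Rightarrow> rat set" where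
  "costs C = cost C ` words C"

definition class_words :: "('a, 'l) lqci \<Rightarrow> nat \<Rightarrow> rat \<Rightarrow> 'a list set" where
  "class_words C i \<theta> = {w \<in> words C. label C w = labels C ! i \<and> cost C w = \<theta>}"

definition label_words :: "('a, 'l) lqci \<Rightarrow> nat \<Rightarrow> 'a list set" where
  "label_words C i = (\<Union>\<theta>\<in>costs C. class_words C i \<theta>)"

text \<open>
  The bounds on the conditional probability are imposed only where it is defined, that is, for
  labels of positive probability (\<^const>\<open>cond_prob\<close> would be \<open>0\<close> otherwise).
\<close>

definition improvising :: "('a, 'l) lqci \<Rightarrow> 'a list pmf \<Rightarrow> bool" where
  "improvising C D \<longleftrightarrow>
    measure_pmf.prob D (words C) = 1 \<and>
    measure_pmf.expectation D (\<lambda>w. of_rat (cost C w)) \<le> (of_rat (cost_bound C) :: real) \<and>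
    (\<forall>i<length (labels C).
      of_rat (label_lo C) \<le> measure_pmf.prob D (label_words C i) \<and>
      measure_pmf.prob D (label_words C i) \<le> of_rat (label_hi C)) \<and>
    (\<forall>i<length (labels C). \<forall>y\<in>label_words C i. measure_pmf.prob D (label_words C i) > 0 \<longrightarrow>
      of_rat (word_lo C ! i) \<le> cond_prob (measure_pmf D) (\<lambda>w. w = y) (\<lambda>w. w \<in> label_words C i) \<and>
      cond_prob (measure_pmf D) (\<lambda>w. w = y) (\<lambda>w. w \<in> label_words C i) \<le> of_rat (word_hi C ! i))"

definition feasible :: "('a, 'l) lqci \<Rightarrow> bool" where
  "feasible C \<longleftrightarrow> (\<exists>D. improvising C D)"

text \<open>A program taking no input is one run on the dummy argument \<open>Num 0\<close>.\<close>

definition improviser :: "('a::countable, 'l) lqci \<Rightarrow> com \<Rightarrow> bool" where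
  "improviser C P \<longleftrightarrow>
    expected_time P (Num 0) < \<infinity> \<and>
    (\<exists>D. improvising C D \<and> output_dist P (Num 0) = map_spmf word_val (spmf_of_pmf D))"

section \<open>Polynomial-time operations and improvisation schemes\<close>

text \<open>
  The parameter \<open>nc\<close> is the encoding of the length bounds; both unary and binary are covered.
\<close>

definition inst_val :: "(nat \<Rightarrow> val) \<Rightarrow> ('a, 'l) lqci \<Rightarrow> val" where
  "inst_val nc C = list_val
    [hard_code C, cost_code C, label_code C, nc (min_len C), nc (max_len C),
     rat_val (cost_bound C), rat_val (label_lo C), rat_val (label_hi C),
     list_val (map rat_val (word_lo C)), list_val (map rat_val (word_hi C))]"

definition inst_size :: "(nat \<Rightarrow> val) \<Rightarrow> ('a, 'l) lqci \<Rightarrow> nat" where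
  "inst_size nc C = val_size (inst_val nc C)"

definition poly_time_costs :: "(nat \<Rightarrow> val) \<Rightarrow> ('a, 'l) lqci set \<Rightarrow> bool" where
  "poly_time_costs nc S \<longleftrightarrow> (\<exists>P (p :: nat poly). \<forall>C\<in>S.
    expected_time P (inst_val nc C) \<le> of_nat (poly p (inst_size nc C)) \<and>
    (\<exists>\<theta>s. distinct \<theta>s \<and> set \<theta>s = costs C \<and>
      output_dist P (inst_val nc C) = return_spmf (list_val (map rat_val \<theta>s))))"

definition query_val :: "(nat \<Rightarrow> val) \<Rightarrow> ('a, 'l) lqci \<Rightarrow> nat \<Rightarrow> rat \<Rightarrow> val" where
  "query_val nc C i \<theta> = list_val [inst_val nc C, nat_val i, rat_val \<theta>]"

definition poly_time_counting :: "(nat \<Rightarrow> val) \<Rightarrow> ('a, 'l) lqci set \<Rightarrow> bool" where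
  "poly_time_counting nc S \<longleftrightarrow> (\<exists>P (p :: nat poly).
    \<forall>C\<in>S. \<forall>i<length (labels C). \<forall>\<theta>\<in>costs C.
      expected_time P (query_val nc C i \<theta>) \<le> of_nat (poly p (inst_size nc C)) \<and>
      output_dist P (query_val nc C i \<theta>) = return_spmf (nat_val (card (class_words C i \<theta>))))"

text \<open>Nothing is required of the sampler on an empty set, where no uniform distribution exists.\<close>

definition poly_time_sampling :: "(nat \<Rightarrow> val) \<Rightarrow> ('a::countable, 'l) lqci set \<Rightarrow> bool" where
  "poly_time_sampling nc S \<longleftrightarrow> (\<exists>P (p :: nat poly).
    \<forall>C\<in>S. \<forall>i<length (labels C). \<forall>\<theta>\<in>costs C. class_words C i \<theta> \<noteq> {} \<longrightarrow>
      expected_time P (query_val nc C i \<theta>) \<le> of_nat (poly p (inst_size nc C)) \<and>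
      output_dist P (query_val nc C i \<theta>) = map_spmf word_val (spmf_of_set (class_words C i \<theta>)))"

text \<open>The answer is \<open>Num 0\<close> for an infeasible instance; otherwise it contains an improviser.\<close>

fun answer_val :: "com option \<Rightarrow> val" where
  "answer_val None = Num 0"
| "answer_val (Some P) = Pr (Num 1) (com_val P)"

definition correct_answer :: "('a::countable, 'l) lqci \<Rightarrow> val \<Rightarrow> bool" where
  "correct_answer C r \<longleftrightarrow>
    (if feasible C then \<exists>P. r = answer_val (Some P) \<and> improviser C P else r = answer_val None)"

definition improvisation_scheme ::
    "(nat \<Rightarrow> val) \<Rightarrow> ('a::countable, 'l) lqci set \<Rightarrow> com \<Rightarrow> bool" where
  "improvisation_scheme nc S A \<longleftrightarrow> (\<forall>C\<in>S.
    expected_time A (inst_val nc C) < \<infinity> \<and>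
    (\<forall>r\<in>set_spmf (output_dist A (inst_val nc C)). correct_answer C r))"

definition poly_time_improvisation_scheme ::
    "(nat \<Rightarrow> val) \<Rightarrow> ('a::countable, 'l) lqci set \<Rightarrow> com \<Rightarrow> bool" where
  "poly_time_improvisation_scheme nc S A \<longleftrightarrow>
    improvisation_scheme nc S A \<and>
    (\<exists>p :: nat poly. \<forall>C\<in>S.
      expected_time A (inst_val nc C) \<le> of_nat (poly p (inst_size nc C))) \<and>
    (\<exists>q :: nat poly. \<forall>C\<in>S. \<forall>P.
      answer_val (Some P) \<in> set_spmf (output_dist A (inst_val nc C)) \<longrightarrow>
      expected_time P (Num 0) \<le> of_nat (poly q (inst_size nc C)))"

end

theory Submission
  imports Defs
begin

text \<open>
  Within a label, the cheapest conditional distribution gives every word the lower bound of its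
  probability and spends the remaining mass greedily on the cheapest words; it may be taken to be
  uniform on each class of words of equal label and cost. The same greedy choice between the labels,
  ordered by the minimal conditional costs so obtained, minimises the expected cost. Hence the instance
  is feasible iff this distribution meets the cost bound. An improviser draws a label, then a cost,
  from the greedy weights, and then calls the uniform sampler of the class.

  Multiplied by a common denominator \<open>D\<close> of all rationals of the instance, the greedy weights are
  integers given by closed formulas with sums and products over labels and costs. Running times are
  therefore bounded once and for all for a small language of such formulas, and all randomness
  reduces to uniform sampling from \<open>{0..<D}\<close> by rejection.
\<close>

text \<open>The main obstacle is that expected polynomial time does not compose: a rare huge
  intermediate value can leave the mean time of the first stage small and still make the mean of a
  polynomial in its size infinite. Hence a second stage is bounded uniformly over all possible
  outputs of the first, and a random value enters a further computation only with an explicit bound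
  on its size. For the random numbers of the improviser this is the size of \<open>D\<close>. A
  value computed deterministically has size at most input size plus mean time, so terms compose
  freely. Rejection is forced by the fair coin: in bounded time all probabilities are dyadic, and
  \<open>1 / D\<close> in general is not. A label whose word bounds no distribution can meet must
  have probability 0, where the conditional bounds are void. The greedy choice between labels ranges
  over the other labels, and such a label is tolerated only if the lower label bound is 0. An
  improvising distribution may have irrational probabilities, so the integral greedy weights are
  compared with real competitors.\<close>

section \<open>Loops as least fixed points of subprobability mass functions\<close>

lemma nn_integral_bind_spmf:
  "(\<integral>\<^sup>+ y. g y \<partial>measure_spmf (bind_spmf p f)) = (\<integral>\<^sup>+ x. \<integral>\<^sup>+ y. g y \<partial>measure_spmf (f x) \<partial>measure_spmf p)"
  by (simp add: measure_spmf_bind o_def space_subprob_algebra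
      nn_integral_bind[where B = "count_space UNIV"] subprob_space_measure_spmf)

lemma nn_integral_measure_spmf_mono:
  assumes "\<And>x. x \<in> set_spmf p \<Longrightarrow> f x \<le> g x"
  shows "(\<integral>\<^sup>+ x. f x \<partial>measure_spmf p) \<le> (\<integral>\<^sup>+ x. g x \<partial>measure_spmf p)"
  using assms by (intro nn_integral_mono_AE) simp

text \<open>Makes upper bounds on expected time admissible for fixed-point induction. The chain may
  be uncountable, but its limit has countable support, and on a countable set monotone convergence
  holds for arbitrary chains; so all integrals are first moved to that support.\<close>

lemma nn_integral_lub_spmf:
  assumes chain: "Complete_Partial_Order.chain (ord_spmf (=)) Y" and Y: "Y \<noteq> {}"
  shows "(\<integral>\<^sup>+ x. f x \<partial>measure_spmf (lub_spmf Y)) = (SUP p\<in>Y. \<integral>\<^sup>+ x. f x \<partial>measure_spmf p)"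
proof -
  let ?L = "lub_spmf Y"
  have sub: "set_spmf p \<subseteq> set_spmf ?L" if "p \<in> Y" for p
    using that by (auto simp: set_lub_spmf[OF chain])
  have "(\<integral>\<^sup>+ x. f x \<partial>measure_spmf ?L) =
      (\<integral>\<^sup>+ x. (SUP p\<in>Y. ennreal (spmf p x) * f x) \<partial>count_space (set_spmf ?L))"
    by (simp add: nn_integral_measure_spmf' ennreal_spmf_lub_spmf[OF chain Y] SUP_mult_right_ennreal)
  also have "\<dots> = (SUP p\<in>Y. \<integral>\<^sup>+ x. ennreal (spmf p x) * f x \<partial>count_space (set_spmf ?L))"
  proof (rule nn_integral_monotone_convergence_SUP_countable)
    show "Complete_Partial_Order.chain (\<le>) ((\<lambda>p x. ennreal (spmf p x) * f x) ` Y)"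
      using chain
      by (rule chain_imageI) (auto simp: le_fun_def intro!: mult_right_mono dest: ord_spmf_eq_leD)
  qed (use Y in simp_all)
  also have "\<dots> = (SUP p\<in>Y. \<integral>\<^sup>+ x. f x \<partial>measure_spmf p)"
  proof (intro SUP_cong refl)
    fix p assume "p \<in> Y"
    show "(\<integral>\<^sup>+ x. ennreal (spmf p x) * f x \<partial>count_space (set_spmf ?L)) =
        (\<integral>\<^sup>+ x. f x \<partial>measure_spmf p)"
      using sub[OF \<open>p \<in> Y\<close>]
      by (auto simp: nn_integral_measure_spmf nn_integral_count_space_indicator
          spmf_eq_0_set_spmf subset_eq intro!: nn_integral_cong split: split_indicator)
  qed
  finally show ?thesis .
qed

text \<open>Fixed-point induction with a predicate that may depend on the start state. It yields
  support invariants and upper bounds on time. Termination with probability one fails at the bottom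
  element and has to come from elsewhere.\<close>

lemma while_spmf_admissible_induct:
  assumes adm: "\<And>s. ccpo.admissible lub_spmf (ord_spmf (=)) (\<lambda>p. P s p)"
    and bot: "\<And>s. P s (return_pmf None)"
    and step: "\<And>F s. (\<And>s. P s (F s)) \<Longrightarrow> P s (if b s then bind_spmf (f s) F else return_spmf s)"
  shows "P s (while_spmf b f s)"
proof -
  have "\<forall>s. P s (while_spmf b f s)"
  proof (induction rule: while_spmf.fixp_induct)
    case 1
    show ?case
      by (intro admissible_all, rule admissible_subst[OF adm])
        (auto intro: mcont_call)
  next
    case 2
    show ?case by (simp add: bot)
  next
    case (3 F)
    then show ?case using step by blast
  qed
  then show ?thesis by blast
qed

lemma while_spmf_invariant:
  assumes step: "\<And>s r. I s \<Longrightarrow> b s \<Longrightarrow> r \<in> set_spmf (f s) \<Longrightarrow> I r"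
    and "I s" "r \<in> set_spmf (while_spmf b f s)"
  shows "I r"
proof -
  have "I s \<longrightarrow> (\<forall>r\<in>set_spmf (while_spmf b f s). I r)"
  proof (rule while_spmf_admissible_induct[where P = "\<lambda>s p. I s \<longrightarrow> (\<forall>r\<in>set_spmf p. I r)"], goal_cases)
    case (1 s)
    show ?case by (rule ccpo.admissibleI) (auto simp: set_lub_spmf)
  next
    case (2 s)
    show ?case by simp
  next
    case (3 F s)
    show ?case
    proof (intro impI ballI)
      fix r assume I: "I s" and r: "r \<in> set_spmf (if b s then bind_spmf (f s) F else return_spmf s)"
      show "I r"
      proof (cases "b s")
        case True
        then obtain r' where "r' \<in> set_spmf (f s)" "r \<in> set_spmf (F r')"
          using r by (auto simp: set_bind_spmf bind_UNION)
        then show ?thesis using 3 step[OF I True] by blast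
      qed (use r I in simp)
    qed
  qed
  then show ?thesis using assms(2,3) by blast
qed

text \<open>The clock is part of the loop state, but neither guard nor body looks at it, so a later
  start only shifts the final time. An unfolded loop, whose remainder starts at a positive time, can
  thus be read as a fresh execution of the same loop.\<close>

lemma while_spmf_time_shift:
  fixes f :: "'s \<Rightarrow> ('s \<times> nat) spmf" and b :: "'s \<Rightarrow> bool" and k :: "'s \<Rightarrow> nat"
  defines "W \<equiv> while_spmf (\<lambda>(s, t). b s)
    (\<lambda>(s, t). map_spmf (\<lambda>(s', t'). (s', t + 1 + k s + t')) (f s))"
  shows "W (s, d + t) = map_spmf (\<lambda>(s', t'). (s', d + t')) (W (s, t))"
proof -
  let ?b = "\<lambda>(s, t). b s"
  let ?f = "\<lambda>(s, t). map_spmf (\<lambda>(s', t'). (s', t + 1 + k s + t')) (f s)"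
  have "\<forall>s t d. W (s, d + t) = map_spmf (\<lambda>(s', t'). (s', d + t')) (W (s, t))"
    unfolding W_def
  proof (induction rule: while_spmf.fixp_induct)
    case 1
    show ?case
      by (intro admissible_all admissible_eq_mcontI) (auto intro: cont_intro)
  next
    case 2
    show ?case by simp
  next
    case (3 F)
    show ?case
    proof (intro allI, goal_cases)
      case (1 s t d)
      define G where "G = F ?b ?f"
      have G: "G (s, d + t) = map_spmf (\<lambda>(s', t'). (s', d + t')) (G (s, t))" for s t d
        using 3 by (simp add: G_def)
      have "bind_spmf (?f (s, d + t)) G =
          bind_spmf (f s) (\<lambda>(s', t'). G (s', d + (t + 1 + k s + t')))"
        by (simp add: bind_map_spmf o_def split_def add.assoc)
      also have "\<dots> = map_spmf (\<lambda>(s', t'). (s', d + t')) (bind_spmf (?f (s, t)) G)"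
        by (subst G) (simp add: map_spmf_bind_spmf bind_map_spmf o_def split_def)
      finally have "bind_spmf (?f (s, d + t)) G =
          map_spmf (\<lambda>(s', t'). (s', d + t')) (bind_spmf (?f (s, t)) G)" .
      then show ?case by (simp add: G_def)
    qed
  qed
  then show ?thesis by blast
qed

lemma exec_While_unfold:
  "exec (While e c) s =
    (if eval e s \<noteq> Num 0
     then bind_spmf (exec c s)
       (\<lambda>(s1, t1). map_spmf (\<lambda>(s2, t2). (s2, 1 + eval_cost e s + t1 + t2)) (exec (While e c) s1))
     else return_spmf (s, 1 + eval_cost e s))"
proof -
  define W where "W = while_spmf (\<lambda>(s1, t1). eval e s1 \<noteq> Num 0)
    (\<lambda>(s1, t1). map_spmf (\<lambda>(s2, t2). (s2, t1 + 1 + eval_cost e s1 + t2)) (exec c s1))"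
  have shift: "W (s, d) = map_spmf (\<lambda>(s', t'). (s', d + t')) (W (s, 0))" for s d
    using while_spmf_time_shift[of "\<lambda>s. eval e s \<noteq> Num 0" "eval_cost e" "exec c" s d 0]
    by (simp add: W_def)
  have ex: "exec (While e c) s = map_spmf (\<lambda>(s1, t1). (s1, t1 + 1 + eval_cost e s1)) (W (s, 0))" for s
    by (simp add: W_def)
  have "W (s, 0) = (if eval e s \<noteq> Num 0 then bind_spmf (exec c s)
      (\<lambda>(s1, t1). W (s1, 1 + eval_cost e s + t1)) else return_spmf (s, 0))"
    unfolding W_def by (subst while_spmf.simps)
      (auto simp: map_spmf_conv_bind_spmf intro!: bind_spmf_cong split: prod.splits)
  also have "\<dots> = (if eval e s \<noteq> Num 0 then bind_spmf (exec c s)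
      (\<lambda>(s1, t1). map_spmf (\<lambda>(s', t'). (s', 1 + eval_cost e s + t1 + t')) (W (s1, 0)))
      else return_spmf (s, 0))"
    by (simp add: shift[of _ "Suc d" for d])
  finally have eq: "W (s, 0) = \<dots>" .
  show ?thesis
    unfolding ex
    by (subst eq) (simp add: map_spmf_bind_spmf o_def split_def spmf.map_comp algebra_simps)
qed

section \<open>Sizes of values during a run\<close>

lemma val_size_pos: "1 \<le> val_size v"
  by (cases v) auto

lemma eval_size_le_cost: "val_size (eval e s) \<le> eval_cost e s"
  by (cases e) auto

text \<open>Every value created during a run has been paid for.\<close>

lemma exec_size_bound:
  assumes "\<And>x. val_size (s x) \<le> B" and "(s', t) \<in> set_spmf (exec c s)"
  shows "val_size (s' x) \<le> B + t"
proof -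
  have "1 \<le> B" using assms(1) val_size_pos order_trans by blast
  with assms show ?thesis
  proof (induction c arbitrary: s B s' t x)
    case Skip
    then show ?case by (auto intro: le_SucI)
  next
    case (Assign y e)
    then show ?case
      using eval_size_le_cost[of e]
      by (auto intro!: le_SucI intro: trans_le_add1 order_trans[OF _ le_add2])
  next
    case (Flip y)
    then show ?case by (auto simp: floorlog_def intro!: le_SucI)
  next
    case (Seq c d)
    then obtain s1 t1 t2 where *: "(s1, t1) \<in> set_spmf (exec c s)"
      "(s', t2) \<in> set_spmf (exec d s1)" "t = t1 + t2"
      by (auto simp: set_bind_spmf bind_UNION)
    have "val_size (s1 x) \<le> B + t1" for x
      using Seq.IH(1) Seq.prems *(1) by blast
    then have "val_size (s' x) \<le> B + t1 + t2"
      using Seq.IH(2)[OF _ *(2)] Seq.prems(3) by (simp add: trans_le_add1)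
    then show ?case by (simp add: *)
  next
    case (If e c d)
    then obtain t1 where *: "(s', t1) \<in> set_spmf (if eval e s \<noteq> Num 0 then exec c s else exec d s)"
      "t1 \<le> t"
      by auto
    have "val_size (s' x) \<le> B + t1"
    proof (cases "eval e s \<noteq> Num 0")
      case True
      show ?thesis using If.IH(1)[OF If.prems(1) _ If.prems(3)] *(1) True by simp
    next
      case False
      show ?thesis using If.IH(2)[OF If.prems(1) _ If.prems(3)] *(1) False by simp
    qed
    with *(2) show ?case by simp
  next
    case (While e c)
    \<comment> \<open>The time in the loop state counts everything paid so far, so the claimed bound
      is itself the invariant.\<close>
    let ?I = "\<lambda>(s', t). \<forall>x. val_size (s' x) \<le> B + t"
    let ?b = "\<lambda>(s1, t1). eval e s1 \<noteq> Num 0"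
    let ?f = "\<lambda>(s1, t1). map_spmf (\<lambda>(s2, t2). (s2, t1 + 1 + eval_cost e s1 + t2)) (exec c s1)"
    have "exec (While e c) s = map_spmf (\<lambda>(s1, t1). (s1, t1 + 1 + eval_cost e s1)) (while_spmf ?b ?f (s, 0))"
      by simp
    then obtain t1 where t1: "(s', t1) \<in> set_spmf (while_spmf ?b ?f (s, 0))" "t = t1 + 1 + eval_cost e s'"
      using While.prems(2) by auto
    have "?I (s', t1)"
    proof (rule while_spmf_invariant[OF _ _ t1(1)])
      show "?I (s, 0)" using While.prems(1) by simp
      fix st r assume I: "?I st" and r: "r \<in> set_spmf (?f st)"
      obtain s1 k where st: "st = (s1, k)" by (cases st)
      obtain s2 t2 where 2: "(s2, t2) \<in> set_spmf (exec c s1)" "r = (s2, k + 1 + eval_cost e s1 + t2)"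
        using r by (auto simp: st)
      have "val_size (s2 x) \<le> B + k + t2" for x
        using While.IH[OF _ 2(1)] While.prems(3) I by (simp add: st trans_le_add1)
      then have "val_size (s2 x) \<le> B + (k + 1 + eval_cost e s1 + t2)" for x
        by (rule order_trans) simp
      then show "?I r" by (simp add: 2(2))
    qed
    then have "val_size (s' x) \<le> B + t1" by simp
    then show ?case by (rule order_trans) (simp add: t1(2))
  next
    case (Call y c e)
    then show ?case
      by (auto, metis le_SucI trans_le_add1)
  qed
qed

lemma init_store_simps [simp]:
  "init_store v 0 = v" "x \<noteq> 0 \<Longrightarrow> init_store v x = Num 0" "(init_store v)(0 := u) = init_store u"
  by (auto simp: init_store_def)

lemma run_size_bound:
  assumes "(u, t) \<in> set_spmf (run c v)"
  shows "val_size u \<le> val_size v + t"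
proof -
  obtain s where "(s, t) \<in> set_spmf (exec c (init_store v))" "u = s 0"
    using assms by (auto simp: run_def)
  moreover have "val_size (init_store v x) \<le> val_size v" for x
    using val_size_pos[of v] by (auto simp: init_store_def floorlog_def)
  ultimately show ?thesis using exec_size_bound by blast
qed

section \<open>Expected polynomial time\<close>

text \<open>Since \<open>expected_time\<close> is infinite unless the run is lossless, the finite
  bound also asserts termination with probability one.\<close>

definition runs :: "com \<Rightarrow> val \<Rightarrow> val spmf \<Rightarrow> nat \<Rightarrow> bool" where
  "runs c v M T \<longleftrightarrow> output_dist c v = M \<and> expected_time c v \<le> of_nat T"

abbreviation mean_time :: "('s \<times> nat) spmf \<Rightarrow> ennreal" where
  "mean_time p \<equiv> (\<integral>\<^sup>+ r. of_nat (snd r) \<partial>measure_spmf p)"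

lemma mean_return: "(\<integral>\<^sup>+ r. f r \<partial>measure_spmf (return_spmf x)) = f x"
  by (simp add: measure_spmf_return_spmf nn_integral_return)

lemma runs_iff:
  "runs c v M T \<longleftrightarrow> map_spmf fst (run c v) = M \<and> lossless_spmf M \<and> mean_time (run c v) \<le> of_nat T"
  by (auto simp: runs_def expected_time_def output_dist_def top_unique split: if_splits)

lemma runs_cong: "runs c v M T \<Longrightarrow> M = M' \<Longrightarrow> T \<le> T' \<Longrightarrow> runs c v M' T'"
  unfolding runs_def by (metis of_nat_mono order_trans)

lemma nn_integral_spmf_affine_le:
  "(\<integral>\<^sup>+ x. of_nat (k + l * f x) \<partial>measure_spmf p) \<le>
    of_nat k + of_nat l * (\<integral>\<^sup>+ x. of_nat (f x) \<partial>measure_spmf p)"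
proof -
  have "(\<integral>\<^sup>+ x. of_nat (k + l * f x) \<partial>measure_spmf p) =
      of_nat k * emeasure (measure_spmf p) (space (measure_spmf p)) +
      of_nat l * (\<integral>\<^sup>+ x. of_nat (f x) \<partial>measure_spmf p)"
    by (simp add: nn_integral_add nn_integral_cmult)
  also have "\<dots> \<le> of_nat k * 1 + of_nat l * (\<integral>\<^sup>+ x. of_nat (f x) \<partial>measure_spmf p)"
    by (intro add_right_mono mult_left_mono measure_spmf.subprob_emeasure_le_1) simp_all
  finally show ?thesis by simp
qed

text \<open>Overheads are affine in the time of the part that causes them, because its result has
  size at most input size plus time. Linearity is essential: the mean of \<open>t\<close> does not
  control the mean of \<open>t * t\<close>.\<close>

lemma mean_time_map_le:
  assumes "mean_time p \<le> of_nat T"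
    and "\<And>u t. (u, t) \<in> set_spmf p \<Longrightarrow> snd (h (u, t)) \<le> k + l * t"
  shows "mean_time (map_spmf h p) \<le> of_nat (k + l * T)"
proof -
  have "mean_time (map_spmf h p) \<le> (\<integral>\<^sup>+ r. of_nat (k + l * snd r) \<partial>measure_spmf p)"
    using assms(2) by (auto intro!: nn_integral_measure_spmf_mono simp: of_nat_mono simp del: of_nat_add of_nat_mult)
  also have "\<dots> \<le> of_nat k + of_nat l * mean_time p"
    by (rule nn_integral_spmf_affine_le)
  also have "\<dots> \<le> of_nat k + of_nat l * of_nat T"
    by (intro add_left_mono mult_left_mono assms) simp
  finally show ?thesis by simp
qed

lemma mean_time_bind_le:
  assumes "mean_time p \<le> of_nat T"
    and "\<And>u t. (u, t) \<in> set_spmf p \<Longrightarrow> mean_time (f (u, t)) \<le> of_nat (k + l * t)"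
  shows "mean_time (bind_spmf p f) \<le> of_nat (k + l * T)"
proof -
  have "mean_time (bind_spmf p f) \<le> (\<integral>\<^sup>+ r. of_nat (k + l * snd r) \<partial>measure_spmf p)"
    unfolding nn_integral_bind_spmf
    using assms(2) by (intro nn_integral_measure_spmf_mono) auto
  also have "\<dots> \<le> of_nat k + of_nat l * mean_time p"
    by (rule nn_integral_spmf_affine_le)
  also have "\<dots> \<le> of_nat k + of_nat l * of_nat T"
    by (intro add_left_mono mult_left_mono assms) simp
  finally show ?thesis by simp
qed

text \<open>Composite programs pass their data through variable 0 and reach their parts by
  \<open>Call\<close>. The store between two parts is then again an \<open>init_store\<close>, so
  \<open>run\<close> describes every part completely.\<close>

lemma exec_Call_0:
  "exec (Call 0 c (Var 0)) (init_store v) =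
    map_spmf (\<lambda>(u, t). (init_store u, 1 + val_size v + t + val_size u)) (run c v)"
  by (simp add: run_def spmf.map_comp o_def split_def)

definition then_com :: "com \<Rightarrow> com \<Rightarrow> com" where
  "then_com c d = Seq (Call 0 c (Var 0)) (Call 0 d (Var 0))"

lemma run_then_com:
  "run (then_com c d) v =
    bind_spmf (run c v) (\<lambda>(u, t). map_spmf (\<lambda>(w, t').
      (w, 1 + val_size v + t + val_size u + (1 + val_size u + t' + val_size w))) (run d u))"
  by (simp add: run_def[of "Seq _ _"] then_com_def exec_Call_0 map_spmf_bind_spmf bind_map_spmf
      o_def split_def spmf.map_comp del: exec.simps(7))

text \<open>The bound \<open>T'\<close> must hold for every \<open>u\<close> in the support of
  \<open>M\<close>, and \<open>f\<close> must be bounded affinely in both times: only then does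
  averaging over the first stage leave a bound in terms of its mean \<open>T\<close>.\<close>

lemma runs_bindI:
  assumes run: "run p v = bind_spmf (run c v) (\<lambda>(u, t). map_spmf (\<lambda>(w, t'). (w, f u t w t')) (run d u))"
    and M: "runs c v M T" and N: "\<And>u. u \<in> set_spmf M \<Longrightarrow> runs d u (N u) T'"
    and f: "\<And>u t w t'. val_size u \<le> val_size v + t \<Longrightarrow> val_size w \<le> val_size u + t' \<Longrightarrow>
      f u t w t' \<le> k + l * t + m * t'"
  shows "runs p v (bind_spmf M N) (k + m * T' + l * T)"
  unfolding runs_iff
proof (intro conjI)
  have fst_N: "map_spmf fst (run d u) = N u" if "u \<in> set_spmf M" for u
    using N[OF that] by (simp add: runs_iff)
  have fst_M: "map_spmf fst (run c v) = M" using M by (simp add: runs_iff)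
  have "map_spmf fst (run p v) = bind_spmf (map_spmf fst (run c v)) (\<lambda>u. map_spmf fst (run d u))"
    by (simp add: run map_spmf_bind_spmf bind_map_spmf o_def split_def spmf.map_comp)
  also have "\<dots> = bind_spmf M N"
    unfolding fst_M using fst_N by (intro bind_spmf_cong) auto
  finally show "map_spmf fst (run p v) = bind_spmf M N" .
  show "lossless_spmf (bind_spmf M N)"
    using M N by (auto simp: runs_iff)
  show "mean_time (run p v) \<le> of_nat (k + m * T' + l * T)"
    unfolding run
  proof (rule mean_time_bind_le)
    show "mean_time (run c v) \<le> of_nat T" using M by (simp add: runs_iff)
    fix u t assume ut: "(u, t) \<in> set_spmf (run c v)"
    then have "u \<in> fst ` set_spmf (run c v)" by force
    then have "u \<in> set_spmf M" by (simp flip: fst_M)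
    then have T': "mean_time (run d u) \<le> of_nat T'" using N by (simp add: runs_iff)
    have "mean_time (map_spmf (\<lambda>(w, t'). (w, f u t w t')) (run d u)) \<le> of_nat ((k + l * t) + m * T')"
      by (rule mean_time_map_le[OF T']) (use f run_size_bound[OF ut] run_size_bound[of _ _ d u] in auto)
    then show "mean_time (case (u, t) of (u, t) \<Rightarrow> map_spmf (\<lambda>(w, t'). (w, f u t w t')) (run d u)) \<le>
        of_nat (k + m * T' + l * t)"
      by (simp add: algebra_simps)
  qed
qed

lemma runs_then_com:
  assumes "runs c v M T" and "\<And>u. u \<in> set_spmf M \<Longrightarrow> runs d u (N u) T'"
  shows "runs (then_com c d) v (bind_spmf M N) (2 + 4 * val_size v + 2 * T' + 4 * T)"
  by (rule runs_bindI[OF run_then_com assms]) auto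

text \<open>A called program starts from a fresh store, so an input that is needed again later must
  travel inside the value that is passed on.\<close>

definition keep_com :: "com \<Rightarrow> com" where
  "keep_com c = Seq (Call 1 c (Var 0)) (Assign 0 (Binary MkPr (Var 0) (Var 1)))"

lemma run_keep_com:
  "run (keep_com c) v =
    map_spmf (\<lambda>(u, t). (Pr v u, 3 + 3 * val_size v + t + 3 * val_size u)) (run c v)"
  by (simp add: run_def keep_com_def map_spmf_bind_spmf bind_map_spmf o_def split_def spmf.map_comp
      map_spmf_conv_bind_spmf) (auto intro!: bind_spmf_cong)

lemma runs_keep_com:
  assumes "runs c v M T"
  shows "runs (keep_com c) v (map_spmf (Pr v) M) (3 + 6 * val_size v + 4 * T)"
proof -
  have "mean_time (run (keep_com c) v) \<le> of_nat (3 + 6 * val_size v + 4 * T)"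
    unfolding run_keep_com using assms
    by (intro mean_time_map_le) (auto simp: runs_iff dest!: run_size_bound)
  then show ?thesis
    using assms by (auto simp: runs_iff run_keep_com spmf.map_comp o_def split_def)
qed

lemma runs_Assign: "runs (Assign 0 e) v (return_spmf (eval e (init_store v))) (1 + eval_cost e (init_store v))"
  by (simp add: runs_iff run_def mean_return)

lemma runs_Flip: "runs (Flip 0) v (map_spmf bool_val coin_spmf) 1"
  using measure_spmf.subprob_emeasure_le_1[of coin_spmf]
  by (auto simp: runs_iff run_def spmf.map_comp o_def intro!: map_spmf_cong)

lemma runs_If:
  assumes "eval e (init_store v) \<noteq> Num 0 \<Longrightarrow> runs c v M T"
    and "eval e (init_store v) = Num 0 \<Longrightarrow> runs d v M T"
  shows "runs (If e c d) v M (1 + eval_cost e (init_store v) + T)"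
proof -
  let ?c = "if eval e (init_store v) \<noteq> Num 0 then c else d"
  have "runs ?c v M T" using assms by auto
  moreover have "run (If e c d) v = map_spmf (\<lambda>(u, t). (u, 1 + eval_cost e (init_store v) + t)) (run ?c v)"
    by (simp add: run_def spmf.map_comp o_def split_def)
  ultimately show ?thesis
    unfolding runs_iff
    using mean_time_map_le[where p = "run ?c v" and T = T and l = 1 and k = "1 + eval_cost e (init_store v)"
        and h = "\<lambda>(u, t). (u, 1 + eval_cost e (init_store v) + t)"]
    by (simp add: spmf.map_comp o_def split_def del: nn_integral_map_spmf)
qed

definition loop_com :: "expr \<Rightarrow> com \<Rightarrow> com" where
  "loop_com e c = While e (Call 0 c (Var 0))"

lemma run_loop_com:
  "run (loop_com e c) v =
    (if eval e (init_store v) \<noteq> Num 0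
     then bind_spmf (run c v) (\<lambda>(u, t). map_spmf (\<lambda>(w, t').
       (w, 1 + eval_cost e (init_store v) + (1 + val_size v + t + val_size u) + t')) (run (loop_com e c) u))
     else return_spmf (v, 1 + eval_cost e (init_store v)))"
proof -
  have eq: "run (loop_com e c) v = map_spmf (\<lambda>(s, t). (s 0, t))
    (if eval e (init_store v) \<noteq> Num 0
     then bind_spmf (exec (Call 0 c (Var 0)) (init_store v))
       (\<lambda>(s1, t1). map_spmf (\<lambda>(s2, t2). (s2, 1 + eval_cost e (init_store v) + t1 + t2))
         (exec (loop_com e c) s1))
     else return_spmf (init_store v, 1 + eval_cost e (init_store v)))"
    unfolding run_def loop_com_def by (subst exec_While_unfold) simp
  show ?thesis
    unfolding eq exec_Call_0
    by (auto simp: run_def[of "loop_com e c"] map_spmf_bind_spmf bind_map_spmf o_def split_def spmf.map_comp)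
qed

lemma runs_loop_stop:
  assumes "eval e (init_store v) = Num 0"
  shows "runs (loop_com e c) v (return_spmf v) (1 + eval_cost e (init_store v))"
  using assms by (simp add: runs_iff run_loop_com[of e c v] mean_return)

lemma runs_loop_step:
  assumes "eval e (init_store v) \<noteq> Num 0" and "runs c v M T"
    and "\<And>u. u \<in> set_spmf M \<Longrightarrow> runs (loop_com e c) u (N u) T'"
  shows "runs (loop_com e c) v (bind_spmf M N)
    (2 + eval_cost e (init_store v) + 2 * val_size v + T' + 2 * T)"
proof -
  have "run (loop_com e c) v = bind_spmf (run c v) (\<lambda>(u, t). map_spmf (\<lambda>(w, t').
      (w, 1 + eval_cost e (init_store v) + (1 + val_size v + t + val_size u) + t')) (run (loop_com e c) u))"
    using assms(1) by (subst run_loop_com) simp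
  from runs_bindI[OF this assms(2,3), where k = "2 + eval_cost e (init_store v) + 2 * val_size v" and l = 2 and m = 1]
  show ?thesis by simp
qed

text \<open>
  As all states in \<open>V\<close> have the same successor distribution, the loop retries until it succeeds.
  The time is bounded by a potential that is \<open>4 b\<close> on \<open>V\<close> and \<open>b\<close> elsewhere.
\<close>

lemma runs_loop_retry:
  assumes v: "v \<in> V"
    and V: "\<And>v. v \<in> V \<Longrightarrow> eval e (init_store v) \<noteq> Num 0"
    and stop: "\<And>v. v \<in> set_spmf K \<Longrightarrow> v \<notin> V \<Longrightarrow> eval e (init_store v) = Num 0"
    and body: "\<And>v. v \<in> V \<Longrightarrow> runs c v K T"
    and half: "measure (measure_spmf K) V \<le> 1 / 2"
    and cost: "\<And>v. v \<in> V \<union> set_spmf K \<Longrightarrow> 2 + eval_cost e (init_store v) + 2 * val_size v + 2 * T \<le> b"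
    and M: "\<And>X. X = bind_spmf K (\<lambda>u. if u \<in> V then X else return_spmf u) \<Longrightarrow> X = M"
    and lossless: "lossless_spmf M"
  shows "runs (loop_com e c) v M (4 * b)"
  unfolding runs_iff
proof (intro conjI lossless)
  define X where "X v = map_spmf fst (run (loop_com e c) v)" for v
  have K: "map_spmf fst (run c v) = K" if "v \<in> V" for v
    using body that by (auto simp: runs_iff)
  have X: "X v = bind_spmf K (\<lambda>u. if u \<in> V then X u else return_spmf u)" if "v \<in> V" for v
  proof -
    have "X v = bind_spmf (map_spmf fst (run c v)) X"
      unfolding X_def using V[OF that]
      by (subst run_loop_com) (simp add: map_spmf_bind_spmf bind_map_spmf o_def split_def spmf.map_comp)
    also have "\<dots> = bind_spmf K (\<lambda>u. if u \<in> V then X u else return_spmf u)"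
      unfolding K[OF that]
    proof (rule bind_spmf_cong[OF refl])
      fix u assume "u \<in> set_spmf K"
      then show "X u = (if u \<in> V then X u else return_spmf u)"
        using stop by (auto simp: X_def run_loop_com[of e c u])
    qed
    finally show ?thesis .
  qed
  have same: "X u = X v" if "u \<in> V" for u
    using X[OF that] X[OF v] by simp
  \<comment> \<open>The common output distribution of the states in \<open>V\<close> solves the
    retry equation, whose only solution is \<open>M\<close>. As \<open>M\<close> is lossless,
    termination comes with this identification.\<close>
  have "X v = bind_spmf K (\<lambda>u. if u \<in> V then X v else return_spmf u)"
    using X[OF v] same by (simp cong: if_cong)
  then show "map_spmf fst (run (loop_com e c) v) = M"
    using M unfolding X_def by blast
next
  let ?b = "\<lambda>(s1, t1). eval e s1 \<noteq> Num 0"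
  let ?f = "\<lambda>(s1, t1). map_spmf (\<lambda>(s2, t2). (s2, t1 + 1 + eval_cost e s1 + t2))
    (exec (Call 0 c (Var 0)) s1)"
  \<comment> \<open>The values the loop can hold: those to be retried, and those on which it stops.
    The potential is claimed only for stores built from these.\<close>
  let ?A = "V \<union> {v \<in> set_spmf K. eval e (init_store v) = Num 0}"
  define time where "time = (\<lambda>(s, t). of_nat (t + 1 + eval_cost e s) :: ennreal)"
  let ?m = "\<lambda>p. \<integral>\<^sup>+ r. time r \<partial>measure_spmf p"
  let ?P = "\<lambda>st p. \<forall>v\<in>?A. fst st = init_store v \<longrightarrow>
    ?m p \<le> of_nat (snd st + b) + of_nat (3 * b) * indicator V v"
  have "?P st (while_spmf ?b ?f st)" for st
  proof (rule while_spmf_admissible_induct[where P = ?P], goal_cases)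
    case (1 st)
    show ?case
    proof (intro ccpo.admissibleI ballI impI)
      fix Y v
      assume Y: "Complete_Partial_Order.chain (ord_spmf (=)) Y" "Y \<noteq> {}"
        and P: "\<forall>p\<in>Y. ?P st p" and v: "v \<in> ?A" "fst st = init_store v"
      have "?m p \<le> of_nat (snd st + b) + of_nat (3 * b) * indicator V v" if "p \<in> Y" for p
        using bspec[OF P that] v by blast
      then show "?m (lub_spmf Y) \<le> of_nat (snd st + b) + of_nat (3 * b) * indicator V v"
        unfolding nn_integral_lub_spmf[OF Y] by (rule SUP_least)
    qed
  next
    case (2 st)
    show ?case by simp
  next
    case (3 F st)
    show ?case
    proof (intro ballI impI)
      fix v assume A: "v \<in> ?A" and st1: "fst st = init_store v"
      define t0 where "t0 = snd st"
      have st: "st = (init_store v, t0)" using st1 by (simp add: t0_def prod_eq_iff)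
      show "?m (if ?b st then bind_spmf (?f st) F else return_spmf st)
          \<le> of_nat (snd st + b) + of_nat (3 * b) * indicator V v"
      proof (cases "v \<in> V")
        case False
        then have "t0 + 1 + eval_cost e (init_store v) \<le> t0 + b" using A cost[of v] by simp
        then show ?thesis using A False by (simp add: st mean_return time_def del: of_nat_add of_nat_Suc)
      next
        case True
        let ?k = "eval_cost e (init_store v)"
        have K: "map_spmf fst (run c v) = K" using body[OF True] by (auto simp: runs_iff)
        have bnd: "?m (F (init_store u, t0 + 1 + ?k + (1 + val_size v + t + val_size u)))
            \<le> of_nat (t0 + 2 + ?k + 2 * val_size v + b + 2 * t) + of_nat (3 * b) * indicator V u"
          if ut: "(u, t) \<in> set_spmf (run c v)" for u t
        proof -
          have "u \<in> fst ` set_spmf (run c v)" using ut by force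
          then have "u \<in> set_spmf K" by (simp flip: K)
          then have uA: "u \<in> ?A" using stop by auto
          have "?m (F (init_store u, t0 + 1 + ?k + (1 + val_size v + t + val_size u)))
            \<le> of_nat (t0 + 1 + ?k + (1 + val_size v + t + val_size u) + b) + of_nat (3 * b) * indicator V u"
            by (rule bspec[OF 3 uA, THEN mp, OF fst_conv, unfolded snd_conv])
          also have "\<dots> \<le> of_nat (t0 + 2 + ?k + 2 * val_size v + b + 2 * t) + of_nat (3 * b) * indicator V u"
            using run_size_bound[OF ut] by (intro add_right_mono of_nat_mono) simp
          finally show ?thesis .
        qed
        have "?m (bind_spmf (?f st) F) =
          (\<integral>\<^sup>+ r. ?m (F (init_store (fst r), t0 + 1 + ?k + (1 + val_size v + snd r + val_size (fst r))))
            \<partial>measure_spmf (run c v))"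
          unfolding st prod.case exec_Call_0 nn_integral_bind_spmf
          by (simp add: o_def split_def)
        also have "\<dots> \<le> (\<integral>\<^sup>+ r. of_nat (t0 + 2 + ?k + 2 * val_size v + b + 2 * snd r)
            + of_nat (3 * b) * indicator V (fst r) \<partial>measure_spmf (run c v))"
          using bnd by (intro nn_integral_measure_spmf_mono) auto
        also have "\<dots> = (\<integral>\<^sup>+ r. of_nat (t0 + 2 + ?k + 2 * val_size v + b + 2 * snd r) \<partial>measure_spmf (run c v))
            + of_nat (3 * b) * (\<integral>\<^sup>+ r. indicator V (fst r) \<partial>measure_spmf (run c v))"
          by (simp add: nn_integral_add nn_integral_cmult del: of_nat_add of_nat_mult)
        \<comment> \<open>One round costs at most \<open>b\<close>, and any successor has potential
          at least \<open>b\<close>. The excess \<open>3 * b\<close> is incurred with probability at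
          most 1/2, and \<open>3 * b / 2\<close> is rounded up to \<open>2 * b\<close>, so that the
          total is again \<open>4 * b\<close>.\<close>
        also have "\<dots> \<le> of_nat (t0 + 2 * b) + of_nat (2 * b)"
        proof (rule add_mono)
          have "(\<integral>\<^sup>+ r. of_nat (t0 + 2 + ?k + 2 * val_size v + b + 2 * snd r) \<partial>measure_spmf (run c v))
              \<le> of_nat (t0 + 2 + ?k + 2 * val_size v + b) + of_nat 2 * mean_time (run c v)"
            by (rule nn_integral_spmf_affine_le)
          also have "\<dots> \<le> of_nat (t0 + 2 + ?k + 2 * val_size v + b) + of_nat 2 * of_nat T"
            using body[OF True] by (intro add_left_mono mult_left_mono) (auto simp: runs_iff)
          also have "\<dots> = of_nat (t0 + b + (2 + ?k + 2 * val_size v + 2 * T))"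
            by (simp add: algebra_simps)
          also have "\<dots> \<le> of_nat (t0 + 2 * b)"
            using cost[of v] True by (intro of_nat_mono) auto
          finally show "(\<integral>\<^sup>+ r. of_nat (t0 + 2 + ?k + 2 * val_size v + b + 2 * snd r) \<partial>measure_spmf (run c v))
              \<le> of_nat (t0 + 2 * b)" .
          have "(\<integral>\<^sup>+ r. indicator V (fst r) \<partial>measure_spmf (run c v)) = emeasure (measure_spmf K) V"
            by (simp flip: K nn_integral_indicator add: o_def)
          also have "\<dots> \<le> ennreal (1 / 2)"
            unfolding measure_spmf.emeasure_eq_measure using half by (intro ennreal_leI)
          finally have "of_nat (3 * b) * (\<integral>\<^sup>+ r. indicator V (fst r) \<partial>measure_spmf (run c v)) \<le>
              of_nat (3 * b) * ennreal (1 / 2)"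
            by (intro mult_left_mono) simp_all
          also have "\<dots> \<le> of_nat (2 * b)"
            unfolding ennreal_of_nat_eq_real_of_nat
            by (subst ennreal_mult[symmetric]) (auto intro!: ennreal_leI)
          finally show "of_nat (3 * b) * (\<integral>\<^sup>+ r. indicator V (fst r) \<partial>measure_spmf (run c v)) \<le> of_nat (2 * b)" .
        qed
        also have "\<dots> = of_nat (snd st + b) + of_nat (3 * b) * indicator V v"
        proof -
          have "(t0 + 2 * b) + 2 * b = (t0 + b) + 3 * b" by simp
          then show ?thesis
            using True by (simp only: st snd_conv indicator_simps mult_1_right flip: of_nat_add)
        qed
        finally show ?thesis using V[OF True] by (simp add: st)
      qed
    qed
  qed
  from this[of "(init_store v, 0)"] have "?m (while_spmf ?b ?f (init_store v, 0)) \<le> of_nat b + of_nat (3 * b)"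
    using v by auto
  also have "\<dots> = of_nat (4 * b)" unfolding of_nat_add[symmetric] by (rule arg_cong[where f = of_nat]) simp
  finally show "mean_time (run (loop_com e c) v) \<le> of_nat (4 * b)"
    by (simp add: run_def loop_com_def spmf.map_comp o_def split_def time_def del: exec.simps(7) of_nat_add of_nat_Suc of_nat_mult)
qed

section \<open>Polynomial bounds and families of programs\<close>

definition poly_bounded :: "'x set \<Rightarrow> ('x \<Rightarrow> nat) \<Rightarrow> ('x \<Rightarrow> nat) \<Rightarrow> bool" where
  "poly_bounded X sz g \<longleftrightarrow> (\<exists>p :: nat poly. \<forall>x\<in>X. g x \<le> poly p (sz x))"

named_theorems pb_intros

lemma pb_const [pb_intros]: "poly_bounded X sz (\<lambda>_. k)"
  unfolding poly_bounded_def by (intro exI[of _ "[:k:]"]) simp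

lemma pb_size [pb_intros]: "poly_bounded X sz sz"
  unfolding poly_bounded_def by (intro exI[of _ "[:0, 1:]"]) simp

lemma pb_add [pb_intros]:
  assumes "poly_bounded X sz f" "poly_bounded X sz g"
  shows "poly_bounded X sz (\<lambda>x. f x + g x)"
proof -
  from assms obtain p q where "\<forall>x\<in>X. f x \<le> poly p (sz x)" "\<forall>x\<in>X. g x \<le> poly q (sz x)"
    unfolding poly_bounded_def by blast
  then show ?thesis
    unfolding poly_bounded_def by (intro exI[of _ "p + q"]) (auto intro: add_mono)
qed

lemma pb_mult [pb_intros]:
  assumes "poly_bounded X sz f" "poly_bounded X sz g"
  shows "poly_bounded X sz (\<lambda>x. f x * g x)"
proof -
  from assms obtain p q where "\<forall>x\<in>X. f x \<le> poly p (sz x)" "\<forall>x\<in>X. g x \<le> poly q (sz x)"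
    unfolding poly_bounded_def by blast
  then show ?thesis
    unfolding poly_bounded_def by (intro exI[of _ "p * q"]) (auto intro: mult_mono)
qed

lemma pb_mono:
  assumes "poly_bounded X sz g" "\<And>x. x \<in> X \<Longrightarrow> f x \<le> g x"
  shows "poly_bounded X sz f"
  using assms unfolding poly_bounded_def by (meson order_trans)

lemma pb_reindex:
  assumes "poly_bounded Y sz g" "\<And>x. x \<in> X \<Longrightarrow> h x \<in> Y" "\<And>x. x \<in> X \<Longrightarrow> sz' x = sz (h x)"
  shows "poly_bounded X sz' (\<lambda>x. g (h x))"
  using assms unfolding poly_bounded_def by metis

lemma pb_Pr:
  assumes "poly_bounded X sz (\<lambda>x. val_size (b x))" "poly_bounded X sz (\<lambda>x. val_size (c x))"
  shows "poly_bounded X sz (\<lambda>x. val_size (Pr (b x) (c x)))"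
proof -
  have "poly_bounded X sz (\<lambda>x. 1 + val_size (b x) + val_size (c x))"
    by (intro pb_intros assms)
  then show ?thesis by simp
qed

lemma pb_poly [pb_intros]: "poly_bounded X sz (\<lambda>x. poly p (sz x))"
  unfolding poly_bounded_def by blast

text \<open>
  Inputs are indexed by \<open>X\<close> because the value to be computed need not be a function of the encoded
  input, and time is polynomial in \<open>sz x\<close> because intermediate inputs are larger than the instance.
\<close>

definition poly_sampled ::
    "'x set \<Rightarrow> ('x \<Rightarrow> nat) \<Rightarrow> ('x \<Rightarrow> val) \<Rightarrow> ('x \<Rightarrow> val spmf) \<Rightarrow> bool" where
  "poly_sampled X sz a M \<longleftrightarrow> poly_bounded X sz (\<lambda>x. val_size (a x)) \<and>
    (\<exists>c g. poly_bounded X sz g \<and> (\<forall>x\<in>X. runs c (a x) (M x) (g x)))"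

abbreviation poly_computed ::
    "'x set \<Rightarrow> ('x \<Rightarrow> nat) \<Rightarrow> ('x \<Rightarrow> val) \<Rightarrow> ('x \<Rightarrow> val) \<Rightarrow> bool" where
  "poly_computed X sz a b \<equiv> poly_sampled X sz a (\<lambda>x. return_spmf (b x))"

lemma poly_sampledI:
  assumes "poly_bounded X sz (\<lambda>x. val_size (a x))" "poly_bounded X sz g"
    "\<And>x. x \<in> X \<Longrightarrow> runs c (a x) (M x) (g x)"
  shows "poly_sampled X sz a M"
  using assms unfolding poly_sampled_def by blast

lemma poly_sampledE:
  assumes "poly_sampled X sz a M"
  obtains c p where "\<And>x. x \<in> X \<Longrightarrow> runs c (a x) (M x) (poly p (sz x))"
proof -
  obtain c g where g: "poly_bounded X sz g" "\<forall>x\<in>X. runs c (a x) (M x) (g x)"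
    using assms unfolding poly_sampled_def by blast
  obtain p where "\<forall>x\<in>X. g x \<le> poly p (sz x)"
    using g(1) unfolding poly_bounded_def by blast
  with g(2) that show ?thesis by (meson runs_cong)
qed

lemma poly_sampled_input: "poly_sampled X sz a M \<Longrightarrow> poly_bounded X sz (\<lambda>x. val_size (a x))"
  by (simp add: poly_sampled_def)

lemma poly_sampled_cong:
  assumes "poly_sampled X sz a M" "\<And>x. x \<in> X \<Longrightarrow> a x = b x" "\<And>x. x \<in> X \<Longrightarrow> M x = N x"
  shows "poly_sampled X sz b N"
proof -
  obtain c p where *: "\<And>x. x \<in> X \<Longrightarrow> runs c (a x) (M x) (poly p (sz x))"
    using poly_sampledE[OF assms(1)] by blast
  have "poly_bounded X sz (\<lambda>x. val_size (b x))"
    by (rule pb_mono[OF poly_sampled_input[OF assms(1)]]) (simp add: assms)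
  then show ?thesis
    by (rule poly_sampledI[OF _ pb_poly[of _ _ p], where c = c]) (use * assms in auto)
qed

lemma poly_sampled_reindex:
  assumes "poly_sampled Y sz a M" "\<And>x. x \<in> X \<Longrightarrow> h x \<in> Y" "\<And>x. x \<in> X \<Longrightarrow> sz' x = sz (h x)"
  shows "poly_sampled X sz' (\<lambda>x. a (h x)) (\<lambda>x. M (h x))"
proof -
  obtain c g where g: "poly_bounded Y sz g" "\<forall>x\<in>Y. runs c (a x) (M x) (g x)"
    using assms unfolding poly_sampled_def by blast
  show ?thesis
  proof (rule poly_sampledI)
    show "poly_bounded X sz' (\<lambda>x. val_size (a (h x)))"
      by (rule pb_reindex[OF poly_sampled_input[OF assms(1)] assms(2,3)])
    show "poly_bounded X sz' (\<lambda>x. g (h x))"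
      by (rule pb_reindex[OF g(1) assms(2,3)])
  qed (use g assms in auto)
qed

lemma poly_sampled_subset:
  assumes "poly_sampled Y sz a M" "X \<subseteq> Y"
  shows "poly_sampled X sz a M"
  using poly_sampled_reindex[OF assms(1), of X "\<lambda>x. x" sz] assms(2) by auto

text \<open>The second family is indexed by \<open>x\<close> together with the random output
  \<open>u\<close>, but measured by \<open>sz x\<close> alone. Its membership in
  \<open>poly_sampled\<close> therefore includes a size bound for all outputs \<open>u\<close>,
  which is what makes the composition legitimate.\<close>

lemma poly_sampled_then:
  assumes M: "poly_sampled X sz a M"
    and N: "poly_sampled {(x, u). x \<in> X \<and> u \<in> set_spmf (M x)} (\<lambda>y. sz (fst y)) snd (\<lambda>(x, u). N x u)"
  shows "poly_sampled X sz a (\<lambda>x. bind_spmf (M x) (N x))"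
proof -
  obtain c p where c: "\<And>x. x \<in> X \<Longrightarrow> runs c (a x) (M x) (poly p (sz x))"
    using poly_sampledE[OF M] by blast
  obtain d q where "\<And>y. y \<in> {(x, u). x \<in> X \<and> u \<in> set_spmf (M x)} \<Longrightarrow>
      runs d (snd y) ((\<lambda>(x, u). N x u) y) (poly q (sz (fst y)))"
    using poly_sampledE[OF N] by (metis (no_types, lifting))
  from this[of "(x, u)" for x u]
  have d: "runs d u (N x u) (poly q (sz x))" if "x \<in> X" "u \<in> set_spmf (M x)" for x u
    using that by simp
  show ?thesis
  proof (rule poly_sampledI)
    show "poly_bounded X sz (\<lambda>x. 2 + 4 * val_size (a x) + 2 * poly q (sz x) + 4 * poly p (sz x))"
      by (intro pb_intros poly_sampled_input[OF M])
    show "runs (then_com c d) (a x) (bind_spmf (M x) (N x))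
        (2 + 4 * val_size (a x) + 2 * poly q (sz x) + 4 * poly p (sz x))" if "x \<in> X" for x
      using c d that by (intro runs_then_com) auto
  qed (rule poly_sampled_input[OF M])
qed

lemma poly_sampled_keep:
  assumes M: "poly_sampled X sz a M"
  shows "poly_sampled X sz a (\<lambda>x. map_spmf (Pr (a x)) (M x))"
proof -
  obtain c p where c: "\<And>x. x \<in> X \<Longrightarrow> runs c (a x) (M x) (poly p (sz x))"
    using poly_sampledE[OF M] by blast
  show ?thesis
    by (rule poly_sampledI[OF _ _ runs_keep_com[OF c]]) (intro pb_intros poly_sampled_input[OF M] | assumption)+
qed

section \<open>Bit sizes of arithmetic and the cost of expressions\<close>

lemma val_size_Num_le_iff: "val_size (Num i) \<le> Suc k \<longleftrightarrow> \<bar>i\<bar> < 2 ^ k"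
proof -
  have "nat \<bar>i\<bar> < 2 ^ k \<longleftrightarrow> \<bar>i\<bar> < 2 ^ k" by (simp add: nat_less_iff)
  then show ?thesis by (simp add: floorlog_le_iff)
qed

lemma abs_less_power_val_size: "\<bar>i\<bar> < 2 ^ (val_size (Num i) - 1)"
  using val_size_Num_le_iff[of i "val_size (Num i) - 1"] by simp

lemma val_size_add_le: "val_size (Num (i + j)) \<le> val_size (Num i) + val_size (Num j)"
proof -
  let ?m = "val_size (Num i) - 1" let ?n = "val_size (Num j) - 1"
  have "\<bar>i + j\<bar> < 2 ^ ?m + 2 ^ ?n"
    using abs_less_power_val_size[of i] abs_less_power_val_size[of j] by linarith
  also have "(2::int) ^ ?m + 2 ^ ?n \<le> 2 ^ (?m + ?n) + 2 ^ (?m + ?n)"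
    by (intro add_mono power_increasing) auto
  also have "\<dots> = 2 ^ Suc (?m + ?n)" by simp
  finally have "val_size (Num (i + j)) \<le> Suc (Suc (?m + ?n))"
    by (subst val_size_Num_le_iff)
  then show ?thesis by simp
qed

lemma val_size_mult_le: "val_size (Num (i * j)) \<le> val_size (Num i) + val_size (Num j)"
proof -
  let ?m = "val_size (Num i) - 1" let ?n = "val_size (Num j) - 1"
  have "\<bar>i * j\<bar> < 2 ^ ?m * 2 ^ ?n"
    unfolding abs_mult by (intro mult_strict_mono abs_less_power_val_size) auto
  also have "(2::int) ^ ?m * 2 ^ ?n = 2 ^ (?m + ?n)"
    by (simp add: power_add)
  finally have "val_size (Num (i * j)) \<le> Suc (?m + ?n)"
    by (subst val_size_Num_le_iff)
  then show ?thesis by simp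
qed

lemma val_size_mono_abs: "\<bar>i\<bar> \<le> \<bar>j\<bar> \<Longrightarrow> val_size (Num i) \<le> val_size (Num j)"
  using abs_less_power_val_size[of j] val_size_Num_le_iff[of i "val_size (Num j) - 1"] by simp

lemma abs_div_le: "\<bar>i div j\<bar> \<le> \<bar>i :: int\<bar>"
proof -
  have pos: "\<bar>i div j\<bar> \<le> \<bar>i\<bar>" if "0 < j" for i j :: int
  proof (cases "0 \<le> i")
    case True
    then show ?thesis using that zdiv_mono2[of i 1 j] by (simp add: pos_imp_zdiv_nonneg_iff)
  next
    case False
    then show ?thesis using that zdiv_mono2_neg[of i 1 j] div_neg_pos_less0[of i j] by simp
  qed
  show ?thesis
    using pos[of j i] pos[of "- j" "- i"] by (cases j "0 :: int" rule: linorder_cases) auto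
qed

lemma val_size_apply_un: "val_size (apply_un f v) \<le> val_size v + 2"
  by (cases "(f, v)" rule: apply_un.cases) (auto simp: floorlog_def)

lemma val_size_apply_bin: "val_size (apply_bin f u v) \<le> val_size u + val_size v + 2"
proof -
  let ?s = "\<lambda>i j. Suc (Suc (val_size (Num i) + val_size (Num j)))"
  have "val_size (Num (i + j)) \<le> ?s i j" for i j
    by (intro le_SucI val_size_add_le)
  moreover have "val_size (Num (i - j)) \<le> ?s i j" for i j
    using val_size_add_le[of i "- j"] by simp
  moreover have "val_size (Num (i * j)) \<le> ?s i j" for i j
    by (intro le_SucI val_size_mult_le)
  moreover have "val_size (Num (i div j)) \<le> ?s i j" for i j
    by (intro le_SucI trans_le_add1 val_size_mono_abs abs_div_le)
  moreover have "val_size (Num (i mod j)) \<le> ?s i j" for i j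
  proof (cases "j = 0")
    case False
    then have "\<bar>i mod j\<bar> \<le> \<bar>j\<bar>" using abs_mod_less[of j i] by simp
    from val_size_mono_abs[OF this] show ?thesis by simp
  qed simp
  moreover have "val_size (Num 1) \<le> Suc (Suc n)" "val_size (Num 0) \<le> Suc n" for n
    by (simp_all add: floorlog_def)
  ultimately show ?thesis
    by (cases "(f, u, v)" rule: apply_bin.cases) (auto simp del: val_size.simps(1))
qed

text \<open>Each operation, even multiplication, yields a value of size at most the sum of its
  operand sizes plus 2, so a fixed expression enlarges its input by a constant factor only. The
  constants double because the operands are paid for once by themselves and once within the result.
  Additive constants are absorbed by \<open>1 \<le> val_size v\<close>.\<close>

lemma eval_cost_linear:
  obtains C where "\<And>v. eval_cost e (init_store v) \<le> C * val_size v"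
proof -
  have "\<exists>C. \<forall>v. eval_cost e (init_store v) \<le> C * val_size v"
  proof (induction e)
    case (Var x)
    have "val_size (init_store v x) \<le> val_size v" for v
      using val_size_pos[of v] by (auto simp: init_store_def floorlog_def)
    then show ?case by (intro exI[of _ 1]) simp
  next
    case (Const u)
    have "val_size u * 1 \<le> val_size u * val_size v" for v
      by (intro mult_left_mono val_size_pos) simp
    then show ?case by (intro exI[of _ "val_size u"]) simp
  next
    case (Unary f e)
    then obtain C where C: "\<forall>v. eval_cost e (init_store v) \<le> C * val_size v" by blast
    have "eval_cost (Unary f e) (init_store v) \<le> (2 * C + 2) * val_size v" for v
      using C[rule_format, of v] eval_size_le_cost[of e "init_store v"] val_size_pos[of v]
        val_size_apply_un[of f "eval e (init_store v)"]
      by (simp add: algebra_simps)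
    then show ?case by blast
  next
    case (Binary f d e)
    then obtain C D where C: "\<forall>v. eval_cost d (init_store v) \<le> C * val_size v"
      and D: "\<forall>v. eval_cost e (init_store v) \<le> D * val_size v" by blast
    have "eval_cost (Binary f d e) (init_store v) \<le> (2 * C + 2 * D + 2) * val_size v" for v
      using C[rule_format, of v] D[rule_format, of v] eval_size_le_cost[of e "init_store v"]
        eval_size_le_cost[of d "init_store v"] val_size_pos[of v]
        val_size_apply_bin[of f "eval d (init_store v)" "eval e (init_store v)"]
      by (simp add: algebra_simps)
    then show ?case by blast
  qed
  then show ?thesis using that by blast
qed

section \<open>Closure properties of polynomial-time families\<close>

lemma poly_computed_eval:
  assumes "poly_bounded X sz (\<lambda>x. val_size (a x))"
  shows "poly_computed X sz a (\<lambda>x. eval e (init_store (a x)))"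
proof -
  obtain C where C: "\<And>v. eval_cost e (init_store v) \<le> C * val_size v"
    using eval_cost_linear by blast
  have "poly_bounded X sz (\<lambda>x. C * val_size (a x))"
    by (intro pb_intros assms)
  then have "poly_bounded X sz (\<lambda>x. eval_cost e (init_store (a x)))"
    by (rule pb_mono) (rule C)
  then show ?thesis
    by (intro poly_sampledI[OF assms _ runs_Assign] pb_intros)
qed

lemma poly_computed_id:
  assumes "poly_bounded X sz (\<lambda>x. val_size (a x))"
  shows "poly_computed X sz a a"
  using poly_computed_eval[OF assms, of "Var 0"] by simp

definition map_com :: "expr \<Rightarrow> com \<Rightarrow> com" where
  "map_com e c = Seq (Call 0 c (Var 0)) (Assign 0 e)"

lemma run_map_com:
  "run (map_com e c) v = map_spmf (\<lambda>(u, t). (eval e (init_store u),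
    1 + val_size v + t + val_size u + (1 + eval_cost e (init_store u)))) (run c v)"
  by (simp add: run_def[of "Seq _ _"] map_com_def exec_Call_0 map_spmf_bind_spmf bind_map_spmf
      map_spmf_conv_bind_spmf o_def split_def del: exec.simps(7))

lemma poly_sampled_map:
  assumes M: "poly_sampled X sz a M"
  shows "poly_sampled X sz a (\<lambda>x. map_spmf (\<lambda>u. eval e (init_store u)) (M x))"
proof -
  obtain c p where c: "\<And>x. x \<in> X \<Longrightarrow> runs c (a x) (M x) (poly p (sz x))"
    using poly_sampledE[OF M] by blast
  obtain C where C: "\<And>v. eval_cost e (init_store v) \<le> C * val_size v"
    using eval_cost_linear by blast
  let ?T = "\<lambda>x. 2 + (2 + C) * val_size (a x) + (2 + C) * poly p (sz x)"
  show ?thesis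
  proof (rule poly_sampledI[OF poly_sampled_input[OF M]])
    show "poly_bounded X sz ?T" by (intro pb_intros poly_sampled_input[OF M])
    fix x assume "x \<in> X"
    then have r: "runs c (a x) (M x) (poly p (sz x))" by (rule c)
    have "1 + val_size (a x) + t + val_size u + (1 + eval_cost e (init_store u))
        \<le> 2 + (2 + C) * val_size (a x) + (2 + C) * t" if "(u, t) \<in> set_spmf (run c (a x))" for u t
    proof -
      have u: "val_size u \<le> val_size (a x) + t" using that by (rule run_size_bound)
      then have "C * val_size u \<le> C * (val_size (a x) + t)" by (rule mult_left_mono) simp
      then show ?thesis using C[of u] u by (simp add: algebra_simps)
    qed
    then have "mean_time (run (map_com e c) (a x)) \<le> of_nat (?T x)"
      unfolding run_map_com using r by (intro mean_time_map_le) (auto simp: runs_iff)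
    moreover have "map_spmf fst (run (map_com e c) (a x)) =
        map_spmf (\<lambda>u. eval e (init_store u)) (map_spmf fst (run c (a x)))"
      by (simp add: run_map_com spmf.map_comp o_def split_def)
    ultimately show "runs (map_com e c) (a x) (map_spmf (\<lambda>u. eval e (init_store u)) (M x)) (?T x)"
      using r unfolding runs_iff by simp
  qed
qed

lemma poly_sampled_flip:
  assumes "poly_bounded X sz (\<lambda>x. val_size (a x))"
  shows "poly_sampled X sz a (\<lambda>_. map_spmf bool_val coin_spmf)"
  by (rule poly_sampledI[OF assms _ runs_Flip]) (rule pb_const)

lemma poly_sampled_if:
  assumes M: "poly_sampled {x \<in> X. eval e (init_store (a x)) \<noteq> Num 0} sz a M"
    and N: "poly_sampled {x \<in> X. eval e (init_store (a x)) = Num 0} sz a N"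
    and a: "poly_bounded X sz (\<lambda>x. val_size (a x))"
  shows "poly_sampled X sz a (\<lambda>x. if eval e (init_store (a x)) \<noteq> Num 0 then M x else N x)"
proof -
  obtain c p where c: "\<And>x. x \<in> X \<Longrightarrow> eval e (init_store (a x)) \<noteq> Num 0 \<Longrightarrow> runs c (a x) (M x) (poly p (sz x))"
    using poly_sampledE[OF M, unfolded mem_Collect_eq] by (metis (no_types, lifting))
  obtain d q where d: "\<And>x. x \<in> X \<Longrightarrow> eval e (init_store (a x)) = Num 0 \<Longrightarrow> runs d (a x) (N x) (poly q (sz x))"
    using poly_sampledE[OF N, unfolded mem_Collect_eq] by (metis (no_types, lifting))
  obtain C where C: "\<And>v. eval_cost e (init_store v) \<le> C * val_size v"
    using eval_cost_linear by blast
  let ?T = "\<lambda>x. 1 + C * val_size (a x) + (poly p (sz x) + poly q (sz x))"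
  show ?thesis
  proof (rule poly_sampledI[OF a])
    show "poly_bounded X sz ?T"
      by (intro pb_intros a)
    fix x assume x: "x \<in> X"
    have "runs (If e c d) (a x) (if eval e (init_store (a x)) \<noteq> Num 0 then M x else N x)
        (1 + eval_cost e (init_store (a x)) + (poly p (sz x) + poly q (sz x)))"
      by (rule runs_If) (use c[OF x] d[OF x] in \<open>auto intro: runs_cong\<close>)
    then show "runs (If e c d) (a x) (if eval e (init_store (a x)) \<noteq> Num 0 then M x else N x) (?T x)"
      by (rule runs_cong) (use C in auto)
  qed
qed

text \<open>Every terminating run yields the same value \<open>b x\<close>, and each takes at least
  the time by which that value exceeds the input in size. So does the mean. For a random output this
  argument would miss large values of small probability.\<close>

lemma poly_computed_output:
  assumes "poly_computed X sz a b"
  shows "poly_bounded X sz (\<lambda>x. val_size (b x))"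
proof -
  obtain c p where c: "\<And>x. x \<in> X \<Longrightarrow> runs c (a x) (return_spmf (b x)) (poly p (sz x))"
    using poly_sampledE[OF assms] by blast
  have "poly_bounded X sz (\<lambda>x. val_size (a x) + poly p (sz x))"
    by (intro pb_intros poly_sampled_input[OF assms])
  then show ?thesis
  proof (rule pb_mono)
    fix x assume "x \<in> X"
    then have r: "map_spmf fst (run c (a x)) = return_spmf (b x)" "mean_time (run c (a x)) \<le> of_nat (poly p (sz x))"
      using c by (auto simp: runs_iff)
    have "lossless_spmf (run c (a x))"
      using arg_cong[OF r(1), of lossless_spmf] by simp
    then have w: "emeasure (measure_spmf (run c (a x))) UNIV = 1"
      by (simp add: lossless_spmf_def weight_spmf_def measure_spmf.emeasure_eq_measure space_measure_spmf)
    have "val_size (b x) - val_size (a x) \<le> t" if "(u, t) \<in> set_spmf (run c (a x))" for u t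
    proof -
      have "u \<in> fst ` set_spmf (run c (a x))" using that by force
      also have "\<dots> = {b x}" by (simp add: r(1) flip: set_map_spmf)
      finally show ?thesis using run_size_bound[OF that] by simp
    qed
    then have "(\<integral>\<^sup>+ r. of_nat (val_size (b x) - val_size (a x)) \<partial>measure_spmf (run c (a x))) \<le> mean_time (run c (a x))"
      by (intro nn_integral_measure_spmf_mono) (auto intro!: of_nat_mono simp del: of_nat_diff)
    then have "(of_nat (val_size (b x) - val_size (a x)) :: ennreal) \<le> mean_time (run c (a x))"
      by (simp add: w space_measure_spmf)
    from order_trans[OF this r(2)] show "val_size (b x) \<le> val_size (a x) + poly p (sz x)"
      by simp
  qed
qed

lemma poly_sampled_comp:
  assumes b: "poly_computed X sz a b" and M: "poly_sampled X sz b M"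
  shows "poly_sampled X sz a M"
proof -
  have "poly_sampled {(x, u). x \<in> X \<and> u = b x} (\<lambda>y. sz (fst y)) (\<lambda>y. b (fst y)) (\<lambda>y. M (fst y))"
    by (rule poly_sampled_reindex[OF M]) auto
  then have "poly_sampled {(x, u). x \<in> X \<and> u \<in> set_spmf (return_spmf (b x))} (\<lambda>y. sz (fst y)) snd (\<lambda>(x, u). M x)"
    by (rule poly_sampled_cong[OF poly_sampled_subset]) auto
  from poly_sampled_then[OF b this] show ?thesis by simp
qed

lemma poly_sampled_bind:
  assumes M: "poly_sampled X sz a M"
    and N: "poly_sampled {(x, u). x \<in> X \<and> u \<in> set_spmf (M x)} (\<lambda>y. sz (fst y))
      (\<lambda>y. Pr (a (fst y)) (snd y)) (\<lambda>y. N (fst y) (snd y))"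
  shows "poly_sampled X sz a (\<lambda>x. bind_spmf (M x) (N x))"
proof -
  have "poly_sampled {(x, u). x \<in> X \<and> u \<in> set_spmf (map_spmf (Pr (a x)) (M x))} (\<lambda>y. sz (fst y)) snd
      (\<lambda>(x, u). N x (apply_un Snd u))"
    by (rule poly_sampled_cong[OF poly_sampled_reindex[OF N, where h = "\<lambda>(x, u). (x, apply_un Snd u)"]]) auto
  from poly_sampled_then[OF poly_sampled_keep[OF M] this]
  show ?thesis by (simp add: bind_map_spmf o_def)
qed

text \<open>The first result is carried along beside the input while the second is computed, and the
  nested pair is rearranged at the end.\<close>

lemma poly_computed_Pr:
  assumes b: "poly_computed X sz a b" and c: "poly_computed X sz a c"
  shows "poly_computed X sz a (\<lambda>x. Pr (b x) (c x))"
proof -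
  have 1: "poly_computed X sz a (\<lambda>x. Pr (a x) (b x))"
    using poly_sampled_keep[OF b] by simp
  have fst: "poly_computed X sz (\<lambda>x. Pr (a x) (b x)) a"
    using poly_computed_eval[OF poly_computed_output[OF 1], of "Unary Fst (Var 0)"] by simp
  have 2: "poly_computed X sz (\<lambda>x. Pr (a x) (b x)) (\<lambda>x. Pr (Pr (a x) (b x)) (c x))"
    using poly_sampled_keep[OF poly_sampled_comp[OF fst c]] by simp
  show ?thesis
    using poly_sampled_map[OF poly_sampled_comp[OF 1 2],
        of "Binary MkPr (Unary Snd (Unary Fst (Var 0))) (Unary Snd (Var 0))"] by simp
qed

lemma poly_computed_un:
  assumes "poly_computed X sz a b"
  shows "poly_computed X sz a (\<lambda>x. apply_un f (b x))"
  using poly_sampled_map[OF assms, of "Unary f (Var 0)"] by simp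

lemma poly_computed_bin:
  assumes "poly_computed X sz a b" "poly_computed X sz a c"
  shows "poly_computed X sz a (\<lambda>x. apply_bin f (b x) (c x))"
  using poly_sampled_map[OF poly_computed_Pr[OF assms], of "Binary f (Unary Fst (Var 0)) (Unary Snd (Var 0))"]
  by simp

lemma poly_computed_const:
  assumes "poly_bounded X sz (\<lambda>x. val_size (a x))"
  shows "poly_computed X sz a (\<lambda>_. v)"
  using poly_computed_eval[OF assms, of "Const v"] by simp

lemma poly_computed_if:
  assumes b: "poly_computed X sz a b" and M: "poly_sampled {x \<in> X. b x \<noteq> Num 0} sz a M"
    and N: "poly_sampled {x \<in> X. b x = Num 0} sz a N"
  shows "poly_sampled X sz a (\<lambda>x. if b x \<noteq> Num 0 then M x else N x)"
proof -
  have 1: "poly_computed X sz a (\<lambda>x. Pr (a x) (b x))"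
    using poly_sampled_keep[OF b] by simp
  let ?e = "Unary Snd (Var 0)"
  have fst: "poly_computed X sz (\<lambda>x. Pr (a x) (b x)) a"
    using poly_computed_eval[OF poly_computed_output[OF 1], of "Unary Fst (Var 0)"] by simp
  have "poly_sampled X sz (\<lambda>x. Pr (a x) (b x))
      (\<lambda>x. if eval ?e (init_store (Pr (a x) (b x))) \<noteq> Num 0 then M x else N x)"
    by (rule poly_sampled_if[OF _ _ poly_computed_output[OF 1]])
      (auto intro: poly_sampled_comp[OF poly_sampled_subset[OF fst]] M N)
  from poly_sampled_comp[OF 1 this] show ?thesis by simp
qed

text \<open>The rank bounds the number of rounds, and \<open>sz\<close> stays constant, so every
  round has the same bound. The sizes of all states in \<open>Y\<close> are bounded beforehand:
  polynomially many rounds of a polynomial-time body could otherwise square a number repeatedly and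
  produce one of exponential size.\<close>

lemma poly_sampled_loop:
  assumes body: "poly_sampled {y \<in> Y. eval e (init_store (a y)) \<noteq> Num 0} sz a (\<lambda>y. map_spmf a (N y))"
    and step: "\<And>y y'. y \<in> Y \<Longrightarrow> eval e (init_store (a y)) \<noteq> Num 0 \<Longrightarrow> y' \<in> set_spmf (N y) \<Longrightarrow>
      y' \<in> Y \<and> \<rho> y' < \<rho> y \<and> sz y' = sz y"
    and \<rho>: "poly_bounded Y sz \<rho>"
    and a: "poly_bounded Y sz (\<lambda>y. val_size (a y))"
    and M: "\<And>y. y \<in> Y \<Longrightarrow> M y = (if eval e (init_store (a y)) \<noteq> Num 0
      then bind_spmf (N y) M else return_spmf (a y))"
  shows "poly_sampled Y sz a M"
proof -
  obtain c p where c: "\<And>y. y \<in> Y \<Longrightarrow> eval e (init_store (a y)) \<noteq> Num 0 \<Longrightarrow>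
      runs c (a y) (map_spmf a (N y)) (poly p (sz y))"
    using poly_sampledE[OF body, unfolded mem_Collect_eq] by (metis (no_types, lifting))
  obtain C where C: "\<And>v. eval_cost e (init_store v) \<le> C * val_size v"
    using eval_cost_linear by blast
  obtain q where q: "\<And>y. y \<in> Y \<Longrightarrow> val_size (a y) \<le> poly q (sz y)"
    using a unfolding poly_bounded_def by blast
  define B where "B n = 2 + C * poly q n + 2 * poly q n + 2 * poly p n" for n
  have "runs (loop_com e c) (a y) (M y) (Suc (\<rho> y) * B (sz y))" if "y \<in> Y" for y
    using that
  proof (induction "\<rho> y" arbitrary: y rule: less_induct)
    case less
    have cost: "eval_cost e (init_store (a y)) \<le> C * poly q (sz y)"
      by (rule order_trans[OF C]) (intro mult_left_mono q less; simp)
    show ?case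
    proof (cases "eval e (init_store (a y)) = Num 0")
      case True
      have "runs (loop_com e c) (a y) (M y) (1 + eval_cost e (init_store (a y)))"
        using runs_loop_stop[OF True] M[OF less(2)] True by simp
      then show ?thesis
        by (rule runs_cong) (use cost in \<open>auto simp: B_def\<close>)
    next
      case False
      let ?L = "loop_com e c"
      have IH: "runs ?L (a y') (M y') (\<rho> y * B (sz y))" if "y' \<in> set_spmf (N y)" for y'
      proof -
        have "Suc (\<rho> y') \<le> \<rho> y" "sz y' = sz y" "y' \<in> Y"
          using step[OF less(2) False that] by auto
        moreover from this(1) have "Suc (\<rho> y') * B (sz y) \<le> \<rho> y * B (sz y)"
          by (rule mult_right_mono) simp
        ultimately show ?thesis
          using less(1)[of y'] runs_cong[OF _ refl] by (metis Suc_le_lessD)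
      qed
      \<comment> \<open>As \<open>a\<close> may identify states, the distribution of the remaining
        loop is attached to the encoded value by \<open>output_dist\<close>, and only afterwards
        identified with \<open>M\<close>.\<close>
      have "runs ?L (a y) (bind_spmf (map_spmf a (N y)) (output_dist ?L))
          (2 + eval_cost e (init_store (a y)) + 2 * val_size (a y) + \<rho> y * B (sz y) + 2 * poly p (sz y))"
      proof (rule runs_loop_step[OF False c[OF less(2) False]])
        fix u assume "u \<in> set_spmf (map_spmf a (N y))"
        then show "runs ?L u (output_dist ?L u) (\<rho> y * B (sz y))"
          using IH by (auto simp: runs_def)
      qed
      moreover have "bind_spmf (map_spmf a (N y)) (output_dist ?L) = M y"
        using IH False M[OF less(2)]
        by (auto simp: bind_map_spmf o_def runs_def intro!: bind_spmf_cong)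
      moreover have "2 + eval_cost e (init_store (a y)) + 2 * val_size (a y) + \<rho> y * B (sz y) + 2 * poly p (sz y)
          \<le> Suc (\<rho> y) * B (sz y)"
        using cost q[OF less(2)] by (simp add: B_def)
      ultimately show ?thesis by (rule runs_cong)
    qed
  qed
  moreover have "poly_bounded Y sz (\<lambda>y. Suc (\<rho> y) * B (sz y))"
    unfolding B_def Suc_eq_plus1 by (intro pb_intros \<rho>)
  ultimately show ?thesis
    by (intro poly_sampledI[OF a])
qed

section \<open>Greedy allocation\<close>

text \<open>
  Closed form of the greedy allocation: every index receives its lower bound, and the rest of \<open>tot\<close> is
  spent in the order of the keys. What is spent before \<open>k\<close> is the capacity of all smaller keys, so
  that no sorting is needed.
\<close>

definition fill ::
    "'i set \<Rightarrow> ('i \<Rightarrow> int) \<Rightarrow> ('i \<Rightarrow> 'a) \<Rightarrow> ('i \<Rightarrow> 'a) \<Rightarrow> 'a \<Rightarrow> 'i \<Rightarrow> 'a :: linordered_idom" where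
  "fill I key l u tot k = l k + max 0 (min (u k - l k)
    (tot - sum l I - (\<Sum>j\<in>I. if key j < key k then u j - l j else 0)))"

text \<open>Programs compute the allocation in integers, while the optimality proof compares it with
  real allocations.\<close>

lemma of_int_fill:
  "of_int (fill I key l u tot k) =
    fill I key (\<lambda>k. of_int (l k)) (\<lambda>k. of_int (u k)) (of_int tot) k"
proof -
  have "(\<Sum>j\<in>I. if key j < key k then of_int (u j) - of_int (l j) else 0) =
      (of_int (\<Sum>j\<in>I. if key j < key k then u j - l j else 0) :: 'a)"
    by (simp add: if_distrib cong: if_cong)
  then show ?thesis by (simp add: fill_def of_int_max of_int_min)
qed

lemma fill_bounds:
  assumes "l k \<le> u k"
  shows "l k \<le> fill I key l u tot k" "fill I key l u tot k \<le> u k"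
  using assms by (auto simp: fill_def)

text \<open>Induction in increasing order of keys. A new largest key leaves the shares of the others
  unchanged, since they look only at smaller keys. It receives what remains of \<open>s\<close>
  after the capacity \<open>sum d I\<close>, clamped to its own capacity.\<close>

lemma sum_clamped:
  fixes d :: "'i \<Rightarrow> 'a :: linordered_idom" and key :: "'i \<Rightarrow> int"
  assumes "finite I" "inj_on key I" "\<And>k. k \<in> I \<Longrightarrow> 0 \<le> d k" "0 \<le> s"
  shows "(\<Sum>k\<in>I. max 0 (min (d k) (s - (\<Sum>j\<in>I. if key j < key k then d j else 0)))) = min s (sum d I)"
  using assms
proof (induction I rule: finite_ranking_induct[where f = key])
  case empty
  then show ?case by simp
next
  case (insert x I)
  show ?case
  proof (cases "x \<in> I")
    case True
    then show ?thesis using insert by (simp add: insert_absorb)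
  next
    case False
    have less: "key j < key x" if "j \<in> I" for j
    proof -
      have "key j \<noteq> key x"
        using inj_onD[OF insert.prems(1), of j x] that False by auto
      with insert.hyps(2)[OF that] show ?thesis by simp
    qed
    have "(\<Sum>j\<in>insert x I. if key j < key k then d j else 0) =
        (\<Sum>j\<in>I. if key j < key k then d j else 0)" if "k \<in> I" for k
      using less[OF that] insert.hyps(1) False by simp
    then have "(\<Sum>k\<in>I. max 0 (min (d k) (s - (\<Sum>j\<in>insert x I. if key j < key k then d j else 0)))) =
        (\<Sum>k\<in>I. max 0 (min (d k) (s - (\<Sum>j\<in>I. if key j < key k then d j else 0))))"
      by (intro sum.cong) simp_all
    also have "\<dots> = min s (sum d I)"
      by (rule insert.IH) (use insert.prems in \<open>auto elim: inj_on_subset\<close>)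
    finally have I: "(\<Sum>k\<in>I. max 0 (min (d k) (s - (\<Sum>j\<in>insert x I. if key j < key k then d j else 0)))) =
        min s (sum d I)" .
    have "(\<Sum>j\<in>I. if key j < key x then d j else 0) = sum d I"
      using less by (intro sum.cong) simp_all
    then have x: "(\<Sum>j\<in>insert x I. if key j < key x then d j else 0) = sum d I"
      using insert.hyps(1) False by simp
    have "0 \<le> d x" "0 \<le> sum d I"
      using insert.prems by (auto intro: sum_nonneg)
    then show ?thesis
      using insert.hyps(1) False I x insert.prems(3) by (simp add: min_def max_def)
  qed
qed

lemma sum_fill:
  assumes "finite I" "inj_on key I" "\<And>k. k \<in> I \<Longrightarrow> l k \<le> u k" "sum l I \<le> tot" "tot \<le> sum u I"
  shows "sum (fill I key l u tot) I = tot"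
proof -
  have "(\<Sum>k\<in>I. max 0 (min (u k - l k)
      (tot - sum l I - (\<Sum>j\<in>I. if key j < key k then u j - l j else 0)))) =
      min (tot - sum l I) (\<Sum>k\<in>I. u k - l k)"
    by (rule sum_clamped) (use assms in auto)
  then show ?thesis using assms by (simp add: fill_def sum.distrib sum_subtractf)
qed

text \<open>The pivot is an index of largest key that is lifted above its lower bound. Nothing after
  it is lifted, and the budget left on reaching it is positive, so everything before it is full. If
  nothing is lifted, an index of smallest key serves, as nothing comes before it.\<close>

lemma fill_pivot:
  assumes "finite I" "I \<noteq> {}" "\<And>k. k \<in> I \<Longrightarrow> l k \<le> u k"
  obtains p where "p \<in> I"
    "\<And>k. k \<in> I \<Longrightarrow> key k < key p \<Longrightarrow> fill I key l u tot k = u k"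
    "\<And>k. k \<in> I \<Longrightarrow> key p < key k \<Longrightarrow> fill I key l u tot k = l k"
proof (cases "\<exists>k\<in>I. fill I key l u tot k \<noteq> l k")
  case True
  let ?J = "{k \<in> I. fill I key l u tot k \<noteq> l k}"
  have "finite (key ` ?J)" "key ` ?J \<noteq> {}" using True assms by auto
  from Max_in[OF this] obtain p where p: "p \<in> ?J" "key p = Max (key ` ?J)" by auto
  show ?thesis
  proof (rule that[of p])
    show "p \<in> I" using p by simp
    fix k assume k: "k \<in> I"
    {
      assume "key p < key k"
      then show "fill I key l u tot k = l k"
        using p k Max_ge[OF \<open>finite (key ` ?J)\<close>] by fastforce
    next
      assume less: "key k < key p"
      let ?c = "\<lambda>k. \<Sum>j\<in>I. if key j < key k then u j - l j else 0"
      have "(u k - l k) + ?c k = (\<Sum>j\<in>I. (if j = k then u k - l k else 0) + (if key j < key k then u j - l j else 0))"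
        using assms(1) k by (simp add: sum.distrib)
      also have "\<dots> \<le> ?c p"
        using less assms(3) by (intro sum_mono) auto
      finally have "(u k - l k) + ?c k \<le> ?c p" .
      moreover have "0 < tot - sum l I - ?c p"
      proof (rule ccontr)
        assume "\<not> 0 < tot - sum l I - ?c p"
        then have "max 0 (min (u p - l p) (tot - sum l I - ?c p)) = 0" by simp
        then show False using p(1) by (simp add: fill_def)
      qed
      ultimately show "fill I key l u tot k = u k"
        using assms(3)[OF k] by (auto simp: fill_def)
    }
  qed
next
  case False
  have "finite (key ` I)" "key ` I \<noteq> {}" using assms by auto
  from Min_in[OF this] obtain p where "p \<in> I" "key p = Min (key ` I)" by auto
  with False show ?thesis
    by (intro that[of p]) (use \<open>finite (key ` I)\<close> in \<open>auto simp: Min_gr_iff dest: Min_le[of "key ` I", OF _ imageI]\<close>)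
qed

text \<open>An exchange argument around the pivot \<open>p\<close>: before \<open>p\<close> the
  allocation is maximal and the price at most \<open>t p\<close>, after \<open>p\<close> it is
  minimal and the price at least \<open>t p\<close>. So each
  \<open>(y k - x k) * (t k - t p)\<close> is nonnegative, where \<open>x\<close> is the greedy
  allocation, and \<open>t p\<close> cancels because both totals agree. Prices and keys are separate
  so that equal prices can be ordered by injective keys.\<close>

lemma fill_optimal:
  fixes t y :: "'i \<Rightarrow> 'a :: linordered_idom"
  assumes "finite I" "inj_on key I"
    and y: "\<And>k. k \<in> I \<Longrightarrow> l k \<le> y k" "\<And>k. k \<in> I \<Longrightarrow> y k \<le> u k" "sum y I = tot"
    and t: "\<And>j k. j \<in> I \<Longrightarrow> k \<in> I \<Longrightarrow> key j < key k \<Longrightarrow> t j \<le> t k"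
  shows "(\<Sum>k\<in>I. t k * fill I key l u tot k) \<le> (\<Sum>k\<in>I. t k * y k)"
proof (cases "I = {}")
  case False
  have lu: "l k \<le> u k" if "k \<in> I" for k using y(1,2)[OF that] by simp
  let ?x = "fill I key l u tot"
  have x: "sum ?x I = tot"
    using y(3) sum_mono[of I l y] sum_mono[of I y u] y(1,2) by (intro sum_fill assms lu) auto
  obtain p where p: "p \<in> I"
    "\<And>k. k \<in> I \<Longrightarrow> key k < key p \<Longrightarrow> ?x k = u k"
    "\<And>k. k \<in> I \<Longrightarrow> key p < key k \<Longrightarrow> ?x k = l k"
    using fill_pivot[where l = l and u = u and key = key and tot = tot, OF assms(1) False lu] by blast
  have "0 \<le> (y k - ?x k) * (t k - t p)" if k: "k \<in> I" for k
  proof (cases "key k" "key p" rule: linorder_cases)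
    case less
    then show ?thesis using p k y t by (intro mult_nonpos_nonpos) auto
  next
    case equal
    then have "k = p" using assms(2) k p(1) by (auto dest: inj_onD)
    then show ?thesis by simp
  next
    case greater
    then show ?thesis using p k y t by (intro mult_nonneg_nonneg) auto
  qed
  then have "0 \<le> (\<Sum>k\<in>I. (y k - ?x k) * (t k - t p))" by (rule sum_nonneg)
  also have "\<dots> = (\<Sum>k\<in>I. t k * y k) - (\<Sum>k\<in>I. t k * ?x k) - t p * (sum y I - sum ?x I)"
    by (simp add: algebra_simps sum.distrib sum_subtractf sum_distrib_left)
  finally show ?thesis by (simp add: x y(3))
qed simp

text \<open>
  All data of an instance are scaled by the common denominator \<open>D\<close>: the bounds \<open>A i\<close>, \<open>B i\<close> on
  word probabilities, the bounds \<open>lam\<close>, \<open>rho\<close> on label probabilities, the costs \<open>T k\<close> and the cost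
  bound \<open>bnd\<close>; \<open>n i k\<close> is the number of words of label \<open>i\<close> and cost \<open>k\<close>.
\<close>

locale allocation =
  fixes L K :: nat and D :: int and A B :: "nat \<Rightarrow> int" and lam rho bnd :: int
    and T :: "nat \<Rightarrow> int" and n :: "nat \<Rightarrow> nat \<Rightarrow> int"
begin

definition N :: "nat \<Rightarrow> int" where "N i = (\<Sum>k<K. n i k)"

definition class_mass :: "nat \<Rightarrow> nat \<Rightarrow> int" where
  "class_mass i = fill {..<K} T (\<lambda>k. A i * n i k) (\<lambda>k. B i * n i k) D"

text \<open>These labels can carry positive probability: \<open>N i\<close> conditional word
  probabilities between \<open>A i / D\<close> and \<open>B i / D\<close> can sum to 1.\<close>

definition valid :: "nat \<Rightarrow> bool" where
  "valid i \<longleftrightarrow> 0 < N i \<and> A i * N i \<le> D \<and> D \<le> B i * N i"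

definition valids :: "nat set" where "valids = {i \<in> {..<L}. valid i}"

definition label_cost :: "nat \<Rightarrow> int" where
  "label_cost i = (\<Sum>k<K. T k * class_mass i k)"

text \<open>Adding the index breaks ties.\<close>

definition label_key :: "nat \<Rightarrow> int" where
  "label_key i = label_cost i * int L + int i"

definition label_mass :: "nat \<Rightarrow> int" where
  "label_mass i = (if valid i then fill valids label_key (\<lambda>_. lam) (\<lambda>_. rho) D i else 0)"

text \<open>The first conjunct handles labels that are not valid: they have mass 0, which must not
  violate the lower bound \<open>lam\<close>. In the last one, costs, class masses and label masses
  each contribute a factor \<open>D\<close> on the left, while \<open>bnd\<close> contains only
  one.\<close>

definition admissible :: bool where
  "admissible \<longleftrightarrow> (int (card valids) = int L \<or> lam \<le> 0) \<and>
    lam * int (card valids) \<le> D \<and> D \<le> rho * int (card valids) \<and>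
    (\<Sum>i<L. label_mass i * label_cost i) \<le> bnd * D * D"

end

locale scaled_allocation = allocation +
  assumes D: "0 < D"
    and AB: "\<And>i. i < L \<Longrightarrow> A i \<le> B i"
    and lam: "0 \<le> lam" "lam \<le> rho"
    and n: "\<And>i k. i < L \<Longrightarrow> k < K \<Longrightarrow> 0 \<le> n i k"
    and T: "inj_on T {..<K}"
begin

lemma finite_valids: "finite valids" by (simp add: valids_def)

lemma inj_label_key: "inj_on label_key {..<L}"
proof (rule inj_onI)
  fix i j assume ij: "i \<in> {..<L}" "j \<in> {..<L}" "label_key i = label_key j"
  then have "label_key i mod int L = label_key j mod int L" by simp
  then show "i = j" using ij by (simp add: label_key_def)
qed

text \<open>A difference in cost contributes at least \<open>L\<close> to the key, which indices
  below \<open>L\<close> cannot outweigh.\<close>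

lemma label_cost_mono:
  assumes "i < L" "j < L" "label_key j < label_key i"
  shows "label_cost j \<le> label_cost i"
proof (rule ccontr)
  assume "\<not> ?thesis"
  then have "(label_cost i + 1) * int L \<le> label_cost j * int L"
    by (intro mult_right_mono) auto
  then show False using assms by (auto simp: label_key_def algebra_simps)
qed

lemma class_bounds:
  assumes "i < L" "k < K"
  shows "A i * n i k \<le> class_mass i k" "class_mass i k \<le> B i * n i k"
  unfolding class_mass_def
  using fill_bounds[of "\<lambda>k. A i * n i k" k "\<lambda>k. B i * n i k"] assms
  by (simp_all add: AB n mult_right_mono)

lemma sum_class_mass:
  assumes "i < L" "valid i"
  shows "(\<Sum>k<K. class_mass i k) = D"
  unfolding class_mass_def using assms
  by (intro sum_fill) (simp_all add: T AB n mult_right_mono valid_def N_def flip: sum_distrib_left)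

lemma label_mass_outside: "\<not> valid i \<Longrightarrow> label_mass i = 0"
  by (simp add: label_mass_def)

text \<open>For a label that is not valid the mass is 0, and then fewer than \<open>L\<close> labels
  are valid, so admissibility forces \<open>lam \<le> 0\<close>.\<close>

lemma label_mass_bounds:
  assumes admissible "i < L"
  shows "lam \<le> label_mass i" "label_mass i \<le> rho"
proof -
  have "lam \<le> 0" if "\<not> valid i"
  proof -
    have "valids \<subset> {..<L}" using assms that by (auto simp: valids_def)
    then have "card valids < L" using psubset_card_mono[of "{..<L}" valids] by simp
    then show ?thesis using assms(1) by (simp add: admissible_def)
  qed
  then show "lam \<le> label_mass i" "label_mass i \<le> rho"
    using fill_bounds[of "\<lambda>_. lam" i "\<lambda>_. rho"] lam by (auto simp: label_mass_def)
qed

lemma sum_valids: "(\<Sum>i<L. if valid i then f i else 0) = sum f valids"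
  unfolding valids_def by (rule sum.inter_filter[symmetric]) simp

lemma sum_label_mass:
  assumes admissible
  shows "(\<Sum>i<L. label_mass i) = D"
proof -
  have "(\<Sum>i<L. label_mass i) = sum (fill valids label_key (\<lambda>_. lam) (\<lambda>_. rho) D) valids"
    unfolding label_mass_def by (rule sum_valids)
  also have "\<dots> = D"
    using assms lam inj_label_key
    by (intro sum_fill) (auto simp: finite_valids valids_def admissible_def mult.commute elim: inj_on_subset)
  finally show ?thesis .
qed

text \<open>Here \<open>q\<close> and \<open>y\<close> are the label and class probabilities of an
  arbitrary competitor. Making the distribution within each label greedy, and then the distribution
  between the labels, never raises the cost, so the greedy cost is below any bound that the
  competitor meets.\<close>

lemma admissibleI:
  fixes q :: "nat \<Rightarrow> real" and y :: "nat \<Rightarrow> nat \<Rightarrow> real"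
  assumes q: "\<And>i. i < L \<Longrightarrow> q i = (\<Sum>k<K. y i k)" "(\<Sum>i<L. q i) = 1"
    and label: "\<And>i. i < L \<Longrightarrow> lam \<le> D * q i" "\<And>i. i < L \<Longrightarrow> D * q i \<le> rho"
    and y0: "\<And>i k. i < L \<Longrightarrow> k < K \<Longrightarrow> 0 \<le> y i k"
    and y: "\<And>i k. i < L \<Longrightarrow> k < K \<Longrightarrow> 0 < q i \<Longrightarrow> A i * n i k * q i \<le> D * y i k"
      "\<And>i k. i < L \<Longrightarrow> k < K \<Longrightarrow> 0 < q i \<Longrightarrow> D * y i k \<le> B i * n i k * q i"
    and cost: "(\<Sum>i<L. \<Sum>k<K. T k * y i k) \<le> bnd"
  shows admissible
proof -
  have q0: "0 \<le> q i" if "i < L" for i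
    using that y0 by (auto simp: q(1) intro!: sum_nonneg)
  \<comment> \<open>The conditional class probabilities given the label, multiplied by
    \<open>D\<close>. They are used only where \<open>q i\<close> is positive, so the division is
    genuine.\<close>
  define z where "z i k = D * y i k / q i" for i k
  have z: "A i * n i k \<le> z i k" "z i k \<le> B i * n i k" if "i < L" "0 < q i" "k < K" for i k
    using y[OF that(1,3,2)] that(2) by (simp_all add: z_def field_simps)
  have sum_z: "(\<Sum>k<K. z i k) = D" if "i < L" "0 < q i" for i
    using that q(1)[OF that(1)] by (simp add: z_def flip: sum_divide_distrib sum_distrib_left)
  have valid: "valid i" if "i < L" "0 < q i" for i
  proof -
    have "real_of_int (A i * N i) \<le> D" "real_of_int D \<le> B i * N i"
      unfolding sum_z[OF that, symmetric] N_def of_int_mult of_int_sum sum_distrib_left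
      using z[OF that] by (auto intro!: sum_mono)
    then have *: "A i * N i \<le> D" "D \<le> B i * N i"
      by (simp_all only: of_int_mult[symmetric] of_int_le_iff)
    moreover have "0 \<le> N i" using n that by (auto simp: N_def intro: sum_nonneg)
    moreover have "N i \<noteq> 0" using *(2) D by auto
    ultimately show ?thesis by (simp add: valid_def)
  qed
  have outside: "q i = 0" if "i < L" "\<not> valid i" for i
    using valid that q0[OF that(1)] by (auto simp: order_le_less)
  have sum_q: "(\<Sum>i\<in>valids. D * q i) = D"
  proof -
    have "sum q valids = (\<Sum>i<L. q i)"
      by (rule sum.mono_neutral_left) (auto simp: valids_def outside)
    then show ?thesis by (simp add: q(2) flip: sum_distrib_left)
  qed
  have "card valids = L \<or> lam \<le> 0"
  proof (cases "\<forall>i<L. valid i")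
    case True
    then have "valids = {..<L}" by (auto simp: valids_def)
    then show ?thesis by simp
  next
    case False
    then obtain i where "i < L" "\<not> valid i" by blast
    then show ?thesis using label(1)[of i] outside[of i] by simp
  qed
  moreover have "real_of_int (lam * int (card valids)) \<le> real_of_int D"
    using sum_bounded_below[of valids "real_of_int lam" "\<lambda>i. D * q i"] label(1)
    unfolding sum_q by (simp add: valids_def mult.commute)
  moreover have "real_of_int D \<le> real_of_int (rho * int (card valids))"
    using sum_bounded_above[of valids "\<lambda>i. D * q i" "real_of_int rho"] label(2)
    unfolding sum_q by (simp add: valids_def mult.commute)
  moreover have "(\<Sum>i<L. label_mass i * label_cost i) \<le> bnd * D * D"
  proof -
    have le: "q i * label_cost i \<le> (\<Sum>k<K. T k * (D * y i k))" if "i < L" for i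
    proof (cases "q i = 0")
      case True
      then have "(\<Sum>k<K. y i k) = 0" using q(1)[OF that] by simp
      then have "y i k = 0" if "k < K" for k
        using sum_nonneg_eq_0_iff[of "{..<K}" "y i"] y0 \<open>i < L\<close> that by simp
      then show ?thesis using True by simp
    next
      case False
      then have pos: "0 < q i" using q0[OF that] by simp
      have "real_of_int (label_cost i) = (\<Sum>k<K. real_of_int (T k) *
          fill {..<K} T (\<lambda>k. real_of_int (A i * n i k)) (\<lambda>k. real_of_int (B i * n i k)) (real_of_int D) k)"
        by (simp add: label_cost_def class_mass_def of_int_fill)
      also have "\<dots> \<le> (\<Sum>k<K. T k * z i k)"
        using z[OF that pos] sum_z[OF that pos] by (intro fill_optimal) (auto simp: T)
      finally have "q i * label_cost i \<le> q i * (\<Sum>k<K. T k * z i k)"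
        using pos by (intro mult_left_mono) auto
      also have "\<dots> = (\<Sum>k<K. T k * (D * y i k))"
        using pos by (simp add: z_def sum_distrib_left field_simps)
      finally show ?thesis .
    qed
    have "real_of_int (\<Sum>i<L. label_mass i * label_cost i) =
        (\<Sum>i<L. if valid i then label_cost i * fill valids label_key (\<lambda>_. lam) (\<lambda>_. rho) D i else 0)"
      by (auto simp: label_mass_def intro!: sum.cong)
    also have "\<dots> = (\<Sum>i\<in>valids. real_of_int (label_cost i) *
        fill valids label_key (\<lambda>_. real_of_int lam) (\<lambda>_. real_of_int rho) (real_of_int D) i)"
      by (subst sum_valids) (simp add: of_int_fill)
    also have "\<dots> \<le> (\<Sum>i\<in>valids. label_cost i * (D * q i))"
    proof (rule fill_optimal)
      show "inj_on label_key valids"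
        using inj_label_key by (rule inj_on_subset) (auto simp: valids_def)
    qed (use label sum_q label_cost_mono in \<open>auto simp: finite_valids valids_def\<close>)
    also have "\<dots> = D * (\<Sum>i\<in>valids. q i * label_cost i)"
      by (simp add: sum_distrib_left algebra_simps)
    also have "(\<Sum>i\<in>valids. q i * label_cost i) = (\<Sum>i<L. q i * label_cost i)"
      by (rule sum.mono_neutral_left) (auto simp: valids_def outside)
    also have "D * \<dots> \<le> D * (\<Sum>i<L. \<Sum>k<K. T k * (D * y i k))"
      using D le by (intro mult_left_mono sum_mono) auto
    also have "\<dots> = D * D * (\<Sum>i<L. \<Sum>k<K. T k * y i k)"
      by (simp add: sum_distrib_left algebra_simps)
    also have "\<dots> \<le> real_of_int (D * D) * real_of_int bnd"
      using D cost by (intro mult_left_mono) auto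
    also have "\<dots> = real_of_int (bnd * D * D)" by simp
    finally show ?thesis by (simp only: of_int_le_iff)
  qed
  ultimately show ?thesis unfolding admissible_def by (simp only: of_int_le_iff of_nat_eq_iff)
qed

end

section \<open>Selection by cumulative weights\<close>

text \<open>The inverse of the cumulative weights, written as a count so that a plain sum over the
  indices evaluates it, without a search.\<close>

definition select :: "nat \<Rightarrow> (nat \<Rightarrow> int) \<Rightarrow> int \<Rightarrow> nat" where
  "select m w r = card {i \<in> {..<m}. (\<Sum>j<Suc i. w j) \<le> r}"

lemma select_eqI:
  assumes w: "\<And>i. i < m \<Longrightarrow> 0 \<le> w i" and i: "i < m"
    and r: "(\<Sum>j<i. w j) \<le> r" "r < (\<Sum>j<Suc i. w j)"
  shows "select m w r = i"
proof -
  have mono: "(\<Sum>j<a. w j) \<le> (\<Sum>j<b. w j)" if "a \<le> b" "b \<le> m" for a b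
    using that w by (intro sum_mono2) auto
  have "{j \<in> {..<m}. (\<Sum>l<Suc j. w l) \<le> r} = {..<i}"
  proof (intro equalityI subsetI)
    fix j assume j: "j \<in> {j \<in> {..<m}. (\<Sum>l<Suc j. w l) \<le> r}"
    show "j \<in> {..<i}"
    proof (rule ccontr)
      assume "j \<notin> {..<i}"
      then have "(\<Sum>l<Suc i. w l) \<le> (\<Sum>l<Suc j. w l)" using j by (intro mono) auto
      then show False using j r(2) by simp
    qed
  next
    fix j assume "j \<in> {..<i}"
    then show "j \<in> {j \<in> {..<m}. (\<Sum>l<Suc j. w l) \<le> r}"
      using mono[of "Suc j" i] i r(1) by auto
  qed
  then show ?thesis by (simp add: select_def)
qed

lemma select_bounds:
  assumes w: "\<And>i. i < m \<Longrightarrow> 0 \<le> w i" and r: "0 \<le> r" "r < (\<Sum>j<m. w j)"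
  shows "select m w r < m" "(\<Sum>j<select m w r. w j) \<le> r" "r < (\<Sum>j<Suc (select m w r). w j)"
proof -
  have ex: "\<exists>i. r < (\<Sum>j<i. w j)" using r(2) by blast
  define b where "b = (LEAST i. r < (\<Sum>j<i. w j))"
  have b: "r < (\<Sum>j<b. w j)" unfolding b_def using ex by (rule LeastI_ex)
  have "b \<le> m" unfolding b_def using r(2) by (rule Least_le)
  have "b \<noteq> 0"
  proof
    assume "b = 0"
    with b r(1) show False by simp
  qed
  then obtain i where i: "b = Suc i" by (cases b) auto
  have "\<not> r < (\<Sum>j<i. w j)"
    using not_less_Least[of i "\<lambda>i. r < (\<Sum>j<i. w j)"] i by (simp add: b_def)
  then have *: "i < m" "(\<Sum>j<i. w j) \<le> r" "r < (\<Sum>j<Suc i. w j)"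
    using \<open>b \<le> m\<close> i b by auto
  have "select m w r = i" by (rule select_eqI) (use w * in auto)
  then show "select m w r < m" "(\<Sum>j<select m w r. w j) \<le> r" "r < (\<Sum>j<Suc (select m w r). w j)"
    using * by auto
qed

lemma select_weight_pos:
  assumes w: "\<And>i. i < m \<Longrightarrow> 0 \<le> w i" and r: "0 \<le> r" "r < (\<Sum>j<m. w j)"
  shows "0 < w (select m w r)"
  using select_bounds[OF assms] by simp

text \<open>The preimage of \<open>i\<close> is the interval between two consecutive partial sums,
  which has \<open>w i\<close> elements.\<close>

lemma pmf_select:
  assumes w: "\<And>i. i < m \<Longrightarrow> 0 \<le> w i" and D: "(\<Sum>j<m. w j) = D" "0 < D" and i: "i < m"
  shows "pmf (map_pmf (select m w) (pmf_of_set {0..<D})) i = w i / D"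
proof -
  have mono: "(\<Sum>j<a. w j) \<le> (\<Sum>j<b. w j)" if "a \<le> b" "b \<le> m" for a b
    using that w by (intro sum_mono2) auto
  have "{0..<D} \<inter> select m w -` {i} = {\<Sum>j<i. w j..<\<Sum>j<Suc i. w j}"
  proof (intro equalityI subsetI)
    fix r assume "r \<in> {0..<D} \<inter> select m w -` {i}"
    then show "r \<in> {\<Sum>j<i. w j..<\<Sum>j<Suc i. w j}"
      using select_bounds[of m w r, OF w] D by auto
  next
    fix r assume "r \<in> {\<Sum>j<i. w j..<\<Sum>j<Suc i. w j}"
    then show "r \<in> {0..<D} \<inter> select m w -` {i}"
      using select_eqI[of m w i r, OF w i] mono[of "Suc i" m] mono[of 0 i] i D by auto
  qed
  then have "measure_pmf.prob (pmf_of_set {0..<D}) (select m w -` {i}) = w i / D"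
    using D w[OF i] by (simp add: measure_pmf_of_set)
  then show ?thesis by (simp add: pmf_map)
qed

section \<open>Feasibility\<close>

definition scale_rat :: "int \<Rightarrow> rat \<Rightarrow> int" where
  "scale_rat D q = fst (quotient_of q) * (D div snd (quotient_of q))"

lemma scale_rat:
  assumes "snd (quotient_of q) dvd D"
  shows "real_of_int (scale_rat D q) = real_of_int D * of_rat q"
proof -
  obtain a b where q: "quotient_of q = (a, b)" by force
  then have b: "b \<noteq> 0" "q = of_int a / of_int b"
    using quotient_of_denom_pos[OF q] quotient_of_div[OF q] by auto
  obtain d where "D = b * d" using assms q by (auto simp: dvd_def)
  then have "scale_rat D q = a * d" using b q by (simp add: scale_rat_def)
  moreover have "real_of_int D * of_rat q = a * d"
    using b by (simp add: \<open>D = b * d\<close> of_rat_divide)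
  ultimately show ?thesis by simp
qed

text \<open>A product in place of a least common multiple needs no gcd, and its bit size is at most
  the sum of those of its factors. The labels are counted by \<open>word_lo\<close>, because
  \<open>labels\<close> is not part of the encoded instance.\<close>

definition denominator :: "('a, 'l) lqci \<Rightarrow> rat list \<Rightarrow> int" where
  "denominator C \<theta>s = (\<Prod>k<length \<theta>s. snd (quotient_of (\<theta>s ! k))) *
    ((\<Prod>i<length (word_lo C). snd (quotient_of (word_lo C ! i))) *
     (\<Prod>i<length (word_lo C). snd (quotient_of (word_hi C ! i)))) *
    (snd (quotient_of (label_lo C)) * (snd (quotient_of (label_hi C)) * snd (quotient_of (cost_bound C))))"

definition class_count :: "('a, 'l) lqci \<Rightarrow> rat list \<Rightarrow> nat \<Rightarrow> nat \<Rightarrow> int" where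
  "class_count C \<theta>s i k = int (card (class_words C i (\<theta>s ! k)))"

locale costed_instance =
  fixes C :: "('a::finite, 'l) lqci" and \<theta>s :: "rat list"
  assumes inst: "lqci_instance C" and \<theta>s: "distinct \<theta>s" "set \<theta>s = costs C"
begin

abbreviation "L \<equiv> length (word_lo C)"
abbreviation "K \<equiv> length \<theta>s"
abbreviation "D \<equiv> denominator C \<theta>s"
abbreviation "cls i k \<equiv> class_words C i (\<theta>s ! k)"

lemma L_labels: "length (labels C) = L"
  using inst by (simp add: lqci_instance_def)

sublocale allocation L K D "\<lambda>i. scale_rat D (word_lo C ! i)" "\<lambda>i. scale_rat D (word_hi C ! i)"
  "scale_rat D (label_lo C)" "scale_rat D (label_hi C)" "scale_rat D (cost_bound C)"
  "\<lambda>k. scale_rat D (\<theta>s ! k)" "class_count C \<theta>s" .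

lemma D_pos: "0 < D"
  unfolding denominator_def by (intro mult_pos_pos prod_pos) (auto simp: quotient_of_denom_pos')

lemma scale_D:
  "i < L \<Longrightarrow> real_of_int (scale_rat D (word_lo C ! i)) = D * of_rat (word_lo C ! i)"
  "i < L \<Longrightarrow> real_of_int (scale_rat D (word_hi C ! i)) = D * of_rat (word_hi C ! i)"
  "k < K \<Longrightarrow> real_of_int (scale_rat D (\<theta>s ! k)) = D * of_rat (\<theta>s ! k)"
  "real_of_int (scale_rat D (label_lo C)) = D * of_rat (label_lo C)"
  "real_of_int (scale_rat D (label_hi C)) = D * of_rat (label_hi C)"
  "real_of_int (scale_rat D (cost_bound C)) = D * of_rat (cost_bound C)"
  by (rule scale_rat; auto simp: denominator_def intro: dvd_mult dvd_mult2 dvd_prodI)+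

sublocale scaled_allocation L K D "\<lambda>i. scale_rat D (word_lo C ! i)" "\<lambda>i. scale_rat D (word_hi C ! i)"
  "scale_rat D (label_lo C)" "scale_rat D (label_hi C)" "scale_rat D (cost_bound C)"
  "\<lambda>k. scale_rat D (\<theta>s ! k)" "class_count C \<theta>s"
proof
  show "scale_rat D (word_lo C ! i) \<le> scale_rat D (word_hi C ! i)" if "i < L" for i
    using that inst D_pos by (subst of_int_le_iff[where 'a = real, symmetric])
      (simp add: scale_D lqci_instance_def of_rat_less_eq)
  have "0 \<le> real_of_int (scale_rat D (label_lo C))"
    using inst D_pos by (simp add: scale_D lqci_instance_def)
  then show "0 \<le> scale_rat D (label_lo C)" by simp
  show "scale_rat D (label_lo C) \<le> scale_rat D (label_hi C)"
    using inst D_pos by (subst of_int_le_iff[where 'a = real, symmetric])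
      (simp add: scale_D lqci_instance_def of_rat_less_eq)
  show "inj_on (\<lambda>k. scale_rat D (\<theta>s ! k)) {..<K}"
  proof (rule inj_onI)
    fix j k assume jk: "j \<in> {..<K}" "k \<in> {..<K}" "scale_rat D (\<theta>s ! j) = scale_rat D (\<theta>s ! k)"
    then have "real_of_int D * of_rat (\<theta>s ! j) = D * of_rat (\<theta>s ! k)"
      by (metis scale_D(3) lessThan_iff)
    then have "\<theta>s ! j = \<theta>s ! k" using D_pos by simp
    then show "j = k" using jk \<theta>s(1) by (simp add: nth_eq_iff_index_eq)
  qed
qed (simp_all add: D_pos class_count_def)

lemma finite_words: "finite (words C)"
proof (rule finite_subset)
  show "words C \<subseteq> {w. set w \<subseteq> UNIV \<and> length w \<le> max_len C}" by (auto simp: words_def)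
qed (rule finite_lists_length_le, simp)

lemma finite_cls: "finite (class_words C i \<theta>)"
  by (rule finite_subset[OF _ finite_words]) (auto simp: class_words_def)

lemma label_words_eq: "label_words C i = (\<Union>k<K. cls i k)"
proof -
  have "costs C = (\<lambda>k. \<theta>s ! k) ` {..<K}"
    unfolding \<theta>s(2)[symmetric] by (auto simp: in_set_conv_nth)
  then show ?thesis by (simp add: label_words_def)
qed

lemma words_eq: "words C = (\<Union>i<L. label_words C i)"
proof (intro equalityI subsetI)
  fix w assume w: "w \<in> words C"
  have "label C w \<in> set (labels C)" using inst by (auto simp: lqci_instance_def)
  then obtain i where i: "i < L" "labels C ! i = label C w" by (auto simp: in_set_conv_nth L_labels)
  then have "w \<in> label_words C i"
    using w by (auto simp: label_words_def class_words_def costs_def)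
  with i show "w \<in> (\<Union>i<L. label_words C i)" by blast
qed (auto simp: label_words_def class_words_def)

lemma cls_disjoint:
  assumes "i < L" "j < L" "k < K" "l < K" "w \<in> cls i k" "w \<in> cls j l"
  shows "i = j \<and> k = l"
  using assms \<theta>s(1) inst
  by (auto simp: class_words_def lqci_instance_def nth_eq_iff_index_eq L_labels)

lemma sum_label_words:
  assumes "i < L"
  shows "sum f (label_words C i) = (\<Sum>k<K. sum f (cls i k))"
  unfolding label_words_eq
  by (rule sum.UNION_disjoint) (use finite_cls cls_disjoint[OF assms assms] in auto)

lemma finite_label_words: "finite (label_words C i)"
  unfolding label_words_eq using finite_cls by blast

lemma sum_words: "sum f (words C) = (\<Sum>i<L. \<Sum>k<K. sum f (cls i k))"
proof -
  have "sum f (words C) = (\<Sum>i<L. sum f (label_words C i))"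
    unfolding words_eq
  proof (rule sum.UNION_disjoint)
    show "\<forall>i\<in>{..<L}. \<forall>j\<in>{..<L}. i \<noteq> j \<longrightarrow> label_words C i \<inter> label_words C j = {}"
      using cls_disjoint unfolding label_words_eq by blast
  qed (use finite_label_words in auto)
  then show ?thesis by (simp add: sum_label_words)
qed

lemma expectation_cost:
  assumes "set_pmf P \<subseteq> words C"
  shows "measure_pmf.expectation P (\<lambda>w. of_rat (cost C w)) =
    (\<Sum>i<L. \<Sum>k<K. of_rat (\<theta>s ! k) * sum (pmf P) (cls i k))"
proof -
  have "measure_pmf.expectation P (\<lambda>w. of_rat (cost C w)) = (\<Sum>w\<in>words C. of_rat (cost C w) * pmf P w)"
    by (rule integral_measure_pmf_real) (use assms finite_words in auto)
  then show ?thesis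
    unfolding sum_words by (auto simp: sum_distrib_left class_words_def intro!: sum.cong)
qed

lemma cond_prob_word:
  assumes "y \<in> label_words C i"
  shows "cond_prob (measure_pmf P) (\<lambda>w. w = y) (\<lambda>w. w \<in> label_words C i) =
    pmf P y / measure_pmf.prob P (label_words C i)"
proof -
  have "{w. w = y \<and> w \<in> label_words C i} = {y}" using assms by auto
  then show ?thesis by (simp add: cond_prob_def measure_pmf_single)
qed

text \<open>Only the masses of the classes matter: the cost is constant on a class, and the bounds
  on words, summed over a class, become bounds on its mass.\<close>

lemma improvising_imp_admissible:
  assumes "improvising C P"
  shows admissible
proof (rule admissibleI)
  let ?q = "\<lambda>i. measure_pmf.prob P (label_words C i)"
  let ?y = "\<lambda>i k. measure_pmf.prob P (cls i k)"
  have y: "?y i k = sum (pmf P) (cls i k)" for i k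
    by (rule measure_measure_pmf_finite[OF finite_cls])
  have q: "?q i = sum (pmf P) (label_words C i)" for i
    by (rule measure_measure_pmf_finite[OF finite_label_words])
  show "?q i = (\<Sum>k<K. ?y i k)" if "i < L" for i
    unfolding q y by (rule sum_label_words[OF that])
  have words: "measure_pmf.prob P (words C) = 1"
    using assms by (simp add: improvising_def)
  then show "(\<Sum>i<L. ?q i) = 1"
    by (simp add: q sum_words sum_label_words measure_measure_pmf_finite[OF finite_words])
  show "scale_rat D (label_lo C) \<le> D * ?q i" "D * ?q i \<le> scale_rat D (label_hi C)" if "i < L" for i
    using assms that D_pos by (simp_all add: scale_D improvising_def L_labels)
  show "0 \<le> ?y i k" for i k by simp
  have cond: "of_rat (word_lo C ! i) * ?q i \<le> pmf P w" "pmf P w \<le> of_rat (word_hi C ! i) * ?q i"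
    if "i < L" "0 < ?q i" "k < K" "w \<in> cls i k" for i k w
  proof -
    have w: "w \<in> label_words C i" using that by (auto simp: label_words_eq)
    have "of_rat (word_lo C ! i) \<le> cond_prob (measure_pmf P) (\<lambda>w'. w' = w) (\<lambda>w. w \<in> label_words C i)"
      "cond_prob (measure_pmf P) (\<lambda>w'. w' = w) (\<lambda>w. w \<in> label_words C i) \<le> of_rat (word_hi C ! i)"
      using assms that w unfolding improvising_def L_labels by blast+
    then show "of_rat (word_lo C ! i) * ?q i \<le> pmf P w" "pmf P w \<le> of_rat (word_hi C ! i) * ?q i"
      using that(2) unfolding cond_prob_word[OF w] by (simp_all add: field_simps)
  qed
  show "scale_rat D (word_lo C ! i) * class_count C \<theta>s i k * ?q i \<le> D * ?y i k"
    if "i < L" "k < K" "0 < ?q i" for i k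
  proof -
    have "card (cls i k) * (of_rat (word_lo C ! i) * ?q i) \<le> ?y i k"
      unfolding y using cond(1)[OF that(1,3,2)] by (rule sum_bounded_below)
    then have "D * (card (cls i k) * (of_rat (word_lo C ! i) * ?q i)) \<le> D * ?y i k"
      using D_pos by (intro mult_left_mono) auto
    then show ?thesis using that by (simp add: scale_D class_count_def mult_ac)
  qed
  show "D * ?y i k \<le> scale_rat D (word_hi C ! i) * class_count C \<theta>s i k * ?q i"
    if "i < L" "k < K" "0 < ?q i" for i k
  proof -
    have "?y i k \<le> card (cls i k) * (of_rat (word_hi C ! i) * ?q i)"
      unfolding y using cond(2)[OF that(1,3,2)] by (rule sum_bounded_above)
    then have "D * ?y i k \<le> D * (card (cls i k) * (of_rat (word_hi C ! i) * ?q i))"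
      using D_pos by (intro mult_left_mono) auto
    then show ?thesis using that by (simp add: scale_D class_count_def mult_ac)
  qed
  have "set_pmf P \<subseteq> words C"
    using words by (simp add: measure_pmf.prob_eq_1 AE_measure_pmf_iff subset_eq)
  then have "(\<Sum>i<L. \<Sum>k<K. of_rat (\<theta>s ! k) * ?y i k) \<le> (of_rat (cost_bound C) :: real)"
    using assms by (simp add: improvising_def expectation_cost y)
  then have "D * (\<Sum>i<L. \<Sum>k<K. of_rat (\<theta>s ! k) * ?y i k) \<le> D * of_rat (cost_bound C)"
    using D_pos by (intro mult_left_mono) auto
  then show "(\<Sum>i<L. \<Sum>k<K. scale_rat D (\<theta>s ! k) * ?y i k) \<le> scale_rat D (cost_bound C)"
    by (simp add: scale_D sum_distrib_left mult.assoc)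
qed

text \<open>Both draws use the same range \<open>{0..<D}\<close>, because the label masses sum to
  \<open>D\<close> and so do the class masses of every valid label.\<close>

definition greedy_pmf :: "'a list pmf" where
  "greedy_pmf = bind_pmf (pmf_of_set {0..<D}) (\<lambda>r. bind_pmf (pmf_of_set {0..<D}) (\<lambda>r'.
    let i = select L label_mass r; k = select K (class_mass i) r' in pmf_of_set (cls i k)))"

context
  assumes adm: admissible
begin

lemma label_mass_nonneg: "i < L \<Longrightarrow> 0 \<le> label_mass i"
  using label_mass_bounds[OF adm, of i] lam by linarith

lemma class_mass_nonneg: "i < L \<Longrightarrow> k < K \<Longrightarrow> 0 \<le> class_mass i k"
proof -
  assume ik: "i < L" "k < K"
  have "0 \<le> real_of_int (scale_rat D (word_lo C ! i))"
    using ik inst D_pos by (simp add: scale_D lqci_instance_def)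
  then have "0 \<le> scale_rat D (word_lo C ! i) * class_count C \<theta>s i k"
    by (simp add: class_count_def)
  also have "\<dots> \<le> class_mass i k" by (rule class_bounds[OF ik])
  finally show ?thesis .
qed

lemma class_mass_empty: "i < L \<Longrightarrow> k < K \<Longrightarrow> cls i k = {} \<Longrightarrow> class_mass i k = 0"
  using class_bounds[of i k] by (simp add: class_count_def)

lemma select_label:
  assumes "r \<in> {0..<D}"
  shows "select L label_mass r < L" "valid (select L label_mass r)"
proof -
  have "0 < label_mass (select L label_mass r)" "select L label_mass r < L"
    using assms select_weight_pos[of L label_mass r] select_bounds(1)[of L label_mass r]
      sum_label_mass[OF adm] label_mass_nonneg by auto
  then show "select L label_mass r < L" "valid (select L label_mass r)"
    using label_mass_outside by force+
qed

text \<open>Both bounds on the mass of a class are multiples of its cardinality, so an empty class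
  has weight 0, and indices of weight 0 are never selected.\<close>

lemma select_class:
  assumes "r \<in> {0..<D}" "i < L" "valid i"
  shows "select K (class_mass i) r < K" "cls i (select K (class_mass i) r) \<noteq> {}"
proof -
  have *: "0 < class_mass i (select K (class_mass i) r)" "select K (class_mass i) r < K"
    using assms select_weight_pos[of K "class_mass i" r] select_bounds(1)[of K "class_mass i" r]
      sum_class_mass[OF assms(2,3)] class_mass_nonneg by auto
  then show "select K (class_mass i) r < K" "cls i (select K (class_mass i) r) \<noteq> {}"
    using class_mass_empty[OF assms(2) *(2)] by auto
qed

lemma set_greedy_pmf: "set_pmf greedy_pmf \<subseteq> words C"
proof
  fix w assume "w \<in> set_pmf greedy_pmf"
  then obtain r r' where r: "r \<in> {0..<D}" "r' \<in> {0..<D}"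
    and w: "w \<in> set_pmf (pmf_of_set (cls (select L label_mass r)
      (select K (class_mass (select L label_mass r)) r')))"
    using D_pos by (auto simp: greedy_pmf_def set_pmf_of_set Let_def)
  have "cls (select L label_mass r) (select K (class_mass (select L label_mass r)) r') \<noteq> {}"
    using select_class[OF r(2)] select_label[OF r(1)] by blast
  then show "w \<in> words C"
    using w finite_cls by (auto simp: set_pmf_of_set class_words_def)
qed

text \<open>As the classes are disjoint, the sums over labels and over costs each retain a single
  term. Labels that are not valid drop out because their mass is 0.\<close>

lemma pmf_greedy:
  assumes "i < L" "k < K" "w \<in> cls i k"
  shows "pmf greedy_pmf w = label_mass i / D * (class_mass i k / D) / card (cls i k)"
proof -
  let ?Q = "map_pmf (select L label_mass) (pmf_of_set {0..<D})"
  let ?R = "\<lambda>i. map_pmf (select K (class_mass i)) (pmf_of_set {0..<D})"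
  let ?G = "\<lambda>i. bind_pmf (?R i) (\<lambda>k. pmf_of_set (cls i k))"
  have G: "greedy_pmf = bind_pmf ?Q ?G"
    by (simp add: greedy_pmf_def bind_map_pmf Let_def)
  have set_Q: "set_pmf ?Q \<subseteq> {j \<in> {..<L}. valid j}"
    using select_label D_pos by (auto simp: set_pmf_of_set)
  have set_R: "set_pmf (?R j) \<subseteq> {l \<in> {..<K}. cls j l \<noteq> {}}" if "j < L" "valid j" for j
    using select_class[OF _ that] D_pos by (auto simp: set_pmf_of_set)
  have pmf_G: "pmf (?G j) w = (if j = i then class_mass i k / D / card (cls i k) else 0)"
    if j: "j < L" "valid j" for j
  proof -
    have "pmf (?G j) w = (\<Sum>l<K. pmf (pmf_of_set (cls j l)) w * pmf (?R j) l)"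
      unfolding pmf_bind using set_R[OF j] by (intro integral_measure_pmf_real) auto
    also have "\<dots> = (\<Sum>l<K. if l = k then (if j = i then class_mass i k / D / card (cls i k) else 0) else 0)"
    proof (intro sum.cong refl)
      fix l assume "l \<in> {..<K}"
      then have l: "l < K" by simp
      have R: "pmf (?R j) l = class_mass j l / D"
        using class_mass_nonneg[OF j(1)] sum_class_mass[OF j] D_pos l by (intro pmf_select) auto
      show "pmf (pmf_of_set (cls j l)) w * pmf (?R j) l =
          (if l = k then (if j = i then class_mass i k / D / card (cls i k) else 0) else 0)"
      proof (cases "cls j l = {}")
        case True
        then have "class_mass j l = 0" using class_mass_empty j l by blast
        moreover have "\<not> (j = i \<and> l = k)" using True assms(3) by auto
        ultimately show ?thesis using R by auto
      next
        case False
        then have "pmf (pmf_of_set (cls j l)) w = indicator (cls j l) w / card (cls j l)"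
          using finite_cls by simp
        moreover have "w \<in> cls j l \<longleftrightarrow> j = i \<and> l = k"
          using cls_disjoint[OF assms(1) j(1) assms(2) l assms(3)] assms(3) by metis
        ultimately show ?thesis using R by (cases "j = i"; cases "l = k") simp_all
      qed
    qed
    finally show ?thesis using assms(2) by simp
  qed
  have Q: "pmf ?Q j = label_mass j / D" if "j < L" for j
    using label_mass_nonneg sum_label_mass[OF adm] D_pos that by (intro pmf_select) auto
  have "pmf greedy_pmf w = (\<Sum>j<L. pmf (?G j) w * pmf ?Q j)"
    unfolding G pmf_bind[of ?Q] using set_Q by (intro integral_measure_pmf_real) auto
  also have "\<dots> = (\<Sum>j<L. if j = i then class_mass i k / D / card (cls i k) * (label_mass i / D) else 0)"
    using pmf_G Q label_mass_outside by (intro sum.cong refl) force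
  finally show ?thesis using assms(1) by (simp add: field_simps)
qed

lemma sum_pmf_greedy:
  assumes "i < L" "k < K"
  shows "sum (pmf greedy_pmf) (cls i k) = label_mass i / D * (class_mass i k / D)"
proof (cases "cls i k = {}")
  case True
  then show ?thesis using class_mass_empty[OF assms] by simp
next
  case False
  have "sum (pmf greedy_pmf) (cls i k) =
      (\<Sum>w\<in>cls i k. label_mass i / D * (class_mass i k / D) / card (cls i k))"
    by (intro sum.cong refl pmf_greedy assms)
  then show ?thesis using False finite_cls by (simp add: card_gt_0_iff)
qed

lemma prob_label_greedy:
  assumes "i < L"
  shows "measure_pmf.prob greedy_pmf (label_words C i) = label_mass i / D"
proof -
  have "measure_pmf.prob greedy_pmf (label_words C i) = (\<Sum>k<K. label_mass i / D * (class_mass i k / D))"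
    using assms by (simp add: measure_measure_pmf_finite[OF finite_label_words] sum_label_words sum_pmf_greedy)
  also have "\<dots> = label_mass i / D * (of_int (\<Sum>k<K. class_mass i k) / D)"
    by (simp add: sum_distrib_left sum_divide_distrib)
  also have "\<dots> = label_mass i / D"
    using sum_class_mass[OF assms] label_mass_outside[of i] D_pos by (cases "valid i") auto
  finally show ?thesis .
qed

lemma improvising_greedy: "improvising C greedy_pmf"
  unfolding improvising_def
proof (intro conjI allI impI ballI)
  show "measure_pmf.prob greedy_pmf (words C) = 1"
    using set_greedy_pmf by (auto simp: measure_pmf.prob_eq_1 AE_measure_pmf_iff)
  have "measure_pmf.expectation greedy_pmf (\<lambda>w. of_rat (cost C w)) =
      (\<Sum>i<L. \<Sum>k<K. of_rat (\<theta>s ! k) * (label_mass i / D * (class_mass i k / D)))"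
    by (simp add: expectation_cost[OF set_greedy_pmf] sum_pmf_greedy)
  also have "\<dots> = (\<Sum>i<L. \<Sum>k<K. scale_rat D (\<theta>s ! k) * (label_mass i * class_mass i k) / (D * D * D))"
    using D_pos by (intro sum.cong refl) (simp add: scale_D)
  also have "\<dots> = of_int (\<Sum>i<L. label_mass i * label_cost i) / (D * D * D)"
    by (simp add: label_cost_def sum_distrib_left sum_distrib_right sum_divide_distrib mult_ac)
  also have "\<dots> \<le> of_int (scale_rat D (cost_bound C) * D * D) / (D * D * D)"
    using adm D_pos by (intro divide_right_mono) (auto simp: admissible_def simp del: of_int_mult of_int_sum)
  also have "\<dots> = of_rat (cost_bound C)"
    using D_pos by (simp add: scale_D)
  finally show "measure_pmf.expectation greedy_pmf (\<lambda>w. of_rat (cost C w)) \<le> (of_rat (cost_bound C) :: real)" .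
next
  fix i assume "i < length (labels C)"
  then have i: "i < L" by (simp add: L_labels)
  have "real_of_int (scale_rat D (label_lo C)) \<le> label_mass i" "label_mass i \<le> real_of_int (scale_rat D (label_hi C))"
    using label_mass_bounds[OF adm i] by auto
  then show "of_rat (label_lo C) \<le> measure_pmf.prob greedy_pmf (label_words C i)"
    "measure_pmf.prob greedy_pmf (label_words C i) \<le> of_rat (label_hi C)"
    using D_pos unfolding prob_label_greedy[OF i] by (simp_all add: scale_D field_simps)
next
  fix i y assume "i < length (labels C)" and y: "y \<in> label_words C i"
    and pos: "0 < measure_pmf.prob greedy_pmf (label_words C i)"
  then have i: "i < L" by (simp add: L_labels)
  obtain k where k: "k < K" "y \<in> cls i k" using y by (auto simp: label_words_eq)
  have card: "0 < card (cls i k)" using k finite_cls by (auto simp: card_gt_0_iff)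
  have label: "label_mass i \<noteq> 0" using pos by (auto simp: prob_label_greedy[OF i])
  have eq: "cond_prob (measure_pmf greedy_pmf) (\<lambda>w. w = y) (\<lambda>w. w \<in> label_words C i) =
      class_mass i k / D / card (cls i k)"
    using label D_pos by (simp add: cond_prob_word[OF y] pmf_greedy[OF i k] prob_label_greedy[OF i])
  have "real_of_int (scale_rat D (word_lo C ! i) * class_count C \<theta>s i k) \<le> class_mass i k"
    "class_mass i k \<le> real_of_int (scale_rat D (word_hi C ! i) * class_count C \<theta>s i k)"
    using class_bounds[OF i k(1)] by (simp_all only: of_int_le_iff)
  then show "of_rat (word_lo C ! i) \<le> cond_prob (measure_pmf greedy_pmf) (\<lambda>w. w = y) (\<lambda>w. w \<in> label_words C i)"
    "cond_prob (measure_pmf greedy_pmf) (\<lambda>w. w = y) (\<lambda>w. w \<in> label_words C i) \<le> of_rat (word_hi C ! i)"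
    using D_pos card i unfolding eq by (simp_all add: scale_D class_count_def field_simps)
qed

end

lemma feasible_iff: "feasible C \<longleftrightarrow> admissible"
  using improvising_imp_admissible improvising_greedy by (auto simp: feasible_def)

end

section \<open>Uniform sampling by rejection\<close>

lemma spmf_bind_spmf_of_set:
  "spmf (bind_spmf (spmf_of_set A) F) z = (\<Sum>a\<in>A. spmf (F a) z) / card A"
  by (simp add: spmf_bind integral_spmf_of_set)

definition bits :: "int \<Rightarrow> nat" where
  "bits W = (LEAST n. W \<le> 2 ^ n)"

lemma le_bits: "W \<le> 2 ^ bits W"
proof -
  have "W \<le> 2 ^ nat W"
  proof (cases "0 \<le> W")
    case True
    have "nat W < 2 ^ nat W" by (rule less_exp)
    then have "int (nat W) < 2 ^ nat W" by (metis of_nat_less_iff of_nat_numeral of_nat_power)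
    then show ?thesis using True by simp
  qed simp
  then show ?thesis unfolding bits_def by (rule LeastI)
qed

lemma less_bits_iff: "j < bits W \<longleftrightarrow> 2 ^ j < W"
proof
  assume "j < bits W"
  then show "2 ^ j < W" using not_less_Least[of j "\<lambda>n. W \<le> 2 ^ n"] by (simp add: bits_def)
next
  assume *: "2 ^ j < W"
  show "j < bits W"
  proof (rule ccontr)
    assume "\<not> j < bits W"
    then have "(2::int) ^ bits W \<le> 2 ^ j" by (intro power_increasing) auto
    then show False using * le_bits[of W] by linarith
  qed
qed

text \<open>Fewer than half of the \<open>bits W\<close>-bit numbers are at least \<open>W\<close>,
  which gives the rejection probability of at most 1/2.\<close>

lemma power_bits_less: "0 < W \<Longrightarrow> 2 ^ bits W < 2 * W"
  using less_bits_iff[of "bits W - 1" W] by (cases "bits W") auto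

lemma val_size_le_bits:
  assumes "0 < W" "0 \<le> i" "i \<le> 2 ^ bits W"
  shows "val_size (Num i) \<le> val_size (Num 2) + val_size (Num W)"
proof -
  have "\<bar>i\<bar> \<le> \<bar>2 * W\<bar>" using assms power_bits_less[of W] by linarith
  from val_size_mono_abs[OF this] show ?thesis
    using val_size_mult_le[of 2 W] by (rule order_trans)
qed

lemma bits_le_size: "bits W \<le> val_size (Num W)"
proof (rule ccontr)
  assume "\<not> ?thesis"
  then have "2 ^ val_size (Num W) < W"
    using less_bits_iff[of "val_size (Num W)" W] by (simp only: not_le)
  moreover have "(2::int) ^ (val_size (Num W) - 1) \<le> 2 ^ val_size (Num W)"
    by (intro power_increasing) auto
  ultimately show False using abs_less_power_val_size[of W] by linarith
qed

text \<open>One more random bit chooses between the two halves of a dyadic block; this is the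
  recursion equation of the bit-sampling loop.\<close>

lemma coin_bind_interval:
  fixes r m :: int
  assumes m: "0 < m"
  shows "bind_spmf coin_spmf (\<lambda>b. spmf_of_set {(2 * r + of_bool b) * m..<(2 * r + of_bool b + 1) * m}) =
    spmf_of_set {r * (2 * m)..<(r + 1) * (2 * m)}"
proof (rule spmf_eqI)
  fix v
  have card: "card {(2 * r + of_bool b) * m..<(2 * r + of_bool b + 1) * m} = nat m" for b
    by (simp add: algebra_simps)
  have card': "card {r * (2 * m)..<(r + 1) * (2 * m)} = 2 * nat m"
    using m by (simp add: algebra_simps nat_mult_distrib)
  have "spmf (bind_spmf coin_spmf (\<lambda>b. spmf_of_set {(2 * r + of_bool b) * m..<(2 * r + of_bool b + 1) * m})) v =
      (indicator {(2 * r + 1) * m..<(2 * r + 1 + 1) * m} v / nat m + indicator {2 * r * m..<(2 * r + 1) * m} v / nat m) / 2"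
    using card[of True] card[of False]
    by (simp add: spmf_bind_spmf_of_set spmf_of_set UNIV_bool)
  also have "\<dots> = (indicator {(2 * r + 1) * m..<(2 * r + 1 + 1) * m} v + indicator {2 * r * m..<(2 * r + 1) * m} v) / (2 * nat m)"
    by (simp add: add_divide_distrib)
  also have "indicator {(2 * r + 1) * m..<(2 * r + 1 + 1) * m} v + indicator {2 * r * m..<(2 * r + 1) * m} v =
      (indicator {r * (2 * m)..<(r + 1) * (2 * m)} v :: real)"
    using m by (auto simp: indicator_def algebra_simps)
  finally show "spmf (bind_spmf coin_spmf (\<lambda>b. spmf_of_set {(2 * r + of_bool b) * m..<(2 * r + of_bool b + 1) * m})) v =
      spmf (spmf_of_set {r * (2 * m)..<(r + 1) * (2 * m)}) v"
    unfolding spmf_of_set card' by simp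
qed

lemma poly_sampled_bits:
  assumes W: "\<And>x. x \<in> X \<Longrightarrow> 0 < W x"
    and size: "poly_bounded X sz (\<lambda>x. val_size (Num (W x)))"
  shows "poly_sampled X sz (\<lambda>x. Num (W x)) (\<lambda>x. map_spmf Num (spmf_of_set {0..<2 ^ bits (W x)}))"
proof -
  define Y where "Y = {(x, j, r :: int). x \<in> X \<and> j \<le> bits (W x) \<and> 0 \<le> r \<and> r < 2 ^ j}"
  \<comment> \<open>The state stores \<open>2 ^ j\<close> in place of \<open>j\<close>, so the guard
    \<open>2 ^ j < W x\<close> finds the number of bits without a logarithm.\<close>
  define a where "a = (\<lambda>(x, j, r). Pr (Num (W x)) (Pr (Num (2 ^ j)) (Num r)))"
  define sz' where "sz' = (\<lambda>y :: 'a \<times> nat \<times> int. sz (fst y))"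
  define N where "N = (\<lambda>(x, j, r). map_spmf (\<lambda>b. (x :: 'a, Suc j, 2 * r + of_bool b :: int)) coin_spmf)"
  \<comment> \<open>After \<open>j\<close> bits with value \<open>r\<close>, the final number is
    uniform on the block of numbers with these leading bits.\<close>
  define M where "M = (\<lambda>(x, j, r). map_spmf (\<lambda>v. Pr (Num (W x)) (Pr (Num (2 ^ bits (W x))) (Num v)))
    (spmf_of_set {r * 2 ^ (bits (W x) - j)..<(r + 1) * 2 ^ (bits (W x) - j)}))"
  let ?e = "Binary Less (Unary Fst (Unary Snd (Var 0))) (Unary Fst (Var 0))"
  have guard: "eval ?e (init_store (a (x, j, r))) \<noteq> Num 0 \<longleftrightarrow> j < bits (W x)" for x j r
    by (simp add: a_def less_bits_iff)
  have pw: "(2::int) ^ j \<le> 2 ^ bits (W x)" if "j \<le> bits (W x)" for j x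
    using that by (intro power_increasing) auto
  have size': "poly_bounded Z sz' (\<lambda>y. val_size (Num (W (fst y))))" if "Z \<subseteq> Y" for Z
    unfolding sz'_def by (rule pb_reindex[OF size]) (use that in \<open>auto simp: Y_def\<close>)
  have double: "poly_bounded Y sz' (\<lambda>y. val_size (Num 2) + val_size (Num (W (fst y))))"
    by (intro pb_intros size' subset_refl)
  have "poly_bounded Y sz' (\<lambda>y. val_size (Num (2 ^ fst (snd y))))"
    by (rule pb_mono[OF double])
      (auto simp: Y_def simp del: val_size.simps(1) intro!: val_size_le_bits W pw)
  moreover have "poly_bounded Y sz' (\<lambda>y. val_size (Num (snd (snd y))))"
    by (rule pb_mono[OF double])
      (auto simp: Y_def simp del: val_size.simps(1) intro!: val_size_le_bits W order_trans[OF less_imp_le pw])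
  ultimately have size_a: "poly_bounded Y sz' (\<lambda>y. val_size (a y))"
    unfolding a_def split_def by (intro pb_Pr size' subset_refl)
  have loop: "poly_sampled Y sz' a M"
  proof (rule poly_sampled_loop[where e = ?e and N = N and \<rho> = "\<lambda>(x, j, r). bits (W x) - j"])
    let ?Z = "{y \<in> Y. eval ?e (init_store (a y)) \<noteq> Num 0}"
    let ?upd = "Binary MkPr (Unary Fst (Unary Fst (Var 0)))
      (Binary MkPr (Binary Mul (Const (Num 2)) (Unary Fst (Unary Snd (Unary Fst (Var 0)))))
        (Binary Add (Binary Mul (Const (Num 2)) (Unary Snd (Unary Snd (Unary Fst (Var 0))))) (Unary Snd (Var 0))))"
    have a: "poly_bounded ?Z sz' (\<lambda>y. val_size (a y))"
      using pb_reindex[OF size_a, of ?Z "\<lambda>y. y" sz'] by auto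
    show "poly_sampled ?Z sz' a (\<lambda>y. map_spmf a (N y))"
      using poly_sampled_map[OF poly_sampled_keep[OF poly_sampled_flip[OF a]], of ?upd]
      by (rule poly_sampled_cong) (auto simp: N_def a_def spmf.map_comp o_def Y_def intro!: map_spmf_cong)
  next
    fix y y' assume y: "y \<in> Y" "eval ?e (init_store (a y)) \<noteq> Num 0" "y' \<in> set_spmf (N y)"
    obtain x j r where yx: "y = (x, j, r)" by (cases y)
    obtain b where y': "y' = (x, Suc j, 2 * r + of_bool b)" using y(3) by (auto simp: yx N_def)
    have "j < bits (W x)" using y(2) guard unfolding yx by blast
    then show "y' \<in> Y \<and> (case y' of (x, j, r) \<Rightarrow> bits (W x) - j) < (case y of (x, j, r) \<Rightarrow> bits (W x) - j) \<and> sz' y' = sz' y"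
      using y(1) by (cases b) (auto simp: yx y' Y_def sz'_def)
  next
    show "poly_bounded Y sz' (\<lambda>(x, j, r). bits (W x) - j)"
      by (rule pb_mono[OF size'[OF subset_refl]])
        (auto simp del: val_size.simps(1) intro: order_trans[OF diff_le_self bits_le_size])
  next
    fix y assume yY: "y \<in> Y"
    obtain x j r where y: "y = (x, j, r)" by (cases y)
    show "M y = (if eval ?e (init_store (a y)) \<noteq> Num 0 then bind_spmf (N y) M else return_spmf (a y))"
    proof (cases "j < bits (W x)")
      case True
      define m where "m = (2::int) ^ (bits (W x) - Suc j)"
      have m: "2 ^ (bits (W x) - j) = 2 * m" "0 < m"
        using True by (auto simp: m_def Suc_diff_Suc simp flip: power_Suc)
      have "bind_spmf (N y) M = map_spmf (\<lambda>v. Pr (Num (W x)) (Pr (Num (2 ^ bits (W x))) (Num v)))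
          (bind_spmf coin_spmf (\<lambda>b. spmf_of_set {(2 * r + of_bool b) * m..<(2 * r + of_bool b + 1) * m}))"
        by (simp add: y N_def M_def bind_map_spmf map_spmf_bind_spmf o_def m_def)
      also have "\<dots> = M y"
        unfolding coin_bind_interval[OF m(2)] by (simp add: y M_def m(1))
      finally show ?thesis using guard[of x j r] True y by simp
    next
      case False
      then have "j = bits (W x)" using yY by (simp add: y Y_def)
      moreover have "{r..<r + 1} = {r}" by auto
      ultimately show ?thesis
        using guard[of x j r] by (simp add: y M_def a_def spmf_of_set_singleton)
    qed
  qed (rule size_a)
  have init: "poly_computed X sz (\<lambda>x. Num (W x)) (\<lambda>x. a (x, 0, 0))"
    using poly_computed_eval[OF size, of "Binary MkPr (Var 0) (Const (Pr (Num 1) (Num 0)))"]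
    by (simp add: a_def)
  have "poly_sampled X sz (\<lambda>x. a (x, 0, 0)) (\<lambda>x. M (x, 0, 0))"
    by (rule poly_sampled_reindex[OF loop]) (auto simp: Y_def sz'_def)
  from poly_sampled_comp[OF init this]
  have M: "poly_sampled X sz (\<lambda>x. Num (W x)) (\<lambda>x. M (x, 0, 0))" .
  show ?thesis
    using poly_sampled_map[OF M, of "Unary Snd (Unary Snd (Var 0))"]
    by (rule poly_sampled_cong) (simp_all add: M_def spmf.map_comp o_def)
qed

lemma poly_sampled_uniform:
  assumes W: "\<And>x. x \<in> X \<Longrightarrow> 0 < W x"
    and size: "poly_bounded X sz (\<lambda>x. val_size (Num (W x)))"
  shows "poly_sampled X sz (\<lambda>x. Num (W x)) (\<lambda>x. map_spmf Num (spmf_of_set {0..<W x}))"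
proof -
  \<comment> \<open>The upper bound is inclusive because the loop starts in the artificially
    rejected value \<open>W x\<close>, which may equal \<open>2 ^ bits (W x)\<close>.\<close>
  define Y where "Y = {(x, r). x \<in> X \<and> W x \<le> r \<and> r \<le> 2 ^ bits (W x)}"
  define a where "a = (\<lambda>(x, r). Pr (Num (W x)) (Num r))"
  define K where "K x = map_spmf (Pr (Num (W x))) (map_spmf Num (spmf_of_set {0..<2 ^ bits (W x)}))" for x
  define M where "M x = map_spmf (\<lambda>r. Pr (Num (W x)) (Num r)) (spmf_of_set {0..<W x})" for x
  \<comment> \<open>\<open>Less\<close> returns 0 or 1, so \<open>1 - (r < W)\<close> is nonzero
    exactly while \<open>r\<close> has to be rejected.\<close>
  let ?e = "Binary Sub (Const (Num 1)) (Binary Less (Unary Snd (Var 0)) (Unary Fst (Var 0)))"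
  have W_Y: "poly_bounded Y (\<lambda>y. sz (fst y)) (\<lambda>y. val_size (Num (W (fst y))))"
    by (rule pb_reindex[OF size]) (auto simp: Y_def)
  then have double: "poly_bounded Y (\<lambda>y. sz (fst y)) (\<lambda>y. val_size (Num 2) + val_size (Num (W (fst y))))"
    by (intro pb_intros)
  have "val_size (Num (snd y)) \<le> val_size (Num 2) + val_size (Num (W (fst y)))" if "y \<in> Y" for y
    using that W by (intro val_size_le_bits) (force simp: Y_def)+
  then have size_a: "poly_bounded Y (\<lambda>y. sz (fst y)) (\<lambda>y. val_size (a y))"
    unfolding a_def split_def by (intro pb_Pr W_Y pb_mono[OF double])
  have fst: "poly_computed Y (\<lambda>y. sz (fst y)) a (\<lambda>y. Num (W (fst y)))"
    using poly_computed_eval[OF size_a, of "Unary Fst (Var 0)"] by (simp add: a_def split_def)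
  have "poly_sampled Y (\<lambda>y. sz (fst y)) (\<lambda>y. Num (W (fst y))) (\<lambda>y. K (fst y))"
    unfolding K_def
    by (rule poly_sampled_reindex[OF poly_sampled_keep[OF poly_sampled_bits[OF W size]]]) (auto simp: Y_def)
  from poly_sampledE[OF poly_sampled_comp[OF fst this]] obtain c p
    where c0: "\<And>y. y \<in> Y \<Longrightarrow> runs c (a y) (K (fst y)) (poly p (sz (fst y)))"
    by metis
  obtain C where C: "\<And>v. eval_cost ?e (init_store v) \<le> C * val_size v"
    using eval_cost_linear by blast
  define V where "V x = (\<lambda>r. a (x, r)) ` {W x..2 ^ bits (W x)}" for x
  define B where "B x = 1 + val_size (Num (W x)) + (val_size (Num 2) + val_size (Num (W x)))" for x
  define b where "b x = 2 + C * B x + 2 * B x + 2 * poly p (sz x)" for x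
  have V: "val_size v \<le> B x" if v: "v \<in> V x \<union> set_spmf (K x)" and x: "x \<in> X" for v x
  proof -
    obtain r where r: "v = a (x, r)" "0 \<le> r" "r \<le> 2 ^ bits (W x)"
      using v W[OF x] by (force simp: V_def K_def a_def)
    then show ?thesis
      using val_size_le_bits[OF W[OF x], of r] W[OF x] by (simp add: a_def B_def del: val_size.simps(1))
  qed
  have runs: "runs (loop_com ?e c) (a (x, W x)) (M x) (4 * b x)"
    if x: "x \<in> X" for x
  proof (rule runs_loop_retry[where V = "V x" and K = "K x" and T = "poly p (sz x)"])
    define m where "m = (2::int) ^ bits (W x)"
    have m: "W x \<le> m" "m < 2 * W x" "0 < W x"
      using le_bits power_bits_less W[OF x] by (auto simp: m_def)
    have K: "K x = map_spmf (\<lambda>r. a (x, r)) (spmf_of_set {0..<m})"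
      by (simp add: K_def m_def a_def spmf.map_comp o_def)
    have inV: "a (x, r) \<in> V x \<longleftrightarrow> W x \<le> r" if "r \<in> {0..<m}" for r
      using that by (auto simp: V_def a_def m_def)
    show "a (x, W x) \<in> V x" using m by (simp add: V_def m_def)
    show "eval ?e (init_store v) \<noteq> Num 0" if "v \<in> V x" for v
      using that by (auto simp: V_def a_def)
    show "eval ?e (init_store v) = Num 0" if "v \<in> set_spmf (K x)" "v \<notin> V x" for v
      using that inV by (auto simp: K a_def)
    show "runs c v (K x) (poly p (sz x))" if "v \<in> V x" for v
      using that c0[of "(x, r)" for r] x by (auto simp: V_def Y_def)
    show "measure (measure_spmf (K x)) (V x) \<le> 1 / 2"
    proof -
      have "measure (measure_spmf (K x)) (V x) = measure (measure_spmf (spmf_of_set {0..<m})) {r. a (x, r) \<in> V x}"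
        by (simp add: K measure_map_spmf vimage_def)
      also have "\<dots> = card ({0..<m} \<inter> {r. a (x, r) \<in> V x}) / card {0..<m}"
        by (simp add: measure_spmf_of_set)
      also have "{0..<m} \<inter> {r. a (x, r) \<in> V x} = {W x..<m}" using inV m by auto
      finally have "measure (measure_spmf (K x)) (V x) = (m - W x) / m" using m by simp
      also have "\<dots> \<le> 1 / 2" using m by (simp add: divide_le_eq)
      finally show ?thesis .
    qed
    show "2 + eval_cost ?e (init_store v) + 2 * val_size v + 2 * poly p (sz x) \<le> b x"
      if "v \<in> V x \<union> set_spmf (K x)" for v
    proof -
      have "C * val_size v \<le> C * B x" using V[OF that x] by (rule mult_left_mono) simp
      then show ?thesis using C[of v] V[OF that x] unfolding b_def by linarith
    qed
    show "X = M x" if X: "X = bind_spmf (K x) (\<lambda>u. if u \<in> V x then X else return_spmf u)" for X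
    proof (rule spmf_eqI)
      fix z
      let ?s = "\<Sum>r\<in>{0..<W x}. spmf (return_spmf (a (x, r))) z"
      have "spmf X z = spmf (bind_spmf (spmf_of_set {0..<m})
          (\<lambda>r. if W x \<le> r then X else return_spmf (a (x, r)))) z"
        using inV by (subst X) (auto simp: K bind_map_spmf o_def intro!: arg_cong[where f = "\<lambda>p. spmf p z"] bind_spmf_cong)
      also have "\<dots> = (\<Sum>r\<in>{0..<m}. spmf (if W x \<le> r then X else return_spmf (a (x, r))) z) / m"
        using m by (simp add: spmf_bind_spmf_of_set)
      also have "{0..<m} = {0..<W x} \<union> {W x..<m}" using m by auto
      also have "(\<Sum>r\<in>{0..<W x} \<union> {W x..<m}. spmf (if W x \<le> r then X else return_spmf (a (x, r))) z) =
          ?s + (m - W x) * spmf X z"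
        using m by (subst sum.union_disjoint) auto
      \<comment> \<open>The equation is linear in \<open>spmf X z\<close> with coefficient
        \<open>(m - W x) / m\<close>, which is less than 1, and so determines it.\<close>
      finally have "spmf X z = ?s / W x" using m by (simp add: field_simps)
      also have "\<dots> = spmf (M x) z"
        using m by (simp add: M_def map_spmf_conv_bind_spmf spmf_bind_spmf_of_set a_def)
      finally show "spmf X z = spmf (M x) z" .
    qed
    show "lossless_spmf (M x)" using m by (simp add: M_def)
  qed
  have init: "poly_computed X sz (\<lambda>x. Num (W x)) (\<lambda>x. a (x, W x))"
    using poly_computed_eval[OF size, of "Binary MkPr (Var 0) (Var 0)"] by (simp add: a_def)
  have "poly_sampled X sz (\<lambda>x. a (x, W x)) M"
  proof (rule poly_sampledI[OF poly_computed_output[OF init] _ runs])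
    show "poly_bounded X sz (\<lambda>x. 4 * b x)"
      unfolding b_def B_def by (intro pb_intros size)
  qed
  from poly_sampled_comp[OF init this]
  have M: "poly_sampled X sz (\<lambda>x. Num (W x)) M" .
  show ?thesis
    using poly_sampled_map[OF M, of "Unary Snd (Var 0)"]
    by (rule poly_sampled_cong) (simp_all add: M_def spmf.map_comp o_def)
qed

section \<open>A term language of polynomial-time functions\<close>

text \<open>
  In \<open>tm\<close>, variables are de Bruijn indices, \<open>Data\<close> is the encoded instance paired with the list of its
  costs, and \<open>Fold\<close> iterates over the indices of the labels or of the costs. Besides such indices,
  variables hold values of bounded size (the random numbers of the improviser). Folding with \<open>Tail\<close>
  drops as many elements of a list as there are nonzero values, which serves for list lookup.
  The flag of \<open>typed\<close> permits \<open>Count\<close>: the queries for the counts are built by terms without it.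
\<close>

datatype kind = Label_Index | Cost_Index | Bounded

datatype fold_op = Arith binop | Tail

datatype tm =
    Loc nat
  | Data
  | Lit val
  | UnT unop tm
  | BinT binop tm tm
  | Cond tm tm tm
  | Count nat nat
  | Fold fold_op kind tm tm

fun fold_step :: "fold_op \<Rightarrow> val \<Rightarrow> val \<Rightarrow> val" where
  "fold_step (Arith f) acc u = apply_bin f acc u"
| "fold_step Tail acc u = (if u \<noteq> Num 0 then apply_un Snd acc else acc)"

fun index_of :: "val \<Rightarrow> nat" where
  "index_of (Num i) = nat i"
| "index_of (Pr u v) = 0"

fun typed :: "bool \<Rightarrow> kind list \<Rightarrow> tm \<Rightarrow> bool" where
  "typed c \<Gamma> (Loc n) \<longleftrightarrow> n < length \<Gamma>"
| "typed c \<Gamma> Data \<longleftrightarrow> True"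
| "typed c \<Gamma> (Lit v) \<longleftrightarrow> True"
| "typed c \<Gamma> (UnT f t) \<longleftrightarrow> typed c \<Gamma> t"
| "typed c \<Gamma> (BinT f s t) \<longleftrightarrow> typed c \<Gamma> s \<and> typed c \<Gamma> t"
| "typed c \<Gamma> (Cond b s t) \<longleftrightarrow> typed c \<Gamma> b \<and> typed c \<Gamma> s \<and> typed c \<Gamma> t"
| "typed c \<Gamma> (Count a b) \<longleftrightarrow> c \<and> a < length \<Gamma> \<and> b < length \<Gamma> \<and> \<Gamma> ! a = Label_Index \<and> \<Gamma> ! b = Cost_Index"
| "typed c \<Gamma> (Fold f k z t) \<longleftrightarrow> k \<noteq> Bounded \<and> typed c \<Gamma> z \<and> typed c (k # \<Gamma>) t"

locale costed_class =
  fixes nc :: "nat \<Rightarrow> val" and S :: "('a::finite, 'l) lqci set" and \<theta> :: "('a, 'l) lqci \<Rightarrow> rat list"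
    and bnd :: "('a, 'l) lqci \<Rightarrow> nat"
  assumes inst: "\<And>C. C \<in> S \<Longrightarrow> lqci_instance C"
    and \<theta>: "\<And>C. C \<in> S \<Longrightarrow> distinct (\<theta> C) \<and> set (\<theta> C) = costs C"
    and \<theta>_size: "poly_bounded S (inst_size nc) (\<lambda>C. val_size (list_val (map rat_val (\<theta> C))))"
    and bnd: "poly_bounded S (inst_size nc) bnd"
begin

definition data :: "('a, 'l) lqci \<Rightarrow> val" where
  "data C = Pr (inst_val nc C) (list_val (map rat_val (\<theta> C)))"

fun index_list :: "('a, 'l) lqci \<Rightarrow> kind \<Rightarrow> rat list" where
  "index_list C Label_Index = word_lo C"
| "index_list C Cost_Index = \<theta> C"
| "index_list C Bounded = []"

fun has_kind :: "('a, 'l) lqci \<Rightarrow> kind \<Rightarrow> val \<Rightarrow> bool" where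
  "has_kind C Bounded v \<longleftrightarrow> val_size v \<le> bnd C"
| "has_kind C k v \<longleftrightarrow> (\<exists>i<length (index_list C k). v = Num (int i))"

fun den :: "tm \<Rightarrow> ('a, 'l) lqci \<Rightarrow> val list \<Rightarrow> val" where
  "den (Loc n) C \<rho> = \<rho> ! n"
| "den Data C \<rho> = data C"
| "den (Lit v) C \<rho> = v"
| "den (UnT f t) C \<rho> = apply_un f (den t C \<rho>)"
| "den (BinT f s t) C \<rho> = apply_bin f (den s C \<rho>) (den t C \<rho>)"
| "den (Cond b s t) C \<rho> = (if den b C \<rho> \<noteq> Num 0 then den s C \<rho> else den t C \<rho>)"
| "den (Count a b) C \<rho> = Num (class_count C (\<theta> C) (index_of (\<rho> ! a)) (index_of (\<rho> ! b)))"
| "den (Fold f k z t) C \<rho> = foldl (\<lambda>acc j. fold_step f acc (den t C (Num (int j) # \<rho>))) (den z C \<rho>)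
    [0..<length (index_list C k)]"

definition envs :: "kind list \<Rightarrow> (('a, 'l) lqci \<times> val list) set" where
  "envs \<Gamma> = {(C, \<rho>). C \<in> S \<and> list_all2 (has_kind C) \<Gamma> \<rho>}"

definition env_size :: "('a, 'l) lqci \<times> val list \<Rightarrow> nat" where
  "env_size x = inst_size nc (fst x)"

definition env_val :: "('a, 'l) lqci \<times> val list \<Rightarrow> val" where
  "env_val x = Pr (data (fst x)) (list_val (snd x))"

abbreviation computable :: "kind list \<Rightarrow> (('a, 'l) lqci \<times> val list \<Rightarrow> val) \<Rightarrow> bool" where
  "computable \<Gamma> f \<equiv> poly_computed (envs \<Gamma>) env_size env_val f"

lemma val_size_nat_le: "val_size (Num (int i)) \<le> i + 2"
proof -
  have "\<bar>int i\<bar> < 2 ^ Suc i"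
    using of_nat_less_two_power[of i, where 'a = int] unfolding power_Suc abs_of_nat by linarith
  then show ?thesis by (subst (asm) val_size_Num_le_iff[symmetric]) simp
qed

lemma length_le_val_size: "length vs \<le> val_size (list_val vs)"
  by (induction vs) auto

lemma val_size_list_elem: "v \<in> set vs \<Longrightarrow> val_size v \<le> val_size (list_val vs)"
  by (induction vs) auto

lemma val_size_list_drop: "val_size (list_val (drop n vs)) \<le> val_size (list_val vs)"
proof (induction vs arbitrary: n)
  case (Cons v vs)
  then show ?case by (cases n) (auto intro: le_SucI trans_le_add2)
qed simp

lemma index_list_bounded: "poly_bounded S (inst_size nc) (\<lambda>C. val_size (list_val (map rat_val (index_list C k))))"
proof (cases k)
  case Label_Index
  have "val_size (list_val (map rat_val (word_lo C))) \<le> inst_size nc C" for C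
    unfolding inst_size_def inst_val_def by (intro val_size_list_elem) simp
  then show ?thesis using Label_Index by (intro pb_mono[OF pb_size]) simp
next
  case Cost_Index
  then show ?thesis using \<theta>_size by simp
next
  case Bounded
  then show ?thesis using pb_const[of S "inst_size nc" 1] by (simp add: floorlog_def)
qed

lemma length_bounded: "poly_bounded S (inst_size nc) (\<lambda>C. length (index_list C k))"
  by (rule pb_mono[OF index_list_bounded[of k]]) (rule order_trans[OF _ length_le_val_size], simp)

lemma data_bounded: "poly_bounded S (inst_size nc) (\<lambda>C. val_size (data C))"
proof -
  have "poly_bounded S (inst_size nc) (\<lambda>C. 1 + inst_size nc C + val_size (list_val (map rat_val (\<theta> C))))"
    by (intro pb_intros \<theta>_size)
  then show ?thesis by (simp add: data_def inst_size_def)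
qed

lemma has_kind_bounded:
  "\<exists>p. \<forall>C\<in>S. \<forall>v. has_kind C k v \<longrightarrow> val_size v \<le> poly p (inst_size nc C)"
proof (cases "k = Bounded")
  case True
  then show ?thesis using bnd by (auto simp: poly_bounded_def intro: order_trans)
next
  case False
  have "poly_bounded S (inst_size nc) (\<lambda>C. length (index_list C k) + 2)"
    by (intro pb_intros length_bounded)
  then obtain p where p: "\<forall>C\<in>S. length (index_list C k) + 2 \<le> poly p (inst_size nc C)"
    unfolding poly_bounded_def by blast
  have "val_size v \<le> poly p (inst_size nc C)" if C: "C \<in> S" and v: "has_kind C k v" for C v
  proof -
    obtain i where "i < length (index_list C k)" "v = Num (int i)"
      using v False by (cases k) auto
    then show ?thesis using p C val_size_nat_le[of i] by fastforce
  qed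
  then show ?thesis by blast
qed

lemma env_bounded: "poly_bounded (envs \<Gamma>) env_size (\<lambda>x. val_size (env_val x))"
proof -
  have "\<exists>p. \<forall>C\<in>S. \<forall>\<rho>. list_all2 (has_kind C) \<Gamma> \<rho> \<longrightarrow> val_size (list_val \<rho>) \<le> poly p (inst_size nc C)"
  proof (induction \<Gamma>)
    case Nil
    show ?case by (intro exI[of _ "[:1:]"]) (auto simp: floorlog_def)
  next
    case (Cons k \<Gamma>)
    then obtain p where p: "\<forall>C\<in>S. \<forall>\<rho>. list_all2 (has_kind C) \<Gamma> \<rho> \<longrightarrow> val_size (list_val \<rho>) \<le> poly p (inst_size nc C)"
      by blast
    obtain q where q: "\<forall>C\<in>S. \<forall>v. has_kind C k v \<longrightarrow> val_size v \<le> poly q (inst_size nc C)"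
      using has_kind_bounded by blast
    show ?case
    proof (intro exI[of _ "1 + q + p"] ballI allI impI)
      fix C \<rho> assume C: "C \<in> S" and "list_all2 (has_kind C) (k # \<Gamma>) \<rho>"
      then obtain v \<rho>' where \<rho>: "\<rho> = v # \<rho>'" "has_kind C k v" "list_all2 (has_kind C) \<Gamma> \<rho>'"
        by (auto simp: list_all2_Cons1)
      then have "val_size v \<le> poly q (inst_size nc C)" "val_size (list_val \<rho>') \<le> poly p (inst_size nc C)"
        using p q C by blast+
      then show "val_size (list_val \<rho>) \<le> poly (1 + q + p) (inst_size nc C)"
        by (simp add: \<rho>(1))
    qed
  qed
  then obtain p where p: "\<And>C \<rho>. C \<in> S \<Longrightarrow> list_all2 (has_kind C) \<Gamma> \<rho> \<Longrightarrow> val_size (list_val \<rho>) \<le> poly p (inst_size nc C)"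
    by blast
  have "poly_bounded (envs \<Gamma>) env_size (\<lambda>x. 1 + val_size (data (fst x)) + poly p (env_size x))"
    by (intro pb_intros pb_reindex[OF data_bounded]) (auto simp: envs_def env_size_def)
  then show ?thesis
    by (rule pb_mono) (use p in \<open>auto simp: envs_def env_val_def env_size_def\<close>)
qed

lemma computable_eval: "computable \<Gamma> (\<lambda>x. eval e (init_store (env_val x)))"
  by (rule poly_computed_eval[OF env_bounded])

lemma computable_data: "computable \<Gamma> (\<lambda>x. data (fst x))"
  using computable_eval[of \<Gamma> "Unary Fst (Var 0)"] by (simp add: env_val_def)

lemma computable_env: "computable \<Gamma> (\<lambda>x. list_val (snd x))"
  using computable_eval[of \<Gamma> "Unary Snd (Var 0)"] by (simp add: env_val_def)

lemma computable_const: "computable \<Gamma> (\<lambda>_. v)"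
  by (rule poly_computed_const[OF env_bounded])

lemma computable_drop:
  assumes "computable \<Gamma> (\<lambda>x. list_val (f x))" "\<And>x. x \<in> envs \<Gamma> \<Longrightarrow> n \<le> length (f x)"
  shows "computable \<Gamma> (\<lambda>x. list_val (drop n (f x)))"
  using assms(2)
proof (induction n)
  case 0
  then show ?case using assms(1) by simp
next
  case (Suc n)
  then have "computable \<Gamma> (\<lambda>x. list_val (drop n (f x)))" by fastforce
  from poly_computed_un[OF this, of Snd] show ?case
  proof (rule poly_sampled_cong)
    fix x assume "x \<in> envs \<Gamma>"
    then have "n < length (f x)" using Suc.prems[of x] by simp
    then show "return_spmf (apply_un Snd (list_val (drop n (f x)))) = return_spmf (list_val (drop (Suc n) (f x)))"
      by (simp add: Cons_nth_drop_Suc[symmetric])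
  qed simp
qed

lemma computable_nth:
  assumes "computable \<Gamma> (\<lambda>x. list_val (f x))" "\<And>x. x \<in> envs \<Gamma> \<Longrightarrow> n < length (f x)"
  shows "computable \<Gamma> (\<lambda>x. f x ! n)"
proof -
  have "computable \<Gamma> (\<lambda>x. list_val (drop n (f x)))"
    by (rule computable_drop[OF assms(1)]) (use assms(2) in fastforce)
  from poly_computed_un[OF this, of Fst] show ?thesis
    by (rule poly_sampled_cong) (simp_all add: assms(2) Cons_nth_drop_Suc[symmetric])
qed

lemma computable_inst: "computable \<Gamma> (\<lambda>x. inst_val nc (fst x))"
  using poly_computed_un[OF computable_data, of \<Gamma> Fst] by (simp add: data_def)

lemma computable_index_list: "k \<noteq> Bounded \<Longrightarrow> computable \<Gamma> (\<lambda>x. list_val (map rat_val (index_list (fst x) k)))"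
proof (cases k)
  case Label_Index
  have "computable \<Gamma> (\<lambda>x. [hard_code (fst x), cost_code (fst x), label_code (fst x), nc (min_len (fst x)),
     nc (max_len (fst x)), rat_val (cost_bound (fst x)), rat_val (label_lo (fst x)), rat_val (label_hi (fst x)),
     list_val (map rat_val (word_lo (fst x))), list_val (map rat_val (word_hi (fst x)))] ! 8)"
    using computable_inst[of \<Gamma>] unfolding inst_val_def by (rule computable_nth) simp
  then show ?thesis using Label_Index by simp
next
  case Cost_Index
  then show ?thesis using poly_computed_un[OF computable_data, of \<Gamma> Snd] by (simp add: data_def)
qed simp

lemma fold_step_size: "val_size (fold_step f acc u) \<le> val_size acc + val_size u + 2"
proof (cases f)
  case (Arith g)
  then show ?thesis using val_size_apply_bin by simp
next
  case Tail
  then show ?thesis using val_size_apply_un[of Snd acc] by simp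
qed

lemma poly_computed_fold_step:
  assumes "poly_computed X sz a b" "poly_computed X sz a c"
  shows "poly_computed X sz a (\<lambda>x. fold_step f (b x) (c x))"
proof (cases f)
  case (Arith g)
  then show ?thesis using poly_computed_bin[OF assms, of g] by simp
next
  case Tail
  have "poly_sampled X sz a (\<lambda>x. if c x \<noteq> Num 0 then return_spmf (apply_un Snd (b x)) else return_spmf (b x))"
    by (intro poly_computed_if assms poly_computed_un poly_sampled_subset[OF assms(1)]) auto
  then show ?thesis using Tail by (simp add: if_distrib cong: if_cong)
qed

text \<open>The term \<open>t\<close> does not see the accumulator. Each step therefore adds at most
  the polynomially bounded size of a new value plus 2, even in a product, and the accumulator
  remains polynomial over all steps.\<close>

lemma computable_fold:
  assumes k: "k \<noteq> Bounded" and z: "computable \<Gamma> (\<lambda>x. z x)"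
    and t: "computable (k # \<Gamma>) (\<lambda>x. t (fst x) (snd x))"
  shows "computable \<Gamma> (\<lambda>x. foldl (\<lambda>acc j. fold_step f acc (t (fst x) (Num (int j) # snd x))) (z x)
    [0..<length (index_list (fst x) k)])"
proof -
  define n where "n x = length (index_list (fst x :: ('a, 'l) lqci) k)" for x :: "('a, 'l) lqci \<times> val list"
  define acc where "acc x j = foldl (\<lambda>acc j. fold_step f acc (t (fst x) (Num (int j) # snd x))) (z x) [0..<j]" for x j
  define Y where "Y = {(x, j). x \<in> envs \<Gamma> \<and> j \<le> n x}"
  define rest where "rest x j = list_val (drop j (map rat_val (index_list (fst x :: ('a, 'l) lqci) k)))"
    for x :: "('a, 'l) lqci \<times> val list" and j
  define a where "a = (\<lambda>(x, j). Pr (env_val x) (Pr (rest x j) (Pr (Num (int j)) (acc x j))))"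
  define sz where "sz = (\<lambda>y :: (('a, 'l) lqci \<times> val list) \<times> nat. env_size (fst y))"
  \<comment> \<open>The rest of the list serves as loop counter: the guard is true as long as it is
    a pair. The number \<open>j\<close> is kept beside it as the value of the loop index.\<close>
  let ?e = "Binary Sub (Const (Num 1)) (Unary IsNum (Unary Fst (Unary Snd (Var 0))))"
  have rest: "rest x j = (if j < n x then Pr (rat_val (index_list (fst x) k ! j)) (rest x (Suc j)) else Num 0)" for x j
    by (simp add: rest_def n_def Cons_nth_drop_Suc[symmetric] drop_map)
  have guard: "eval ?e (init_store (a (x, j))) \<noteq> Num 0 \<longleftrightarrow> j < n x" for x j
    by (subst (asm) rest | simp add: a_def rest[of x j])+
  have ext: "(fst x, Num (int j) # snd x) \<in> envs (k # \<Gamma>)" if "x \<in> envs \<Gamma>" "j < n x" for x j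
    using that k by (cases k) (auto simp: envs_def n_def)
  obtain q where q: "\<And>x. x \<in> envs (k # \<Gamma>) \<Longrightarrow> val_size (t (fst x) (snd x)) \<le> poly q (env_size x)"
    using poly_computed_output[OF t] unfolding poly_bounded_def by blast
  have acc_size: "val_size (acc x j) \<le> val_size (z x) + j * (poly q (env_size x) + 2)"
    if "x \<in> envs \<Gamma>" "j \<le> n x" for x j
    using that(2)
  proof (induction j)
    case 0
    then show ?case by (simp add: acc_def)
  next
    case (Suc j)
    have "val_size (t (fst x) (Num (int j) # snd x)) \<le> poly q (env_size x)"
      using q[OF ext[OF that(1), of j]] Suc.prems by (simp add: env_size_def)
    then show ?case
      using Suc fold_step_size[of f "acc x j" "t (fst x) (Num (int j) # snd x)"]
      by (simp add: acc_def)
  qed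
  have len: "poly_bounded Y sz (\<lambda>y. n (fst y))"
    using pb_reindex[OF length_bounded[of k], of Y "\<lambda>y. fst (fst y)" sz]
    by (auto simp: n_def Y_def envs_def sz_def env_size_def)
  have rest_size: "poly_bounded Y sz (\<lambda>y. val_size (list_val (map rat_val (index_list (fst (fst y)) k))))"
    by (rule pb_reindex[OF index_list_bounded]) (auto simp: Y_def envs_def sz_def env_size_def)
  have "poly_bounded Y sz (\<lambda>y. val_size (rest (fst y) (snd y)))"
    by (rule pb_mono[OF rest_size]) (unfold rest_def, rule val_size_list_drop)
  moreover have "poly_bounded Y sz (\<lambda>y. val_size (Num (int (snd y))))"
  proof (rule pb_mono)
    show "poly_bounded Y sz (\<lambda>y. n (fst y) + 2)" by (intro pb_intros len)
    show "val_size (Num (int (snd y))) \<le> n (fst y) + 2" if "y \<in> Y" for y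
      using that val_size_nat_le[of "snd y"] by (auto simp: Y_def)
  qed
  moreover have "poly_bounded Y sz (\<lambda>y. val_size (acc (fst y) (snd y)))"
  proof (rule pb_mono)
    show "poly_bounded Y sz (\<lambda>y. val_size (z (fst y)) + n (fst y) * (poly q (sz y) + 2))"
      by (intro pb_intros len pb_reindex[OF poly_computed_output[OF z]]) (auto simp: Y_def sz_def)
    fix y assume "y \<in> Y"
    then have y: "fst y \<in> envs \<Gamma>" "snd y \<le> n (fst y)" by (auto simp: Y_def)
    have "snd y * (poly q (sz y) + 2) \<le> n (fst y) * (poly q (sz y) + 2)"
      using y(2) by (rule mult_right_mono) simp
    then show "val_size (acc (fst y) (snd y)) \<le> val_size (z (fst y)) + n (fst y) * (poly q (sz y) + 2)"
      using acc_size[OF y] unfolding sz_def by linarith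
  qed
  moreover have "poly_bounded Y sz (\<lambda>y. val_size (env_val (fst y)))"
    by (rule pb_reindex[OF env_bounded[of \<Gamma>]]) (auto simp: Y_def sz_def)
  ultimately have size_a: "poly_bounded Y sz (\<lambda>y. val_size (a y))"
    unfolding a_def split_def by (intro pb_Pr)
  have loop: "poly_computed Y sz a (\<lambda>y. a (fst y, n (fst y)))"
  proof (rule poly_sampled_loop[where e = ?e and N = "\<lambda>(x, j). return_spmf (x, Suc j)" and \<rho> = "\<lambda>(x, j). n x - j"])
    let ?Z = "{y \<in> Y. eval ?e (init_store (a y)) \<noteq> Num 0}"
    have Z: "x \<in> envs \<Gamma>" "j < n x" if "(x, j) \<in> ?Z" for x j
      using that guard[of x j] unfolding Y_def by blast+
    have size_Z: "poly_bounded ?Z sz (\<lambda>y. val_size (a y))"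
      using pb_reindex[OF size_a, of ?Z "\<lambda>y. y" sz] by auto
    note ev = poly_computed_eval[OF size_Z]
    have "poly_computed ?Z sz a (\<lambda>y. env_val (fst (fst y), Num (int (snd y)) # snd (fst y)))"
      using ev[of "Binary MkPr (Unary Fst (Unary Fst (Var 0)))
        (Binary MkPr (Unary Fst (Unary Snd (Unary Snd (Var 0)))) (Unary Snd (Unary Fst (Var 0))))"]
      by (rule poly_sampled_cong) (auto simp: a_def env_val_def)
    moreover have "poly_computed ?Z sz (\<lambda>y. env_val (fst (fst y), Num (int (snd y)) # snd (fst y)))
        (\<lambda>y. t (fst (fst y)) (Num (int (snd y)) # snd (fst y)))"
      using poly_sampled_reindex[OF t, of ?Z "\<lambda>y. (fst (fst y), Num (int (snd y)) # snd (fst y))" sz]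
        Z ext by (auto simp: sz_def env_size_def)
    ultimately have u: "poly_computed ?Z sz a (\<lambda>y. t (fst (fst y)) (Num (int (snd y)) # snd (fst y)))"
      by (rule poly_sampled_comp)
    have acc: "poly_computed ?Z sz a (\<lambda>y. acc (fst y) (snd y))"
      using ev[of "Unary Snd (Unary Snd (Unary Snd (Var 0)))"]
      by (rule poly_sampled_cong) (auto simp: a_def)
    have "poly_computed ?Z sz a (\<lambda>y. acc (fst y) (Suc (snd y)))"
      using poly_computed_fold_step[OF acc u, of f] by (rule poly_sampled_cong) (auto simp: acc_def)
    moreover have "poly_computed ?Z sz a (\<lambda>y. env_val (fst y))"
      using ev[of "Unary Fst (Var 0)"] by (rule poly_sampled_cong) (auto simp: a_def)
    moreover have "poly_computed ?Z sz a (\<lambda>y. rest (fst y) (Suc (snd y)))"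
      using ev[of "Unary Snd (Unary Fst (Unary Snd (Var 0)))"]
    proof (rule poly_sampled_cong)
      fix y assume y: "y \<in> ?Z"
      obtain x j where xj: "y = (x, j)" by (cases y)
      then have "j < n x" using y Z by blast
      then show "return_spmf (eval (Unary Snd (Unary Fst (Unary Snd (Var 0)))) (init_store (a y))) =
          return_spmf (rest (fst y) (Suc (snd y)))"
        by (simp add: xj a_def rest[of x j])
    qed simp
    moreover have "poly_computed ?Z sz a (\<lambda>y. Num (int (Suc (snd y))))"
      using ev[of "Binary Add (Unary Fst (Unary Snd (Unary Snd (Var 0)))) (Const (Num 1))"]
      by (rule poly_sampled_cong) (auto simp: a_def)
    ultimately have "poly_computed ?Z sz a (\<lambda>y. Pr (env_val (fst y)) (Pr (rest (fst y) (Suc (snd y)))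
        (Pr (Num (int (Suc (snd y)))) (acc (fst y) (Suc (snd y))))))"
      by (intro poly_computed_Pr)
    then show "poly_sampled ?Z sz a (\<lambda>y. map_spmf a (case y of (x, j) \<Rightarrow> return_spmf (x, Suc j)))"
      by (rule poly_sampled_cong) (auto simp: a_def)
  next
    fix y y' assume y: "y \<in> Y" "eval ?e (init_store (a y)) \<noteq> Num 0"
      "y' \<in> set_spmf (case y of (x, j) \<Rightarrow> return_spmf (x, Suc j))"
    obtain x j where xj: "y = (x, j)" by (cases y)
    have "j < n x" using y(2) guard unfolding xj by blast
    then show "y' \<in> Y \<and> (case y' of (x, j) \<Rightarrow> n x - j) < (case y of (x, j) \<Rightarrow> n x - j) \<and> sz y' = sz y"
      using y(1,3) by (auto simp: xj Y_def sz_def)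
  next
    show "poly_bounded Y sz (\<lambda>(x, j). n x - j)"
      by (rule pb_mono[OF len]) auto
  next
    fix y assume yY: "y \<in> Y"
    obtain x j where xj: "y = (x, j)" by (cases y)
    show "return_spmf (a (fst y, n (fst y))) = (if eval ?e (init_store (a y)) \<noteq> Num 0
      then bind_spmf (case y of (x, j) \<Rightarrow> return_spmf (x, Suc j)) (\<lambda>y. return_spmf (a (fst y, n (fst y))))
      else return_spmf (a y))"
      using guard[of x j] yY by (auto simp: xj Y_def)
  qed (rule size_a)
  have "computable \<Gamma> (\<lambda>x. Pr (env_val x) (Pr (list_val (map rat_val (index_list (fst x) k))) (Pr (Num 0) (z x))))"
    by (intro poly_computed_Pr poly_computed_id env_bounded computable_index_list k computable_const z)
  then have 1: "computable \<Gamma> (\<lambda>x. a (x, 0))"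
    by (simp add: a_def rest_def acc_def)
  have 2: "poly_computed (envs \<Gamma>) env_size (\<lambda>x. a (x, 0)) (\<lambda>x. a (x, n x))"
    using poly_sampled_reindex[OF loop, of "envs \<Gamma>" "\<lambda>x. (x, 0)" env_size]
    by (auto simp: Y_def sz_def)
  have "computable \<Gamma> (\<lambda>x. acc x (n x))"
    using poly_computed_un[OF poly_computed_un[OF poly_computed_un[OF poly_sampled_comp[OF 1 2], of Snd], of Snd], of Snd]
    by (simp add: a_def)
  then show ?thesis by (simp add: acc_def n_def)
qed

text \<open>The case of \<open>Count\<close> is left as a hypothesis. With the flag
  \<open>False\<close> it is vacuous, which makes the queries to the counter computable; with
  \<open>True\<close> it is then discharged by means of those queries.\<close>

lemma computable_tm_aux:
  assumes "\<And>\<Gamma> a b. typed c \<Gamma> (Count a b) \<Longrightarrow> computable \<Gamma> (\<lambda>x. den (Count a b) (fst x) (snd x))"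
  shows "typed c \<Gamma> t \<Longrightarrow> computable \<Gamma> (\<lambda>x. den t (fst x) (snd x))"
proof (induction t arbitrary: \<Gamma>)
  case (Loc n)
  have "computable \<Gamma> (\<lambda>x. snd x ! n)"
    by (rule computable_nth[OF computable_env]) (use Loc in \<open>auto simp: envs_def dest: list_all2_lengthD\<close>)
  then show ?case by simp
next
  case Data
  show ?case using computable_data by simp
next
  case (Lit v)
  show ?case using computable_const by simp
next
  case (UnT f t)
  then show ?case using poly_computed_un[OF UnT.IH, of \<Gamma> f] by simp
next
  case (BinT f s t)
  then show ?case using poly_computed_bin[OF BinT.IH, of \<Gamma> f] by simp
next
  case (Cond b s t)
  have "poly_sampled (envs \<Gamma>) env_size env_val (\<lambda>x. if den b (fst x) (snd x) \<noteq> Num 0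
      then return_spmf (den s (fst x) (snd x)) else return_spmf (den t (fst x) (snd x)))"
    using Cond by (intro poly_computed_if) (auto intro: poly_sampled_subset)
  then show ?case by (simp add: if_distrib cong: if_cong)
next
  case (Count a b)
  then show ?case by (rule assms)
next
  case (Fold f k z t)
  then show ?case using computable_fold[of k \<Gamma> "\<lambda>x. den z (fst x) (snd x)" "den t" f] by simp
qed

end

section \<open>Terms for the greedy allocation\<close>

definition "less_tm s t = BinT Less s t"
definition "add_tm s t = BinT Add s t"
definition "sub_tm s t = BinT Sub s t"
definition "mul_tm s t = BinT Mul s t"
definition "ite_tm b s t = Cond b s t"
definition "sum_tm k t = Fold (Arith Add) k (Lit (Num 0)) t"
definition "prod_tm k t = Fold (Arith Mul) k (Lit (Num 1)) t"
definition "max0_tm t = ite_tm (less_tm (Lit (Num 0)) t) t (Lit (Num 0))"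
definition "min_tm s t = ite_tm (less_tm s t) s t"

text \<open>One element is dropped for each loop index below the value of \<open>Loc a\<close>.
  Below a \<open>Fold\<close>, \<open>Loc 0\<close> is the loop index and outer variables move up by
  one, hence \<open>Suc a\<close>.\<close>

definition "nth_tm k xs a = UnT Fst (Fold Tail k xs (less_tm (Loc 0) (Loc (Suc a))))"
definition "numer_tm q = UnT Fst q"
definition "denom_tm q = UnT Snd q"

text \<open>Positions in the list of \<open>inst_val\<close> count from 0: 5 is the cost bound, 6
  and 7 are the label bounds, 8 and 9 the lists of word bounds.\<close>

definition "field_tm n = UnT Fst ((UnT Snd ^^ n) (UnT Fst Data))"
definition "theta_tm a = nth_tm Cost_Index (UnT Snd Data) a"
definition "word_lo_tm a = nth_tm Label_Index (field_tm 8) a"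
definition "word_hi_tm a = nth_tm Label_Index (field_tm 9) a"

definition "denominator_tm =
  mul_tm (mul_tm (prod_tm Cost_Index (denom_tm (theta_tm 0)))
    (mul_tm (prod_tm Label_Index (denom_tm (word_lo_tm 0))) (prod_tm Label_Index (denom_tm (word_hi_tm 0)))))
  (mul_tm (denom_tm (field_tm 6)) (mul_tm (denom_tm (field_tm 7)) (denom_tm (field_tm 5))))"

definition "scale_tm q = mul_tm (numer_tm q) (BinT Div denominator_tm (denom_tm q))"

definition "lo_tm i k = mul_tm (scale_tm (word_lo_tm i)) (Count i k)"
definition "hi_tm i k = mul_tm (scale_tm (word_hi_tm i)) (Count i k)"
definition "cost_tm k = scale_tm (theta_tm k)"

definition "N_tm i = sum_tm Cost_Index (Count (Suc i) 0)"

definition "class_mass_tm i k = add_tm (lo_tm i k) (max0_tm (min_tm (sub_tm (hi_tm i k) (lo_tm i k))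
  (sub_tm (sub_tm denominator_tm (sum_tm Cost_Index (lo_tm (Suc i) 0)))
    (sum_tm Cost_Index (ite_tm (less_tm (cost_tm 0) (cost_tm (Suc k)))
      (sub_tm (hi_tm (Suc i) 0) (lo_tm (Suc i) 0)) (Lit (Num 0)))))))"

text \<open>Conjunctions are nested conditionals, and \<open>x \<le> y\<close> is expressed by
  \<open>y < x\<close> with exchanged branches.\<close>

definition "valid_tm i = ite_tm (less_tm (Lit (Num 0)) (N_tm i))
  (ite_tm (less_tm denominator_tm (mul_tm (scale_tm (word_lo_tm i)) (N_tm i))) (Lit (Num 0))
    (ite_tm (less_tm (mul_tm (scale_tm (word_hi_tm i)) (N_tm i)) denominator_tm) (Lit (Num 0)) (Lit (Num 1))))
  (Lit (Num 0))"

definition "label_cost_tm i = sum_tm Cost_Index (mul_tm (cost_tm 0) (class_mass_tm (Suc i) 0))"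
definition "label_key_tm i = add_tm (mul_tm (label_cost_tm i) (sum_tm Label_Index (Lit (Num 1)))) (Loc i)"

definition "lam_tm = scale_tm (field_tm 6)"
definition "rho_tm = scale_tm (field_tm 7)"

text \<open>Transcribes \<open>fill\<close> over the valid labels. A \<open>Fold\<close> cannot
  range over a computed set, so labels that are not valid contribute 0 to sums over all
  labels.\<close>

definition "label_mass_tm i = ite_tm (valid_tm i)
  (add_tm lam_tm (max0_tm (min_tm (sub_tm rho_tm lam_tm)
    (sub_tm (sub_tm denominator_tm (sum_tm Label_Index (ite_tm (valid_tm 0) lam_tm (Lit (Num 0)))))
      (sum_tm Label_Index (ite_tm (valid_tm 0) (ite_tm (less_tm (label_key_tm 0) (label_key_tm (Suc i)))
        (sub_tm rho_tm lam_tm) (Lit (Num 0))) (Lit (Num 0))))))))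
  (Lit (Num 0))"

definition "valids_tm = sum_tm Label_Index (valid_tm 0)"

definition "admissible_tm =
  ite_tm (ite_tm (BinT Equal valids_tm (sum_tm Label_Index (Lit (Num 1)))) (Lit (Num 1))
    (ite_tm (less_tm (Lit (Num 0)) lam_tm) (Lit (Num 0)) (Lit (Num 1))))
  (ite_tm (less_tm denominator_tm (mul_tm lam_tm valids_tm)) (Lit (Num 0))
    (ite_tm (less_tm (mul_tm rho_tm valids_tm) denominator_tm) (Lit (Num 0))
      (ite_tm (less_tm (mul_tm (mul_tm (scale_tm (field_tm 5)) denominator_tm) denominator_tm)
          (sum_tm Label_Index (mul_tm (label_mass_tm 0) (label_cost_tm 0))))
        (Lit (Num 0)) (Lit (Num 1)))))
  (Lit (Num 0))"

text \<open>A prefix sum is a full sum whose terms beyond the outer index \<open>Loc 1\<close> are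
  replaced by 0. The weight \<open>w\<close> is evaluated below both loop indices, the random number
  \<open>Loc r\<close> is read below one of them.\<close>

definition "select_tm k w r = sum_tm k (ite_tm
  (less_tm (Loc (Suc r)) (sum_tm k (ite_tm (less_tm (Loc 1) (Loc 0)) (Lit (Num 0)) w)))
  (Lit (Num 0)) (Lit (Num 1)))"

definition "query_tm i k = BinT MkPr (UnT Fst Data) (BinT MkPr (Loc i) (BinT MkPr (theta_tm k) (Lit (Num 0))))"

lemmas basic_tm_defs = less_tm_def add_tm_def sub_tm_def mul_tm_def ite_tm_def sum_tm_def prod_tm_def
  max0_tm_def min_tm_def numer_tm_def denom_tm_def

section \<open>Typing of the terms\<close>

lemma typed_field: "typed c \<Gamma> (field_tm n)"
proof -
  have "typed c \<Gamma> ((UnT Snd ^^ n) (UnT Fst Data))" by (induction n) auto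
  then show ?thesis by (simp add: field_tm_def)
qed

lemma typed_nth: "typed c \<Gamma> xs \<Longrightarrow> k \<noteq> Bounded \<Longrightarrow> a < length \<Gamma> \<Longrightarrow> typed c \<Gamma> (nth_tm k xs a)"
  by (simp add: nth_tm_def less_tm_def)

lemma typed_rat:
  "a < length \<Gamma> \<Longrightarrow> typed c \<Gamma> (theta_tm a)"
  "a < length \<Gamma> \<Longrightarrow> typed c \<Gamma> (word_lo_tm a)"
  "a < length \<Gamma> \<Longrightarrow> typed c \<Gamma> (word_hi_tm a)"
  by (simp_all add: theta_tm_def word_lo_tm_def word_hi_tm_def typed_nth typed_field)

lemma typed_denominator: "typed c \<Gamma> denominator_tm"
  by (simp add: denominator_tm_def basic_tm_defs typed_rat typed_field)

lemma typed_scale: "typed c \<Gamma> q \<Longrightarrow> typed c \<Gamma> (scale_tm q)"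
  by (simp add: scale_tm_def basic_tm_defs typed_denominator)

abbreviation "is_class_of \<Gamma> i k \<equiv> i < length \<Gamma> \<and> k < length \<Gamma> \<and> \<Gamma> ! i = Label_Index \<and> \<Gamma> ! k = Cost_Index"
abbreviation "is_label_of \<Gamma> i \<equiv> i < length \<Gamma> \<and> \<Gamma> ! i = Label_Index"

lemma typed_lo_hi:
  "is_class_of \<Gamma> i k \<Longrightarrow> typed True \<Gamma> (lo_tm i k)"
  "is_class_of \<Gamma> i k \<Longrightarrow> typed True \<Gamma> (hi_tm i k)"
  "k < length \<Gamma> \<Longrightarrow> typed c \<Gamma> (cost_tm k)"
  by (simp_all add: lo_tm_def hi_tm_def cost_tm_def typed_scale typed_rat mul_tm_def)

lemma typed_class_mass: "is_class_of \<Gamma> i k \<Longrightarrow> typed True \<Gamma> (class_mass_tm i k)"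
  by (simp add: class_mass_tm_def basic_tm_defs typed_denominator typed_lo_hi)

lemma typed_valid: "is_label_of \<Gamma> i \<Longrightarrow> typed True \<Gamma> (valid_tm i)"
  by (simp add: valid_tm_def N_tm_def basic_tm_defs typed_denominator typed_rat typed_scale)

lemma typed_label_cost: "is_label_of \<Gamma> i \<Longrightarrow> typed True \<Gamma> (label_cost_tm i)"
  by (simp add: label_cost_tm_def basic_tm_defs typed_lo_hi typed_class_mass)

lemma typed_label_key: "is_label_of \<Gamma> i \<Longrightarrow> typed True \<Gamma> (label_key_tm i)"
  by (simp add: label_key_tm_def basic_tm_defs typed_label_cost)

lemma typed_lam_rho: "typed c \<Gamma> lam_tm" "typed c \<Gamma> rho_tm"
  by (simp_all add: lam_tm_def rho_tm_def typed_scale typed_field)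

lemma typed_label_mass: "is_label_of \<Gamma> i \<Longrightarrow> typed True \<Gamma> (label_mass_tm i)"
  by (simp add: label_mass_tm_def basic_tm_defs typed_lam_rho typed_denominator typed_valid typed_label_key)

lemma typed_admissible: "typed True \<Gamma> admissible_tm"
  by (simp add: admissible_tm_def valids_tm_def basic_tm_defs typed_lam_rho typed_denominator typed_valid
      typed_label_cost typed_label_mass typed_scale typed_field)

lemma typed_select:
  "k \<noteq> Bounded \<Longrightarrow> r < length \<Gamma> \<Longrightarrow> typed c (k # k # \<Gamma>) w \<Longrightarrow> typed c \<Gamma> (select_tm k w r)"
  by (simp add: select_tm_def basic_tm_defs)

lemma typed_query: "i < length \<Gamma> \<Longrightarrow> k < length \<Gamma> \<Longrightarrow> typed c \<Gamma> (query_tm i k)"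
  by (simp add: query_tm_def typed_rat)

section \<open>Values of the terms\<close>

fun to_int :: "val \<Rightarrow> int" where
  "to_int (Num i) = i"
| "to_int (Pr u v) = 0"

fun is_num :: "val \<Rightarrow> bool" where
  "is_num (Num i) \<longleftrightarrow> True"
| "is_num (Pr u v) \<longleftrightarrow> False"

lemma is_num_eq: "is_num v \<Longrightarrow> v = Num (to_int v)"
  by (cases v) auto

lemma to_int_if [simp]: "to_int (if b then u else v) = (if b then to_int u else to_int v)"
  by simp

definition is_index :: "nat \<Rightarrow> val \<Rightarrow> bool" where
  "is_index n v \<longleftrightarrow> (\<exists>i<n. v = Num (int i))"

lemma is_index_Num [simp]: "is_index n (Num (int i)) \<longleftrightarrow> i < n"
  by (auto simp: is_index_def)

lemma is_indexD: "is_index n v \<Longrightarrow> index_of v < n" "is_index n v \<Longrightarrow> v = Num (int (index_of v))"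
  by (auto simp: is_index_def)

lemma rat_val_fst_snd: "rat_val q = Pr (Num (fst (quotient_of q))) (Num (snd (quotient_of q)))"
  by (simp add: rat_val_def split: prod.splits)

locale class_member = costed_class +
  fixes C
  assumes CS: "C \<in> S"
begin

sublocale costed_instance C "\<theta> C"
  by unfold_locales (use inst \<theta> CS in auto)

lemma den_arith:
  assumes "is_num (den s C \<rho>)" "is_num (den t C \<rho>)"
  shows "den (less_tm s t) C \<rho> = Num (of_bool (to_int (den s C \<rho>) < to_int (den t C \<rho>)))"
    "den (add_tm s t) C \<rho> = Num (to_int (den s C \<rho>) + to_int (den t C \<rho>))"
    "den (sub_tm s t) C \<rho> = Num (to_int (den s C \<rho>) - to_int (den t C \<rho>))"
    "den (mul_tm s t) C \<rho> = Num (to_int (den s C \<rho>) * to_int (den t C \<rho>))"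
    "den (BinT Div s t) C \<rho> = Num (to_int (den s C \<rho>) div to_int (den t C \<rho>))"
    "den (BinT Equal s t) C \<rho> = Num (of_bool (to_int (den s C \<rho>) = to_int (den t C \<rho>)))"
  using is_num_eq[OF assms(1)] is_num_eq[OF assms(2)]
  by (cases "den s C \<rho>"; cases "den t C \<rho>";
      simp add: less_tm_def add_tm_def sub_tm_def mul_tm_def)+

lemma den_ite:
  assumes "is_num (den b C \<rho>)" "is_num (den s C \<rho>)" "is_num (den t C \<rho>)"
  shows "den (ite_tm b s t) C \<rho> =
    Num (if to_int (den b C \<rho>) \<noteq> 0 then to_int (den s C \<rho>) else to_int (den t C \<rho>))"
  using assms by (cases "den b C \<rho>"; cases "den s C \<rho>"; cases "den t C \<rho>") (simp_all add: ite_tm_def)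

lemma den_min:
  assumes "is_num (den s C \<rho>)" "is_num (den t C \<rho>)"
  shows "den (min_tm s t) C \<rho> = Num (min (to_int (den s C \<rho>)) (to_int (den t C \<rho>)))"
  using assms by (simp add: min_tm_def den_ite den_arith)

lemma den_max0:
  assumes "is_num (den t C \<rho>)"
  shows "den (max0_tm t) C \<rho> = Num (max 0 (to_int (den t C \<rho>)))"
  using assms by (simp add: max0_tm_def den_ite den_arith)

lemma den_sum:
  assumes "\<And>j. j < length (index_list C k) \<Longrightarrow> is_num (den t C (Num (int j) # \<rho>))"
  shows "den (sum_tm k t) C \<rho> = Num (\<Sum>j<length (index_list C k). to_int (den t C (Num (int j) # \<rho>)))"
proof -
  have "foldl (\<lambda>acc j. fold_step (Arith Add) acc (den t C (Num (int j) # \<rho>))) (Num 0) [0..<m] =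
      Num (\<Sum>j<m. to_int (den t C (Num (int j) # \<rho>)))" if "m \<le> length (index_list C k)" for m
    using that
  proof (induction m)
    case (Suc m)
    then show ?case using is_num_eq[OF assms[of m]] by (cases "den t C (Num (int m) # \<rho>)") auto
  qed simp
  then show ?thesis by (simp add: sum_tm_def)
qed

lemma den_prod:
  assumes "\<And>j. j < length (index_list C k) \<Longrightarrow> is_num (den t C (Num (int j) # \<rho>))"
  shows "den (prod_tm k t) C \<rho> = Num (\<Prod>j<length (index_list C k). to_int (den t C (Num (int j) # \<rho>)))"
proof -
  have "foldl (\<lambda>acc j. fold_step (Arith Mul) acc (den t C (Num (int j) # \<rho>))) (Num 1) [0..<m] =
      Num (\<Prod>j<m. to_int (den t C (Num (int j) # \<rho>)))" if "m \<le> length (index_list C k)" for m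
    using that
  proof (induction m)
    case (Suc m)
    then show ?case using is_num_eq[OF assms[of m]] by (cases "den t C (Num (int m) # \<rho>)") auto
  qed simp
  then show ?thesis by (simp add: prod_tm_def)
qed

lemma den_nth:
  assumes xs: "den t C \<rho> = list_val (map rat_val qs)" "length qs = length (index_list C k)"
    and a: "is_index (length qs) (\<rho> ! a)"
  shows "den (nth_tm k t a) C \<rho> = rat_val (qs ! index_of (\<rho> ! a))"
proof -
  define i where "i = index_of (\<rho> ! a)"
  have i: "\<rho> ! a = Num (int i)" "i < length qs" using is_indexD[OF a] by (simp_all add: i_def)
  \<comment> \<open>Only the indices below \<open>i\<close> drop an element, so running on to the
    end of the list leaves exactly \<open>i\<close> elements dropped.\<close>
  have "foldl (\<lambda>acc j. fold_step Tail acc (den (less_tm (Loc 0) (Loc (Suc a))) C (Num (int j) # \<rho>)))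
      (list_val (map rat_val qs)) [0..<m] = list_val (map rat_val (drop (min m i) qs))" for m
  proof (induction m)
    case (Suc m)
    show ?case
    proof (cases "m < i")
      case True
      have "drop m qs = qs ! m # drop (Suc m) qs" using True i(2) by (simp add: Cons_nth_drop_Suc)
      then show ?thesis using Suc True by (simp add: less_tm_def i(1) min_def)
    next
      case False
      then show ?thesis using Suc by (simp add: less_tm_def i(1) min_def)
    qed
  qed simp
  then have "den (nth_tm k t a) C \<rho> = apply_un Fst (list_val (map rat_val (drop i qs)))"
    using i(2) xs by (simp add: nth_tm_def min_absorb2)
  also have "drop i qs = qs ! i # drop (Suc i) qs" using i(2) by (simp add: Cons_nth_drop_Suc)
  finally show ?thesis by (simp add: i_def)
qed

lemma den_field:
  assumes "n < 10"
  shows "den (field_tm n) C \<rho> = [hard_code C, cost_code C, label_code C, nc (min_len C),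
     nc (max_len C), rat_val (cost_bound C), rat_val (label_lo C), rat_val (label_hi C),
     list_val (map rat_val (word_lo C)), list_val (map rat_val (word_hi C))] ! n"
proof -
  have "den ((UnT Snd ^^ n) t) C \<rho> = list_val (drop n vs)"
    if "den t C \<rho> = list_val vs" "n \<le> length vs" for n t vs
    using that(2)
  proof (induction n)
    case 0
    then show ?case using that(1) by simp
  next
    case (Suc n)
    then have "drop n vs = vs ! n # drop (Suc n) vs" by (simp add: Cons_nth_drop_Suc)
    then show ?case using Suc by simp
  qed
  moreover have "apply_un Fst (list_val (drop n vs)) = vs ! n" if "n < length vs" for n vs
    using that by (simp add: Cons_nth_drop_Suc[symmetric])
  ultimately have "den (field_tm n) C \<rho> = vs ! n" if "inst_val nc C = list_val vs" "n < length vs" for vs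
    using that by (simp add: field_tm_def data_def)
  from this[OF inst_val_def] assms show ?thesis by simp
qed

lemmas den_sums = den_sum[of Label_Index, simplified] den_sum[of Cost_Index, simplified]
lemmas den_prods = den_prod[of Label_Index, simplified] den_prod[of Cost_Index, simplified]

lemma den_rat:
  "is_index K (\<rho> ! a) \<Longrightarrow> den (theta_tm a) C \<rho> = rat_val (\<theta> C ! index_of (\<rho> ! a))"
  "is_index L (\<rho> ! a) \<Longrightarrow> den (word_lo_tm a) C \<rho> = rat_val (word_lo C ! index_of (\<rho> ! a))"
  "is_index L (\<rho> ! a) \<Longrightarrow> den (word_hi_tm a) C \<rho> = rat_val (word_hi C ! index_of (\<rho> ! a))"
proof -
  have "length (word_hi C) = L" using inst by (simp add: lqci_instance_def)
  then show "is_index K (\<rho> ! a) \<Longrightarrow> den (theta_tm a) C \<rho> = rat_val (\<theta> C ! index_of (\<rho> ! a))"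
    "is_index L (\<rho> ! a) \<Longrightarrow> den (word_lo_tm a) C \<rho> = rat_val (word_lo C ! index_of (\<rho> ! a))"
    "is_index L (\<rho> ! a) \<Longrightarrow> den (word_hi_tm a) C \<rho> = rat_val (word_hi C ! index_of (\<rho> ! a))"
    unfolding theta_tm_def word_lo_tm_def word_hi_tm_def
    by (auto intro!: den_nth simp: data_def den_field)
qed

lemma den_numer_denom:
  assumes "den q C \<rho> = rat_val r"
  shows "den (numer_tm q) C \<rho> = Num (fst (quotient_of r))" "den (denom_tm q) C \<rho> = Num (snd (quotient_of r))"
  using assms by (simp_all add: numer_tm_def denom_tm_def rat_val_fst_snd)

lemma den_denominator: "den denominator_tm C \<rho> = Num D"
  by (simp add: denominator_tm_def den_arith den_prods den_rat den_field denominator_def denom_tm_def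
      rat_val_fst_snd)

lemma den_scale:
  assumes "den q C \<rho> = rat_val r"
  shows "den (scale_tm q) C \<rho> = Num (scale_rat D r)"
  using den_numer_denom[OF assms] by (simp add: scale_tm_def den_arith den_denominator scale_rat_def)

abbreviation "lo \<equiv> \<lambda>i k. scale_rat D (word_lo C ! i) * class_count C (\<theta> C) i k"
abbreviation "hi \<equiv> \<lambda>i k. scale_rat D (word_hi C ! i) * class_count C (\<theta> C) i k"

lemma den_lo_hi:
  "is_index L (\<rho> ! i) \<Longrightarrow> den (lo_tm i k) C \<rho> = Num (lo (index_of (\<rho> ! i)) (index_of (\<rho> ! k)))"
  "is_index L (\<rho> ! i) \<Longrightarrow> den (hi_tm i k) C \<rho> = Num (hi (index_of (\<rho> ! i)) (index_of (\<rho> ! k)))"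
  "is_index K (\<rho> ! k) \<Longrightarrow> den (cost_tm k) C \<rho> = Num (scale_rat D (\<theta> C ! index_of (\<rho> ! k)))"
  by (simp_all add: lo_tm_def hi_tm_def cost_tm_def den_arith den_scale[OF den_rat(1)]
      den_scale[OF den_rat(2)] den_scale[OF den_rat(3)])

lemma den_N: "den (N_tm i) C \<rho> = Num (N (index_of (\<rho> ! i)))"
  by (simp add: N_tm_def den_sums N_def)

lemma den_class_mass:
  assumes "is_index L (\<rho> ! i)" "is_index K (\<rho> ! k)"
  shows "den (class_mass_tm i k) C \<rho> = Num (class_mass (index_of (\<rho> ! i)) (index_of (\<rho> ! k)))"
proof -
  let ?i = "index_of (\<rho> ! i)" and ?k = "index_of (\<rho> ! k)"
  have 1: "den (sum_tm Cost_Index (lo_tm (Suc i) 0)) C \<rho> = Num (\<Sum>k<K. lo ?i k)"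
    using assms by (simp add: den_sums den_lo_hi cong: sum.cong_simp)
  have 2: "den (ite_tm (less_tm (cost_tm 0) (cost_tm (Suc k))) (sub_tm (hi_tm (Suc i) 0) (lo_tm (Suc i) 0))
      (Lit (Num 0))) C (Num (int j) # \<rho>) =
    Num (if scale_rat D (\<theta> C ! j) < scale_rat D (\<theta> C ! ?k) then hi ?i j - lo ?i j else 0)" if "j < K" for j
    using assms that by (simp add: den_ite den_arith den_lo_hi)
  have 3: "den (sum_tm Cost_Index (ite_tm (less_tm (cost_tm 0) (cost_tm (Suc k)))
      (sub_tm (hi_tm (Suc i) 0) (lo_tm (Suc i) 0)) (Lit (Num 0)))) C \<rho> =
    Num (\<Sum>j<K. if scale_rat D (\<theta> C ! j) < scale_rat D (\<theta> C ! ?k) then hi ?i j - lo ?i j else 0)"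
    by (simp add: den_sums 2 cong: sum.cong_simp)
  show ?thesis
    using assms unfolding class_mass_tm_def class_mass_def fill_def
    by (simp add: den_arith den_min den_max0 den_lo_hi den_denominator 1 3)
qed

lemma den_valid:
  assumes "is_index L (\<rho> ! i)"
  shows "den (valid_tm i) C \<rho> = Num (of_bool (valid (index_of (\<rho> ! i))))"
  using assms
  by (simp add: valid_tm_def den_arith den_ite den_N den_denominator den_scale[OF den_rat(2)]
      den_scale[OF den_rat(3)] valid_def not_less of_bool_def)

lemma den_label_cost:
  assumes "is_index L (\<rho> ! i)"
  shows "den (label_cost_tm i) C \<rho> = Num (label_cost (index_of (\<rho> ! i)))"
  using assms
  by (simp add: label_cost_tm_def den_arith den_sums den_lo_hi den_class_mass label_cost_def
      cong: sum.cong_simp if_cong)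

lemma den_label_key:
  assumes "is_index L (\<rho> ! i)"
  shows "den (label_key_tm i) C \<rho> = Num (label_key (index_of (\<rho> ! i)))"
proof -
  have "den (Loc i) C \<rho> = Num (int (index_of (\<rho> ! i)))"
    using is_indexD(2)[OF assms] by simp
  then show ?thesis
    using assms by (simp add: label_key_tm_def den_arith den_sums den_label_cost label_key_def del: den.simps(1))
qed

lemma den_lam_rho: "den lam_tm C \<rho> = Num (scale_rat D (label_lo C))" "den rho_tm C \<rho> = Num (scale_rat D (label_hi C))"
  "den (scale_tm (field_tm 5)) C \<rho> = Num (scale_rat D (cost_bound C))"
  unfolding lam_tm_def rho_tm_def by (rule den_scale, simp add: den_field)+

lemma sum_over_valids: "(\<Sum>i\<in>valids. f i) = (\<Sum>i<L. if valid i then f i else 0)"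
  by (simp add: sum_valids)

lemma den_label_mass:
  assumes "is_index L (\<rho> ! i)"
  shows "den (label_mass_tm i) C \<rho> = Num (label_mass (index_of (\<rho> ! i)))"
proof -
  let ?i = "index_of (\<rho> ! i)"
  let ?lam = "scale_rat D (label_lo C)" and ?rho = "scale_rat D (label_hi C)"
  have 1: "den (sum_tm Label_Index (ite_tm (valid_tm 0) lam_tm (Lit (Num 0)))) C \<rho> = Num (\<Sum>i\<in>valids. ?lam)"
    unfolding sum_over_valids
    by (simp add: den_sums den_ite den_valid den_lam_rho cong: sum.cong_simp if_cong)
  have 2: "den (ite_tm (valid_tm 0) (ite_tm (less_tm (label_key_tm 0) (label_key_tm (Suc i)))
      (sub_tm rho_tm lam_tm) (Lit (Num 0))) (Lit (Num 0))) C (Num (int j) # \<rho>) =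
    Num (if valid j then if label_key j < label_key ?i then ?rho - ?lam else 0 else 0)" if "j < L" for j
    using assms that by (simp add: den_ite den_arith den_valid den_label_key den_lam_rho)
  have 3: "den (sum_tm Label_Index (ite_tm (valid_tm 0) (ite_tm (less_tm (label_key_tm 0) (label_key_tm (Suc i)))
      (sub_tm rho_tm lam_tm) (Lit (Num 0))) (Lit (Num 0)))) C \<rho> =
    Num (\<Sum>j\<in>valids. if label_key j < label_key ?i then ?rho - ?lam else 0)"
    unfolding sum_over_valids by (simp add: den_sums 2 cong: sum.cong_simp)
  show ?thesis
    using assms unfolding label_mass_tm_def label_mass_def fill_def
    by (simp add: den_arith den_min den_max0 den_ite den_valid den_lam_rho den_denominator 1 3)
qed

lemma den_valids: "den valids_tm C \<rho> = Num (int (card valids))"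
proof -
  have "int (card valids) = (\<Sum>i<L. if valid i then 1 else 0)"
    using sum_over_valids[of "\<lambda>_. 1 :: int"] by simp
  then show ?thesis
    by (simp add: valids_tm_def den_sums den_valid of_bool_def cong: sum.cong_simp if_cong)
qed

lemma den_admissible: "den admissible_tm C \<rho> = Num (of_bool admissible)"
  by (simp add: admissible_tm_def den_arith den_ite den_sums den_valids den_lam_rho den_denominator
      den_label_mass den_label_cost admissible_def of_bool_def not_less cong: sum.cong_simp if_cong)

lemma den_select:
  assumes k: "k \<noteq> Bounded" and r: "is_num (\<rho> ! r)"
    and w: "\<And>i j. i < length (index_list C k) \<Longrightarrow> j < length (index_list C k) \<Longrightarrow>
      den w C (Num (int j) # Num (int i) # \<rho>) = Num (f j)"
  shows "den (select_tm k w r) C \<rho> = Num (int (select (length (index_list C k)) f (to_int (\<rho> ! r))))"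
proof -
  let ?m = "length (index_list C k)"
  have inner: "(\<Sum>j<?m. if i < j then 0 else f j) = (\<Sum>j<Suc i. f j)" if "i < ?m" for i
  proof -
    have "(\<Sum>j<?m. if i < j then 0 else f j) = (\<Sum>j\<in>{j \<in> {..<?m}. \<not> i < j}. f j)"
      by (subst sum.inter_filter) (auto intro!: sum.cong)
    also have "{j \<in> {..<?m}. \<not> i < j} = {..<Suc i}" using that by auto
    finally show ?thesis .
  qed
  have "den (select_tm k w r) C \<rho> =
      Num (\<Sum>i<?m. if to_int (\<rho> ! r) < (\<Sum>j<?m. if i < j then 0 else f j) then 0 else 1)"
    using r by (simp add: select_tm_def den_arith den_ite den_sum w cong: sum.cong_simp if_cong)
  also have "(\<Sum>i<?m. if to_int (\<rho> ! r) < (\<Sum>j<?m. if i < j then 0 else f j) then 0 else 1 :: int) =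
      (\<Sum>i<?m. if (\<Sum>j<Suc i. f j) \<le> to_int (\<rho> ! r) then 1 else 0)"
    by (intro sum.cong refl) (use inner in auto)
  also have "\<dots> = int (select ?m f (to_int (\<rho> ! r)))"
    unfolding select_def by (subst sum.inter_filter[symmetric]) simp_all
  finally show ?thesis .
qed

lemma den_query:
  assumes "is_index L (\<rho> ! i)" "is_index K (\<rho> ! k)"
  shows "den (query_tm i k) C \<rho> = query_val nc C (index_of (\<rho> ! i)) (\<theta> C ! index_of (\<rho> ! k))"
proof -
  have "den (Loc i) C \<rho> = nat_val (index_of (\<rho> ! i))"
    using is_indexD(2)[OF assms(1)] by (simp add: nat_val_def)
  then show ?thesis
    using den_rat(1)[OF assms(2)] by (simp add: query_tm_def query_val_def data_def)
qed

end

section \<open>The improvisation scheme\<close>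

definition queries :: "('a, 'l) lqci set \<Rightarrow> (('a, 'l) lqci \<Rightarrow> rat list) \<Rightarrow> (('a, 'l) lqci \<times> nat \<times> nat) set" where
  "queries S \<theta> = {(C, i, k). C \<in> S \<and> i < length (word_lo C) \<and> k < length (\<theta> C)}"

text \<open>The environments are \<open>[u]\<close> for the label and \<open>[label, u']\<close> for
  the cost, with random numbers \<open>u\<close> and \<open>u'\<close>. Below the two loop indices
  of \<open>select_tm\<close> the label has position 2, and position 0 is the index whose weight is
  summed.\<close>

abbreviation "select_label_tm \<equiv> select_tm Label_Index (label_mass_tm 0) 0"
abbreviation "select_class_tm \<equiv> select_tm Cost_Index (class_mass_tm 2 0) 1"

context costed_class
begin

text \<open>Read off from the term, so that it is defined for every instance and every value; on
  feasible instances it agrees with \<open>select\<close>.\<close>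

definition label_of :: "('a, 'l) lqci \<Rightarrow> val \<Rightarrow> nat" where
  "label_of C u = index_of (den select_label_tm C [u])"

definition cost_of :: "('a, 'l) lqci \<Rightarrow> val \<Rightarrow> val \<Rightarrow> nat" where
  "cost_of C u u' = index_of (den select_class_tm C [Num (int (label_of C u)), u'])"

end

context class_member
begin

lemma den_label_select:
  assumes admissible "r \<in> {0..<D}"
  shows "den select_label_tm C [Num r] = Num (int (label_of C (Num r)))"
    "label_of C (Num r) = select L label_mass r"
proof -
  have "den select_label_tm C [Num r] = Num (int (select L label_mass r))"
    using den_select[of Label_Index "[Num r]" 0 "label_mass_tm 0" label_mass] by (simp add: den_label_mass)
  then show "den select_label_tm C [Num r] = Num (int (label_of C (Num r)))"
    "label_of C (Num r) = select L label_mass r"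
    by (simp_all add: label_of_def)
qed

lemma den_cost_select:
  assumes adm: admissible and r: "r \<in> {0..<D}" "r' \<in> {0..<D}"
  shows "den select_class_tm C [Num (int (label_of C (Num r))), Num r'] =
      Num (int (cost_of C (Num r) (Num r')))"
    "cost_of C (Num r) (Num r') = select K (class_mass (select L label_mass r)) r'"
proof -
  have "label_of C (Num r) < L"
    using select_label(1)[OF adm r(1)] den_label_select(2)[OF adm r(1)] by simp
  then have "den select_class_tm C [Num (int (label_of C (Num r))), Num r'] =
      Num (int (select K (class_mass (label_of C (Num r))) r'))"
    using den_select[of Cost_Index "[Num (int (label_of C (Num r))), Num r']" 1 "class_mass_tm 2 0"
        "class_mass (label_of C (Num r))"]
    by (simp add: den_class_mass)
  then show "den select_class_tm C [Num (int (label_of C (Num r))), Num r'] =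
      Num (int (cost_of C (Num r) (Num r')))"
    "cost_of C (Num r) (Num r') = select K (class_mass (select L label_mass r)) r'"
    using den_label_select(2)[OF adm r(1)] by (simp_all add: cost_of_def)
qed

end

locale counted_class = costed_class nc S \<theta> bnd
  for nc and S :: "('a::finite, 'l) lqci set" and \<theta> bnd +
  assumes counting: "poly_computed (queries S \<theta>) (\<lambda>(C, i, k). inst_size nc C)
    (\<lambda>(C, i, k). query_val nc C i (\<theta> C ! k)) (\<lambda>(C, i, k). nat_val (card (class_words C i (\<theta> C ! k))))"
begin

lemma member: "C \<in> S \<Longrightarrow> class_member nc S \<theta> bnd C"
  by unfold_locales

lemma env_index:
  assumes "x \<in> envs \<Gamma>" "a < length \<Gamma>"
  shows "\<Gamma> ! a = Label_Index \<Longrightarrow> is_index (length (word_lo (fst x))) (snd x ! a)"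
    "\<Gamma> ! a = Cost_Index \<Longrightarrow> is_index (length (\<theta> (fst x))) (snd x ! a)"
  using assms by (auto simp: envs_def list_all2_conv_all_nth is_index_def)

lemma computable_query:
  assumes "a < length \<Gamma>" "b < length \<Gamma>" "\<Gamma> ! a = Label_Index" "\<Gamma> ! b = Cost_Index"
  shows "computable \<Gamma> (\<lambda>x. query_val nc (fst x) (index_of (snd x ! a)) (\<theta> (fst x) ! index_of (snd x ! b)))"
proof -
  have "computable \<Gamma> (\<lambda>x. den (query_tm a b) (fst x) (snd x))"
    by (rule computable_tm_aux[where c = False]) (use assms typed_query in auto)
  then show ?thesis
  proof (rule poly_sampled_cong)
    fix x assume x: "x \<in> envs \<Gamma>"
    then interpret class_member nc S \<theta> bnd "fst x" by (intro member) (auto simp: envs_def)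
    show "return_spmf (den (query_tm a b) (fst x) (snd x)) =
        return_spmf (query_val nc (fst x) (index_of (snd x ! a)) (\<theta> (fst x) ! index_of (snd x ! b)))"
      using env_index[OF x] assms by (simp add: den_query)
  qed simp
qed

lemma query_index:
  assumes "x \<in> envs \<Gamma>" "a < length \<Gamma>" "b < length \<Gamma>" "\<Gamma> ! a = Label_Index" "\<Gamma> ! b = Cost_Index"
  shows "(fst x, index_of (snd x ! a), index_of (snd x ! b)) \<in> queries S \<theta>"
  using env_index[OF assms(1)] assms by (auto simp: queries_def envs_def dest: is_indexD(1))

lemma computable_tm:
  assumes "typed True \<Gamma> t"
  shows "computable \<Gamma> (\<lambda>x. den t (fst x) (snd x))"
  using _ assms
proof (rule computable_tm_aux)
  fix \<Gamma> a b assume "typed True \<Gamma> (Count a b)"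
  then have ab: "a < length \<Gamma>" "b < length \<Gamma>" "\<Gamma> ! a = Label_Index" "\<Gamma> ! b = Cost_Index" by auto
  have "poly_computed (envs \<Gamma>) env_size
      (\<lambda>x. query_val nc (fst x) (index_of (snd x ! a)) (\<theta> (fst x) ! index_of (snd x ! b)))
      (\<lambda>x. nat_val (card (class_words (fst x) (index_of (snd x ! a)) (\<theta> (fst x) ! index_of (snd x ! b)))))"
    using poly_sampled_reindex[OF counting, of "envs \<Gamma>" "\<lambda>x. (fst x, index_of (snd x ! a), index_of (snd x ! b))" env_size]
      query_index[OF _ ab] by (simp add: env_size_def)
  from poly_sampled_comp[OF computable_query[OF ab] this]
  show "computable \<Gamma> (\<lambda>x. den (Count a b) (fst x) (snd x))"
    by (simp add: nat_val_def class_count_def)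
qed

end

locale improvisable_class = counted_class nc S \<theta> bnd
  for nc and S :: "('a::finite, 'l) lqci set" and \<theta> bnd +
  assumes sampling: "poly_sampled {(C, i, k) \<in> queries S \<theta>. class_words C i (\<theta> C ! k) \<noteq> {}}
    (\<lambda>(C, i, k). inst_size nc C) (\<lambda>(C, i, k). query_val nc C i (\<theta> C ! k))
    (\<lambda>(C, i, k). map_spmf word_val (spmf_of_set (class_words C i (\<theta> C ! k))))"
  and bnd_denominator: "\<And>C. C \<in> S \<Longrightarrow> val_size (Num (denominator C (\<theta> C))) \<le> bnd C"
begin

definition unif :: "('a, 'l) lqci \<Rightarrow> val spmf" where
  "unif C = map_spmf Num (spmf_of_set {0..<denominator C (\<theta> C)})"

definition greedy_spmf :: "('a, 'l) lqci \<Rightarrow> val spmf" where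
  "greedy_spmf C = bind_spmf (unif C) (\<lambda>u. bind_spmf (unif C) (\<lambda>u'.
    map_spmf word_val (spmf_of_set (class_words C (label_of C u) (\<theta> C ! cost_of C u u')))))"

definition feasibles :: "('a, 'l) lqci set" where
  "feasibles = {C \<in> S. feasible C}"

text \<open>Every pair of drawn numbers leads to legal indices and to a nonempty class, which is
  exactly where the sampler is specified. Feasibility is essential, as it makes the masses sum to
  \<open>D\<close>.\<close>

lemma select_terms:
  assumes C: "C \<in> feasibles" and r: "r \<in> {0..<denominator C (\<theta> C)}" "r' \<in> {0..<denominator C (\<theta> C)}"
  defines "i \<equiv> label_of C (Num r)" and "k \<equiv> cost_of C (Num r) (Num r')"
  shows "den select_label_tm C [Num r] = Num (int i)"
    "den select_class_tm C [Num (int i), Num r'] = Num (int k)"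
    "i < length (word_lo C)" "k < length (\<theta> C)" "class_words C i (\<theta> C ! k) \<noteq> {}"
proof -
  interpret class_member nc S \<theta> bnd C by (rule member) (use C in \<open>simp add: feasibles_def\<close>)
  have adm: admissible using C feasible_iff by (simp add: feasibles_def)
  show "den select_label_tm C [Num r] = Num (int i)"
    unfolding i_def by (rule den_label_select(1)[OF adm r(1)])
  show "den select_class_tm C [Num (int i), Num r'] = Num (int k)"
    unfolding i_def k_def by (rule den_cost_select(1)[OF adm r])
  show "i < L" "k < K" "cls i k \<noteq> {}"
    using select_label[OF adm r(1)] select_class[OF adm r(2)] unfolding i_def k_def
    by (auto simp: den_label_select(2)[OF adm r(1)] den_cost_select(2)[OF adm r])
qed

lemma greedy_spmf_improvising:
  assumes C: "C \<in> feasibles"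
  shows "\<exists>P. improvising C P \<and> greedy_spmf C = map_spmf word_val (spmf_of_pmf P)"
proof -
  interpret class_member nc S \<theta> bnd C by (rule member) (use C in \<open>simp add: feasibles_def\<close>)
  have adm: admissible using C feasible_iff by (simp add: feasibles_def)
  have D: "finite {0..<D}" "{0..<D} \<noteq> {}" using D_pos by auto
  have sel: "spmf_of_set (class_words C (label_of C (Num r)) (\<theta> C ! cost_of C (Num r) (Num r'))) =
      spmf_of_pmf (pmf_of_set (cls (select L label_mass r) (select K (class_mass (select L label_mass r)) r')))"
    if r: "r \<in> {0..<D}" "r' \<in> {0..<D}" for r r'
  proof -
    have "cls (select L label_mass r) (select K (class_mass (select L label_mass r)) r') \<noteq> {}"
      using select_class[OF adm r(2)] select_label[OF adm r(1)] by blast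
    then show ?thesis
      using finite_cls den_label_select(2)[OF adm r(1)] den_cost_select(2)[OF adm r]
      by simp
  qed
  have U: "spmf_of_set {0..<D} = spmf_of_pmf (pmf_of_set {0..<D})" using D by simp
  have "greedy_spmf C = bind_spmf (spmf_of_set {0..<D}) (\<lambda>r. bind_spmf (spmf_of_set {0..<D}) (\<lambda>r'.
      map_spmf word_val (spmf_of_set (class_words C (label_of C (Num r)) (\<theta> C ! cost_of C (Num r) (Num r'))))))"
    by (simp add: greedy_spmf_def unif_def bind_map_spmf o_def)
  also have "\<dots> = bind_spmf (spmf_of_set {0..<D}) (\<lambda>r. bind_spmf (spmf_of_set {0..<D}) (\<lambda>r'.
      map_spmf word_val (spmf_of_pmf
        (pmf_of_set (cls (select L label_mass r) (select K (class_mass (select L label_mass r)) r'))))))"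
    by (intro bind_spmf_cong refl) (simp only: sel set_spmf_of_set_finite D(1))
  also have "\<dots> = map_spmf word_val (spmf_of_pmf greedy_pmf)"
    unfolding U bind_spmf_of_pmf greedy_pmf_def Let_def
    by (simp add: spmf_of_pmf_bind map_bind_pmf map_spmf_of_pmf[symmetric] del: map_spmf_of_pmf)
  finally have "greedy_spmf C = map_spmf word_val (spmf_of_pmf greedy_pmf)" .
  then show ?thesis using improvising_greedy[OF adm] by blast
qed

lemma env_computed:
  assumes X: "\<And>x. x \<in> X \<Longrightarrow> (C x, \<rho> x) \<in> envs \<Gamma>"
    and sz: "\<And>x. x \<in> X \<Longrightarrow> sz x = inst_size nc (C x)"
    and env: "poly_computed X sz a (\<lambda>x. env_val (C x, \<rho> x))"
    and t: "typed True \<Gamma> t"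
  shows "poly_computed X sz a (\<lambda>x. den t (C x) (\<rho> x))"
proof -
  have "poly_computed X sz (\<lambda>x. env_val (C x, \<rho> x)) (\<lambda>x. den t (C x) (\<rho> x))"
    using poly_sampled_reindex[OF computable_tm[OF t], of X "\<lambda>x. (C x, \<rho> x)" sz] X sz
    by (simp add: env_size_def)
  with env show ?thesis by (rule poly_sampled_comp)
qed

lemma env_nil: "X \<subseteq> S \<Longrightarrow> poly_computed X (inst_size nc) data (\<lambda>C. env_val (C, []))"
  using poly_computed_eval[OF pb_reindex[OF data_bounded, of X "\<lambda>C. C" "inst_size nc"],
      of "Binary MkPr (Var 0) (Const (Num 0))"]
  by (auto simp: env_val_def)

lemma denominator_computed:
  "X \<subseteq> S \<Longrightarrow> poly_computed X (inst_size nc) data (\<lambda>C. Num (denominator C (\<theta> C)))"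
proof -
  assume X: "X \<subseteq> S"
  have "poly_computed X (inst_size nc) data (\<lambda>C. den denominator_tm C [])"
    by (rule env_computed[OF _ _ env_nil[OF X] typed_denominator, where \<Gamma> = "[]"])
      (use X in \<open>auto simp: envs_def\<close>)
  then show ?thesis
  proof (rule poly_sampled_cong)
    fix C assume "C \<in> X"
    then interpret class_member nc S \<theta> bnd C by (intro member) (use X in auto)
    show "return_spmf (den denominator_tm C []) = return_spmf (Num (denominator C (\<theta> C)))"
      by (simp add: den_denominator)
  qed simp
qed

lemma denominator_pos: "C \<in> S \<Longrightarrow> 0 < denominator C (\<theta> C)"
proof -
  assume "C \<in> S"
  then interpret class_member nc S \<theta> bnd C by (rule member)
  show ?thesis by (rule D_pos)
qed

lemma unif_sampled: "X \<subseteq> S \<Longrightarrow> poly_sampled X (inst_size nc) data unif"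
proof -
  assume X: "X \<subseteq> S"
  note D = denominator_computed[OF X]
  have "poly_sampled X (inst_size nc) (\<lambda>C. Num (denominator C (\<theta> C))) unif"
    unfolding unif_def by (rule poly_sampled_uniform[OF _ poly_computed_output[OF D]])
      (use X denominator_pos in auto)
  with D show ?thesis by (rule poly_sampled_comp)
qed

text \<open>The inputs grow from \<open>data\<close> by one random number at a time. Both numbers
  lie below the denominator, so they are legitimate \<open>Bounded\<close> variables for the terms
  that select label and cost.\<close>

lemma greedy_sampled: "poly_sampled feasibles (inst_size nc) data greedy_spmf"
  unfolding greedy_spmf_def
proof (rule poly_sampled_bind, rule unif_sampled, simp add: feasibles_def subset_eq, rule poly_sampled_bind)
  let ?Y = "{(C, u). C \<in> feasibles \<and> u \<in> set_spmf (unif C)}"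
  have small: "val_size u \<le> bnd C" if u: "u \<in> set_spmf (unif C)" and CS: "C \<in> S" for C u
  proof -
    obtain r where "u = Num r" "0 \<le> r" "r < denominator C (\<theta> C)" using u by (auto simp: unif_def)
    then show ?thesis
      using val_size_mono_abs[of r "denominator C (\<theta> C)"] bnd_denominator[OF CS] by auto
  qed
  have "poly_bounded ?Y (\<lambda>y. inst_size nc (fst y)) (\<lambda>y. bnd (fst y))"
    by (rule pb_reindex[OF bnd]) (auto simp: feasibles_def)
  then have "poly_bounded ?Y (\<lambda>y. inst_size nc (fst y)) (\<lambda>y. val_size (snd y))"
    by (rule pb_mono) (auto simp: feasibles_def small)
  then have data: "poly_bounded ?Y (\<lambda>y. inst_size nc (fst y)) (\<lambda>y. val_size (Pr (data (fst y)) (snd y)))"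
    by (intro pb_Pr pb_reindex[OF data_bounded]) (auto simp: feasibles_def)
  have "poly_computed ?Y (\<lambda>y. inst_size nc (fst y)) (\<lambda>y. Pr (data (fst y)) (snd y)) (\<lambda>y. data (fst y))"
    using poly_computed_eval[OF data, of "Unary Fst (Var 0)"] by simp
  moreover have "poly_sampled ?Y (\<lambda>y. inst_size nc (fst y)) (\<lambda>y. data (fst y)) (\<lambda>y. unif (fst y))"
    by (rule poly_sampled_reindex[OF unif_sampled[OF subset_refl]]) (auto simp: feasibles_def)
  ultimately show U: "poly_sampled ?Y (\<lambda>y. inst_size nc (fst y)) (\<lambda>y. Pr (data (fst y)) (snd y)) (\<lambda>y. unif (fst y))"
    by (rule poly_sampled_comp)
  let ?Z = "{(y, u'). y \<in> ?Y \<and> u' \<in> set_spmf (unif (fst y))}"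
  let ?sz = "\<lambda>z. inst_size nc (fst (fst z))" and ?in = "\<lambda>z. Pr (Pr (data (fst (fst z))) (snd (fst z))) (snd z)"
  let ?C = "\<lambda>z :: (('a, 'l) lqci \<times> val) \<times> val. fst (fst z)"
  let ?i = "\<lambda>z. label_of (fst (fst z)) (snd (fst z))" and ?k = "\<lambda>z. cost_of (fst (fst z)) (snd (fst z)) (snd z)"
  have "poly_bounded ?Z ?sz (\<lambda>z. bnd (fst (fst z)))"
    by (rule pb_reindex[OF bnd]) (auto simp: feasibles_def)
  then have "poly_bounded ?Z ?sz (\<lambda>z. val_size (snd z))"
    by (rule pb_mono) (auto simp: feasibles_def small)
  then have in_size: "poly_bounded ?Z ?sz (\<lambda>z. val_size (?in z))"
    by (intro pb_Pr[OF pb_reindex[OF data]]) auto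
  have S: "?C z \<in> S" if "z \<in> ?Z" for z using that by (auto simp: feasibles_def)
  have sel: "den select_label_tm (?C z) [snd (fst z)] = Num (int (?i z))"
    "den select_class_tm (?C z) [Num (int (?i z)), snd z] = Num (int (?k z))"
    "?i z < length (word_lo (?C z))" "?k z < length (\<theta> (?C z))"
    "class_words (?C z) (?i z) (\<theta> (?C z) ! ?k z) \<noteq> {}" if z_in: "z \<in> ?Z" for z
  proof -
    obtain C r r' where z: "z = ((C, Num r), Num r')" "C \<in> feasibles"
      "r \<in> {0..<denominator C (\<theta> C)}" "r' \<in> {0..<denominator C (\<theta> C)}"
      using z_in by (auto simp: unif_def)
    show "den select_label_tm (?C z) [snd (fst z)] = Num (int (?i z))"
      "den select_class_tm (?C z) [Num (int (?i z)), snd z] = Num (int (?k z))"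
      "?i z < length (word_lo (?C z))" "?k z < length (\<theta> (?C z))"
      "class_words (?C z) (?i z) (\<theta> (?C z) ! ?k z) \<noteq> {}"
      using select_terms[OF z(2-4)] by (simp_all add: z(1))
  qed
  note ev = poly_computed_eval[OF in_size]
  have d: "poly_computed ?Z ?sz ?in (\<lambda>z. data (?C z))"
    using ev[of "Unary Fst (Unary Fst (Var 0))"] by simp
  have u': "poly_computed ?Z ?sz ?in snd"
    using ev[of "Unary Snd (Var 0)"] by simp
  have nil: "poly_computed ?Z ?sz ?in (\<lambda>_. Num 0)"
    using ev[of "Const (Num 0)"] by simp
  have "poly_computed ?Z ?sz ?in (\<lambda>z. env_val (?C z, [snd (fst z)]))"
    using ev[of "Binary MkPr (Unary Fst (Unary Fst (Var 0))) (Binary MkPr (Unary Snd (Unary Fst (Var 0))) (Const (Num 0)))"]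
    by (simp add: env_val_def)
  then have "poly_computed ?Z ?sz ?in (\<lambda>z. den select_label_tm (?C z) [snd (fst z)])"
    by (rule env_computed[where \<Gamma> = "[Bounded]", rotated 2])
      (use S small in \<open>auto simp: envs_def intro!: typed_select typed_label_mass\<close>)
  then have i: "poly_computed ?Z ?sz ?in (\<lambda>z. Num (int (?i z)))"
    by (rule poly_sampled_cong) (simp_all only: sel)
  have "poly_computed ?Z ?sz ?in (\<lambda>z. env_val (?C z, [Num (int (?i z)), snd z]))"
    unfolding env_val_def fst_conv snd_conv list_val.simps by (intro poly_computed_Pr d i u' nil)
  then have "poly_computed ?Z ?sz ?in
      (\<lambda>z. den select_class_tm (?C z) [Num (int (?i z)), snd z])"
    by (rule env_computed[where \<Gamma> = "[Label_Index, Bounded]", rotated 2])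
      (use S small sel(3) in \<open>auto simp: envs_def numeral_2_eq_2 intro!: typed_select typed_class_mass\<close>)
  then have k: "poly_computed ?Z ?sz ?in (\<lambda>z. Num (int (?k z)))"
    by (rule poly_sampled_cong) (simp_all only: sel)
  have env: "poly_computed ?Z ?sz ?in (\<lambda>z. env_val (?C z, [Num (int (?i z)), Num (int (?k z))]))"
    unfolding env_val_def fst_conv snd_conv list_val.simps by (intro poly_computed_Pr d i k nil)
  have "poly_computed ?Z ?sz (\<lambda>z. env_val (?C z, [Num (int (?i z)), Num (int (?k z))]))
      (\<lambda>z. query_val nc (?C z) (?i z) (\<theta> (?C z) ! ?k z))"
    using poly_sampled_reindex[OF computable_query[of 0 "[Label_Index, Cost_Index]" 1],
        of ?Z "\<lambda>z. (?C z, [Num (int (?i z)), Num (int (?k z))])" ?sz] S sel(3,4)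
    by (auto simp: envs_def env_size_def)
  note query = poly_sampled_comp[OF env this]
  have "poly_sampled ?Z ?sz (\<lambda>z. query_val nc (?C z) (?i z) (\<theta> (?C z) ! ?k z))
      (\<lambda>z. map_spmf word_val (spmf_of_set (class_words (?C z) (?i z) (\<theta> (?C z) ! ?k z))))"
    using poly_sampled_reindex[OF sampling, of ?Z "\<lambda>z. (?C z, ?i z, ?k z)" ?sz] S sel(3,4,5)
    by (auto simp: queries_def)
  from poly_sampled_comp[OF query this]
  show "poly_sampled ?Z ?sz ?in
      (\<lambda>z. map_spmf word_val (spmf_of_set (class_words (?C z) (?i z) (\<theta> (?C z) ! ?k z))))" .
qed

lemma feasible_computed:
  "poly_computed S (inst_size nc) data (\<lambda>C. Num (of_bool (feasible C)))"
proof -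
  have "poly_computed S (inst_size nc) data (\<lambda>C. den admissible_tm C [])"
    by (rule env_computed[OF _ _ env_nil[OF subset_refl] typed_admissible, where \<Gamma> = "[]"])
      (auto simp: envs_def)
  then show ?thesis
  proof (rule poly_sampled_cong)
    fix C assume "C \<in> S"
    then interpret class_member nc S \<theta> bnd C by (rule member)
    show "return_spmf (den admissible_tm C []) = return_spmf (Num (of_bool (feasible C)))"
      by (simp add: den_admissible feasible_iff)
  qed simp
qed

end

text \<open>Turns a program with an input into one without: the input becomes a constant of the
  program text, whose size is paid for in every run.\<close>

lemma runs_Call_Const:
  assumes "runs c v M T"
  shows "runs (Call 0 c (Const v)) u M (1 + 2 * val_size v + 2 * T)"
proof -
  have run: "run (Call 0 c (Const v)) u = map_spmf (\<lambda>(w, t). (w, 1 + val_size v + t + val_size w)) (run c v)"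
    by (simp add: run_def spmf.map_comp o_def split_def)
  have "mean_time (run (Call 0 c (Const v)) u) \<le> of_nat ((1 + 2 * val_size v) + 2 * T)"
    unfolding run using assms
    by (intro mean_time_map_le) (auto simp: runs_iff dest!: run_size_bound)
  then show ?thesis
    using assms by (simp add: runs_iff run spmf.map_comp o_def split_def del: nn_integral_map_spmf)
qed

context improvisable_class
begin

lemma poly_time_scheme:
  assumes costs: "poly_computed S (inst_size nc) (inst_val nc) (\<lambda>C. list_val (map rat_val (\<theta> C)))"
  shows "\<exists>A. poly_time_improvisation_scheme nc S A"
proof -
  obtain Q q where Q: "\<And>C. C \<in> feasibles \<Longrightarrow> runs Q (data C) (greedy_spmf C) (poly q (inst_size nc C))"
    using poly_sampledE[OF greedy_sampled] by blast
  define P where "P C = Call 0 Q (Const (data C))" for C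
  define answer where "answer C = answer_val (if feasible C then Some (P C) else None)" for C
  have data: "poly_computed S (inst_size nc) (inst_val nc) data"
    using poly_sampled_keep[OF costs] by (simp add: data_def)
  have some: "poly_computed X (inst_size nc) data (\<lambda>C. answer_val (Some (P C)))" if "X \<subseteq> S" for X
    \<comment> \<open>The improvisers share the program \<open>Q\<close> and differ only in one
      constant. The expression spells out the code of \<open>Call 0 Q (Const v)\<close>, with tags 6
      and 1, and puts the input \<open>Var 0\<close> in the place of \<open>v\<close>.\<close>
    using poly_computed_eval[OF pb_reindex[OF data_bounded, of X "\<lambda>C. C" "inst_size nc"],
        of "Binary MkPr (Const (Num 1)) (Binary MkPr (Const (Num 6)) (Binary MkPr (Const (nat_val 0))
          (Binary MkPr (Const (com_val Q)) (Binary MkPr (Binary MkPr (Const (Num 1))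
            (Binary MkPr (Var 0) (Const (Num 0)))) (Const (Num 0))))))"] that
    by (auto simp: P_def)
  have none: "poly_computed X (inst_size nc) data (\<lambda>_. Num 0)" if "X \<subseteq> S" for X
    using poly_computed_const[OF pb_reindex[OF data_bounded, of X "\<lambda>C. C" "inst_size nc"]] that by auto
  have "poly_sampled S (inst_size nc) data (\<lambda>C. if Num (of_bool (feasible C)) \<noteq> Num 0
      then return_spmf (answer_val (Some (P C))) else return_spmf (Num 0))"
    by (intro poly_computed_if feasible_computed some none) auto
  then have "poly_computed S (inst_size nc) data answer"
    by (rule poly_sampled_cong) (auto simp: answer_def)
  from poly_sampledE[OF poly_sampled_comp[OF data this]] obtain A p
    where A: "\<And>C. C \<in> S \<Longrightarrow> runs A (inst_val nc C) (return_spmf (answer C)) (poly p (inst_size nc C))"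
    by metis
  have "poly_bounded S (inst_size nc) (\<lambda>C. 1 + 2 * val_size (data C) + 2 * poly q (inst_size nc C))"
    by (intro pb_intros data_bounded)
  then obtain q' where q': "\<And>C. C \<in> S \<Longrightarrow>
      1 + 2 * val_size (data C) + 2 * poly q (inst_size nc C) \<le> poly q' (inst_size nc C)"
    unfolding poly_bounded_def by blast
  have P: "runs (P C) (Num 0) (greedy_spmf C) (poly q' (inst_size nc C))" if "C \<in> S" "feasible C" for C
    unfolding P_def using runs_Call_Const[OF Q, of C "Num 0"] q'[OF that(1)] that
    by (auto simp: feasibles_def intro: runs_cong)
  have improviser: "improviser C (P C)" if "C \<in> S" "feasible C" for C
  proof -
    have "expected_time (P C) (Num 0) < \<infinity>" "output_dist (P C) (Num 0) = greedy_spmf C"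
      using P[OF that] by (auto simp: runs_def intro: le_less_trans[OF _ of_nat_less_top])
    moreover have "C \<in> feasibles" using that by (simp add: feasibles_def)
    from greedy_spmf_improvising[OF this] obtain M
      where "improvising C M" "greedy_spmf C = map_spmf word_val (spmf_of_pmf M)"
      by blast
    ultimately show ?thesis by (auto simp: improviser_def)
  qed
  have out: "output_dist A (inst_val nc C) = return_spmf (answer C)"
    "expected_time A (inst_val nc C) \<le> of_nat (poly p (inst_size nc C))" if "C \<in> S" for C
    using A[OF that] by (auto simp: runs_def)
  have "poly_time_improvisation_scheme nc S A"
    unfolding poly_time_improvisation_scheme_def improvisation_scheme_def
  proof (intro conjI ballI)
    fix C assume C: "C \<in> S"
    show "expected_time A (inst_val nc C) < \<infinity>"
      using out(2)[OF C] by (auto intro: le_less_trans[OF _ of_nat_less_top])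
    fix r assume "r \<in> set_spmf (output_dist A (inst_val nc C))"
    then have "r = answer C" by (simp add: out(1)[OF C])
    then show "correct_answer C r"
      using improviser[OF C] by (auto simp: correct_answer_def answer_def)
  next
    show "\<exists>p :: nat poly. \<forall>C\<in>S. expected_time A (inst_val nc C) \<le> of_nat (poly p (inst_size nc C))"
      using out(2) by blast
  next
    show "\<exists>q :: nat poly. \<forall>C\<in>S. \<forall>P. answer_val (Some P) \<in> set_spmf (output_dist A (inst_val nc C)) \<longrightarrow>
        expected_time P (Num 0) \<le> of_nat (poly q (inst_size nc C))"
    proof (intro exI[of _ q'] ballI allI impI)
      fix C P' assume C: "C \<in> S" and "answer_val (Some P') \<in> set_spmf (output_dist A (inst_val nc C))"
      then have "answer_val (Some P') = answer C" by (simp add: out(1)[OF C])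
      then have "feasible C" "P' = P C" by (auto simp: answer_def split: if_splits)
      then show "expected_time P' (Num 0) \<le> of_nat (poly q' (inst_size nc C))"
        using P[OF C] by (simp add: runs_def)
    qed
  qed
  then show ?thesis by blast
qed

end

section \<open>From the three operations to the scheme\<close>

theorem theorem2:
  fixes nc :: "nat \<Rightarrow> val"
    and S :: "('a::finite, 'l) lqci set"
  assumes "\<And>C. C \<in> S \<Longrightarrow> lqci_instance C"
    and "poly_time_costs nc S"
    and "poly_time_counting nc S"
    and "poly_time_sampling nc S"
  shows "\<exists>A. poly_time_improvisation_scheme nc S A"
proof -
  obtain A p where A: "\<forall>C\<in>S. expected_time A (inst_val nc C) \<le> of_nat (poly p (inst_size nc C)) \<and>
    (\<exists>\<theta>s. distinct \<theta>s \<and> set \<theta>s = costs C \<and>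
      output_dist A (inst_val nc C) = return_spmf (list_val (map rat_val \<theta>s)))"
    using assms(2) unfolding poly_time_costs_def by blast
  \<comment> \<open>The order of the costs is the one in which the given program lists them; all
    indices \<open>k\<close> refer to this list.\<close>
  then obtain \<theta> where \<theta>: "\<And>C. C \<in> S \<Longrightarrow> distinct (\<theta> C) \<and> set (\<theta> C) = costs C"
    and \<theta>_out: "\<And>C. C \<in> S \<Longrightarrow> output_dist A (inst_val nc C) = return_spmf (list_val (map rat_val (\<theta> C)))"
    by metis
  have costs: "poly_computed S (inst_size nc) (inst_val nc) (\<lambda>C. list_val (map rat_val (\<theta> C)))"
  proof (rule poly_sampledI)
    show "poly_bounded S (inst_size nc) (\<lambda>C. val_size (inst_val nc C))"
      using pb_size[of S "inst_size nc"] unfolding inst_size_def .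
    show "poly_bounded S (inst_size nc) (\<lambda>C. poly p (inst_size nc C))"
      by (rule pb_poly)
    show "runs A (inst_val nc C) (return_spmf (list_val (map rat_val (\<theta> C)))) (poly p (inst_size nc C))"
      if "C \<in> S" for C
      using A \<theta>_out that by (simp add: runs_def)
  qed
  \<comment> \<open>The size bound for random numbers is that of the denominator, which is bounded
    by computing it. Its term is closed and free of \<open>Count\<close>, so it can be evaluated
    here, with bound 0 and before counting is available.\<close>
  interpret base: costed_class nc S \<theta> "\<lambda>_. 0"
    by unfold_locales (use assms(1) \<theta> poly_computed_output[OF costs] pb_const in auto)
  define bnd where "bnd C = val_size (Num (denominator C (\<theta> C)))" for C
  have "poly_computed S (inst_size nc) base.data (\<lambda>C. base.env_val (C, []))"
    using poly_computed_eval[OF base.data_bounded, of "Binary MkPr (Var 0) (Const (Num 0))"]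
    by (simp add: base.env_val_def)
  moreover have "poly_computed S (inst_size nc) (\<lambda>C. base.env_val (C, [])) (\<lambda>C. base.den denominator_tm C [])"
    using poly_sampled_reindex[OF base.computable_tm_aux[where c = False and t = denominator_tm and \<Gamma> = "[]"], of S "\<lambda>C. (C, [])" "inst_size nc"]
    by (auto simp: typed_denominator base.envs_def base.env_size_def)
  ultimately have "poly_computed S (inst_size nc) base.data (\<lambda>C. base.den denominator_tm C [])"
    by (rule poly_sampled_comp)
  from poly_computed_output[OF this] have bnd: "poly_bounded S (inst_size nc) bnd"
  proof (rule pb_mono)
    fix C assume "C \<in> S"
    then interpret class_member nc S \<theta> "\<lambda>_. 0" C by unfold_locales
    show "bnd C \<le> val_size (base.den denominator_tm C [])"
      by (simp add: bnd_def den_denominator del: val_size.simps)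
  qed
  interpret costed_class nc S \<theta> bnd
    by unfold_locales (use assms(1) \<theta> poly_computed_output[OF costs] bnd in auto)
  have labels: "length (labels C) = length (word_lo C)" if "C \<in> S" for C
    using assms(1)[OF that] by (simp add: lqci_instance_def)
  \<comment> \<open>The time of the given programs is measured in the instance, but their inputs are
    queries, whose sizes must be bounded as well.\<close>
  have query_size: "poly_bounded (queries S \<theta>) (\<lambda>(C, i, k). inst_size nc C)
      (\<lambda>x. val_size (case x of (C, i, k) \<Rightarrow> query_val nc C i (\<theta> C ! k)))"
  proof -
    let ?sz = "\<lambda>(C, i, k). inst_size nc C"
    have inst: "poly_bounded (queries S \<theta>) ?sz (\<lambda>x. val_size (inst_val nc (fst x)))"
      using pb_reindex[OF pb_size[of S "inst_size nc"], of "queries S \<theta>" fst ?sz]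
      by (auto simp: queries_def inst_size_def)
    have "poly_bounded (queries S \<theta>) ?sz (\<lambda>x. length (index_list (fst x) Label_Index) + 2)"
      by (intro pb_intros pb_reindex[OF length_bounded]) (auto simp: queries_def)
    then have idx: "poly_bounded (queries S \<theta>) ?sz (\<lambda>x. val_size (nat_val (fst (snd x))))"
    proof (rule pb_mono)
      fix x assume "x \<in> queries S \<theta>"
      then have "fst (snd x) < length (word_lo (fst x))" by (auto simp: queries_def)
      then show "val_size (nat_val (fst (snd x))) \<le> length (index_list (fst x) Label_Index) + 2"
        using val_size_nat_le[of "fst (snd x)"] by (simp add: nat_val_def del: val_size.simps)
    qed
    have "poly_bounded (queries S \<theta>) ?sz (\<lambda>x. val_size (list_val (map rat_val (\<theta> (fst x)))))"
      by (rule pb_reindex[OF \<theta>_size]) (auto simp: queries_def)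
    then have rat: "poly_bounded (queries S \<theta>) ?sz (\<lambda>x. val_size (rat_val (\<theta> (fst x) ! snd (snd x))))"
      by (rule pb_mono) (auto simp: queries_def intro!: val_size_list_elem)
    show ?thesis
      unfolding query_val_def list_val.simps split_def
      by (intro pb_Pr pb_const inst[unfolded split_def] idx[unfolded split_def] rat[unfolded split_def])
  qed
  obtain B r where B: "\<forall>C\<in>S. \<forall>i<length (labels C). \<forall>\<theta>\<in>costs C.
      expected_time B (query_val nc C i \<theta>) \<le> of_nat (poly r (inst_size nc C)) \<and>
      output_dist B (query_val nc C i \<theta>) = return_spmf (nat_val (card (class_words C i \<theta>)))"
    using assms(3) unfolding poly_time_counting_def by blast
  obtain G s where G: "\<forall>C\<in>S. \<forall>i<length (labels C). \<forall>\<theta>\<in>costs C. class_words C i \<theta> \<noteq> {} \<longrightarrow>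
      expected_time G (query_val nc C i \<theta>) \<le> of_nat (poly s (inst_size nc C)) \<and>
      output_dist G (query_val nc C i \<theta>) = map_spmf word_val (spmf_of_set (class_words C i \<theta>))"
    using assms(4) unfolding poly_time_sampling_def by blast
  have elem: "\<theta> C ! k \<in> costs C" if "C \<in> S" "k < length (\<theta> C)" for C k
    using \<theta>[OF that(1)] that(2) nth_mem by blast
  let ?sz = "\<lambda>(C, i, k). inst_size nc C"
  interpret improvisable_class nc S \<theta> bnd
  proof unfold_locales
    show "poly_computed (queries S \<theta>) ?sz (\<lambda>(C, i, k). query_val nc C i (\<theta> C ! k))
        (\<lambda>(C, i, k). nat_val (card (class_words C i (\<theta> C ! k))))"
      by (rule poly_sampledI[OF query_size pb_poly[of _ _ r], where c = B])
        (use B labels elem in \<open>auto simp: queries_def runs_def\<close>)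
    have "poly_bounded {(C, i, k) \<in> queries S \<theta>. class_words C i (\<theta> C ! k) \<noteq> {}} ?sz
        (\<lambda>x. val_size (case x of (C, i, k) \<Rightarrow> query_val nc C i (\<theta> C ! k)))"
      by (rule pb_reindex[OF query_size, where h = "\<lambda>x. x"]) auto
    then show "poly_sampled {(C, i, k) \<in> queries S \<theta>. class_words C i (\<theta> C ! k) \<noteq> {}} ?sz
        (\<lambda>(C, i, k). query_val nc C i (\<theta> C ! k))
        (\<lambda>(C, i, k). map_spmf word_val (spmf_of_set (class_words C i (\<theta> C ! k))))"
    proof (rule poly_sampledI[OF _ pb_poly[of _ _ s]])
      fix x assume x: "x \<in> {(C, i, k) \<in> queries S \<theta>. class_words C i (\<theta> C ! k) \<noteq> {}}"
      obtain C i k where Cik: "x = (C, i, k)" by (cases x)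
      have "C \<in> S" "i < length (labels C)" "\<theta> C ! k \<in> costs C" "class_words C i (\<theta> C ! k) \<noteq> {}"
        using x labels elem by (auto simp: Cik queries_def)
      with G show "runs G (case x of (C, i, k) \<Rightarrow> query_val nc C i (\<theta> C ! k))
          (case x of (C, i, k) \<Rightarrow> map_spmf word_val (spmf_of_set (class_words C i (\<theta> C ! k))))
          (poly s (?sz x))"
        unfolding runs_def Cik prod.case by blast
    qed
  qed (simp add: bnd_def del: val_size.simps)
  show ?thesis by (rule poly_time_scheme[OF costs])
qed

end
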